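(* Let $\mathcal F$ be the canonical polygon for a signature $(g;m_1,\dots,m_r;t)$, $t\ge1$, let $\mathcal A=\{A_1,\dots,A_N\}$ be a partition of $\mathbb S$ with $A_k=V_k$ for ideal $V_k$ and $A_k\in(V_{k-1},V_{k+1})$ for elliptic $V_k$, and let $F_{\mathcal A}$ be the associated natural extension map. If each elliptic partition point satisfies $A_k\in[P_k,Q_k]$, then the set $\Omega_{\mathcal A}$ defined in the context is the global attractor of $F_{\mathcal A}$. Moreover, for any initial point $(u_0,w_0)\in(\mathbb S\times\mathbb S)\setminus\Delta$, there exists $K>0$ for which $F_{\mathcal A}^K(u_0,w_0)\in\Omega_{\mathcal A}$.
   Context: $\mathbb D$ is the unit disk model of the hyperbolic plane, $\mathbb S=\partial\mathbb D$, $\Delta$ the diagonal of $\mathbb S\times\mathbb S$; $[x,y]\subset\mathbb S$ denotes the counter-clockwise arc from $x$ to $y$. A signature $(g;m_1,\dots,m_r;t)$ consists of $g\ge0$, $2\le m_1\le\dots\le m_r$, and $t$, with $2g-2+\sum(1-1/m_i)+t>0$. Canonical polygon $\mathcal F$ for a signature with $t\ge1$. Put $\ell=g+r+t-1$, $N=4g+2r+2(t-1)$. It is a convex polygon with vertices $V_0=1,V_1,\dots,V_N=V_0$ counter-clockwise and sides $V_{k-1}V_k$, all of infinite length. The first $4g$ sides form $g$ quadruples of adjacent complete geodesics; in the $k$-th quadruple (from $V_{4k-4}$ to $V_{4k}$) the first side is glued to the third by a hyperbolic $a_k$ ($V_{4k-4}\mapsto V_{4k-1}$, $V_{4k-3}\mapsto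 V_{4k-2}$) and the fourth to the second by a hyperbolic $b_k$ ($V_{4k-1}\mapsto V_{4k-2}$, $V_{4k}\mapsto V_{4k-3}$). The next $2r$ sides are geodesic rays in $r$ adjacent pairs; the $i$-th pair meets at a vertex in $\mathbb D$ (an elliptic vertex of order $m_i$) with angle $2\pi/m_i$ and is glued by an elliptic transformation fixing that vertex. The last $2(t-1)$ sides form $t-1$ adjacent pairs of complete geodesics meeting at a point of $\mathbb S$, each glued by a parabolic transformation fixing that point. Each glued side is an arc of an isometric circle of its side-pairing transformation (if $\ell=2$, $m_i=2$, the pair lies on a diameter with vertex $0$ and is glued by $z\mapsto-z$). Further, $\arg V_{4k}=\frac{2\pi}{\ell}k$ ($0\le k\le g$), $\arg V_{4g+2j}=\frac{2\pi}{\ell}(g+j)$ ($1\le j\le r+t-1$), and the vertices of each quadruple are equally spaced on $\mathbb S$. $\gamma_k$ denotes the side-pairing mapping side $V_{k-1}V_k$ to its paired side. Vertices on $\mathbb S$ are called ideal. For an elliptic vertex $V_k\in\mathbb D$, $P_k,Q_k\in\mathbb S$ are the points such that $V_k$ is the intersection of the complete geodesics $V_{k-1}Q_k$ and $P_kV_{k+1}$; $A_k$ is then called an elliptic partition point. Natural extension: $F_{\mathcal A}(u,w)=(\gamma_k(u),\gamma_k(w))$ for $w\in[A_{k-1},A_k)$ (with $A_0=A_N$), on $(\mathbb S\times\mathbb S)\setminus\Delta$. Global attractor of $F_{\mathcal A}$: the set $\overline{\bigcap_{n=0}^\infty F_{\mathcal A}^n\big((\mathbb S\times\mathbb S)\setminus\Delta\big)}$,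 which is described as a bijectivity domain to which every point is mapped. The set $\Omega_{\mathcal A}$. Let $v=e^{\pi i/\ell}$, $v^{\alpha}=e^{\alpha\pi i/\ell}$, $R(z)=e^{2\pi i/\ell}z$, and let $(s_1,\dots,s_\ell)=(\square,\dots,\square,m_1,\dots,m_r,\infty,\dots,\infty)$ with $g$ symbols $\square$ and $t-1$ symbols $\infty$. Then $$\Omega_{\mathcal A}=\bigcup_{n=1}^{\ell}(R^{n-1}\times R^{n-1})\,\Omega_n,$$ where $\Omega_n\subset\mathbb S\times[1,v^2]$ is as follows. If $s_n=\square$: $\Omega_n=([v^{1/2},1]\times[1,v^{1/2}])\cup([v,v^{1/2}]\times[v^{1/2},v])\cup([v^{3/2},v]\times[v,v^{3/2}])\cup([v^2,v^{3/2}]\times[v^{3/2},v^2])$. If $s_n=2$: $\Omega_n=[v^2,1]\times[1,v^2]$. If $s_n=\infty$: $\Omega_n=([v,1]\times[1,v])\cup([v^2,v]\times[v,v^2])$. If $s_n=m$ with $3\le m<\infty$: let $k=4g+2(n-g)-1$ (so $V_k$ is the elliptic vertex in the $n$-th sector), let $a=R^{-(n-1)}(A_k)\in(1,v^2)$, and let $c_m=R^{-(n-1)}\circ\gamma_k\circ R^{n-1}$, which is the clockwise hyperbolic rotation by $2\pi/m$ about the point $R^{-(n-1)}(V_k)$ and satisfies $c_m(1)=v^2$. The integers $I,J$ are defined as follows. If $c_m^j(a)\ne1$ for all integers $j$, then $J$ is the smallest non-negative integer such that $c_m^{J+1}(a)$ is not in the open arc $(1,v^2)$, and $I=m-J-2$.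 In the special case that $c_m^{j}(a)=1$ for some $j$ (take the least positive such $j$), put $i=m-j-2$ and then $I=i-1$, $J=j$. Then $\Omega_n=\bigcup_{i=1}^{I+1}\mathcal U_m(i)\cup\bigcup_{j=1}^{J+1}\mathcal L_m(j)$ with $\mathcal U_m(i)=[v^2,c_m^{-i+1}(1)]\times[c_m^{-i+1}(a),c_m^{-i}(a)]$ for $1\le i\le I$, $\mathcal U_m(I+1)=[v^2,c_m^{-I}(1)]\times[c_m^{-I}(a),v^2]$, $\mathcal L_m(j)=[c_m^{j-1}(v^2),1]\times[c_m^{j}(a),c_m^{j-1}(a)]$ for $1\le j\le J$, $\mathcal L_m(J+1)=[c_m^{J}(v^2),1]\times[1,c_m^{J}(a)]$.
   Formalization: Read literally, the intersection is all of S×S, so the attractor is formulated as: absorbs every point, is forward invariant, equals the closure of the intersection of F^n(Ω∖Δ), and F is bijective on it up to a null set; in the special case j is least ≥0 with c_m^{j+1}(a)=1. *)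

theory Defs
  imports "HOL-Complex_Analysis.Complex_Analysis"
begin

section \<open>The circle at infinity\<close>

text \<open>Counter-clockwise arcs from \<open>x\<close> to \<open>y\<close>; in particular the closed arc from \<open>x\<close> to \<open>x\<close> is the
  single point \<open>x\<close>.\<close>

definition arc_cc :: "complex \<Rightarrow> complex \<Rightarrow> complex set" where
  "arc_cc x y = {z \<in> sphere 0 1. Arg2pi (z / x) \<le> Arg2pi (y / x)}"

definition arc_co :: "complex \<Rightarrow> complex \<Rightarrow> complex set" where
  "arc_co x y = {z \<in> sphere 0 1. Arg2pi (z / x) < Arg2pi (y / x)}"

definition arc_oo :: "complex \<Rightarrow> complex \<Rightarrow> complex set" where
  "arc_oo x y = {z \<in> sphere 0 1. 0 < Arg2pi (z / x) \<and> Arg2pi (z / x) < Arg2pi (y / x)}"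

definition off_diagonal :: "(complex \<times> complex) set" where
  "off_diagonal = (sphere 0 1 \<times> sphere 0 1) - {(u, w). u = w}"

section \<open>Hyperbolic geometry of the unit disk\<close>

text \<open>Orientation-preserving isometries, as Moebius transformations of the plane.\<close>

definition disk_isometry :: "(complex \<Rightarrow> complex) \<Rightarrow> bool" where
  "disk_isometry T \<longleftrightarrow> (\<exists>\<theta> c. cmod c < 1 \<and> T = Moebius_function \<theta> c)"

definition hyperbolic :: "(complex \<Rightarrow> complex) \<Rightarrow> bool" where
  "hyperbolic T \<longleftrightarrow> disk_isometry T \<and> card {z \<in> sphere 0 1. T z = z} = 2"

definition parabolic :: "(complex \<Rightarrow> complex) \<Rightarrow> bool" where
  "parabolic T \<longleftrightarrow> disk_isometry T \<and> card {z \<in> sphere 0 1. T z = z} = 1"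

definition elliptic :: "(complex \<Rightarrow> complex) \<Rightarrow> bool" where
  "elliptic T \<longleftrightarrow> disk_isometry T \<and> (\<exists>!z. z \<in> ball 0 1 \<and> T z = z)"

text \<open>The geodesic segment, ray or complete geodesic joining two points of the closed disk, with its
  end points: the isometric image of a closed subinterval of the diameter \<open>[-1, 1]\<close>.\<close>

definition geodesic :: "complex \<Rightarrow> complex \<Rightarrow> complex set" where
  "geodesic p q = {z. \<exists>T (a::real) b x. disk_isometry T \<and> -1 \<le> a \<and> a \<le> x \<and> x \<le> b \<and> b \<le> 1 \<and>
     T (of_real a) = p \<and> T (of_real b) = q \<and> z = T (of_real x)}"

text \<open>The part of the closed disk lying weakly to the left of the complete geodesic through \<open>p\<close> and \<open>q\<close>,
  directed from \<open>p\<close> to \<open>q\<close>.\<close>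

definition left_half_plane :: "complex \<Rightarrow> complex \<Rightarrow> complex set" where
  "left_half_plane p q = {z. \<exists>T (a::real) b \<zeta>. disk_isometry T \<and> -1 \<le> a \<and> a < b \<and> b \<le> 1 \<and>
     T (of_real a) = p \<and> T (of_real b) = q \<and> cmod \<zeta> \<le> 1 \<and> 0 \<le> Im \<zeta> \<and> z = T \<zeta>}"

text \<open>The angle at \<open>q\<close> swept counter-clockwise from the geodesic towards \<open>s\<close> to the geodesic towards \<open>p\<close>,
  i.e. the interior angle at \<open>q\<close> of a counter-clockwise polygon with consecutive vertices \<open>p, q, s\<close>:
  the conformal map \<open>Moebius_function 0 q\<close> sends \<open>q\<close> to 0 and the geodesics from \<open>q\<close> to radii.\<close>

definition interior_angle :: "complex \<Rightarrow> complex \<Rightarrow> complex \<Rightarrow> real" where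
  "interior_angle p q s = Arg2pi (Moebius_function 0 q p / Moebius_function 0 q s)"

definition isometric_circle :: "(complex \<Rightarrow> complex) \<Rightarrow> complex set" where
  "isometric_circle T = {z. cmod (deriv T z) = 1}"

section \<open>Canonical polygons\<close>

definition signature :: "nat \<Rightarrow> nat list \<Rightarrow> nat \<Rightarrow> bool" where
  "signature g ms t \<longleftrightarrow> sorted ms \<and> (\<forall>m\<in>set ms. 2 \<le> m) \<and>
     0 < 2 * real g - 2 + (\<Sum>i<length ms. 1 - 1 / real (ms ! i)) + real t"

definition num_sectors :: "nat \<Rightarrow> nat list \<Rightarrow> nat \<Rightarrow> nat" where
  "num_sectors g ms t = g + length ms + t - 1"

definition num_sides :: "nat \<Rightarrow> nat list \<Rightarrow> nat \<Rightarrow> nat" where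
  "num_sides g ms t = 4 * g + 2 * length ms + 2 * (t - 1)"

definition elliptic_index :: "nat \<Rightarrow> nat list \<Rightarrow> nat \<Rightarrow> bool" where
  "elliptic_index g ms k \<longleftrightarrow> (\<exists>i\<in>{1..length ms}. k = 4 * g + 2 * i - 1)"

text \<open>The polygon is given by its vertices \<open>V 0, \<dots>, V N\<close> and side pairings \<open>\<gamma> 1, \<dots>, \<gamma> N\<close>, side \<open>k\<close>
  being \<open>geodesic (V (k - 1)) (V k)\<close>. In the \<open>k\<close>-th quadruple \<open>a\<^sub>k = \<gamma> (4 * k - 3)\<close>,
  \<open>b\<^sub>k = \<gamma> (4 * k)\<close>, and \<open>\<gamma> (4 * k - 1)\<close>, \<open>\<gamma> (4 * k - 2)\<close> are their inverses. Every side has an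
  ideal end point, so that all sides are automatically of infinite length. The requirement
  \<open>\<gamma> k 0 \<noteq> 0\<close> says that \<open>\<gamma> k\<close> is not a rotation about 0, i.e. that it has an isometric circle.\<close>

locale canonical_polygon =
  fixes g :: nat and ms :: "nat list" and t :: nat
    and V :: "nat \<Rightarrow> complex" and \<gamma> :: "nat \<Rightarrow> complex \<Rightarrow> complex"
  assumes signature: "signature g ms t"
    and cusp: "1 \<le> t"
    and closed_up: "V 0 = 1" "V (num_sides g ms t) = V 0"
    and ideal_vertex: "\<And>k. k \<le> num_sides g ms t \<Longrightarrow> \<not> elliptic_index g ms k \<Longrightarrow> V k \<in> sphere 0 1"
    and elliptic_vertex: "\<And>k. elliptic_index g ms k \<Longrightarrow> V k \<in> ball 0 1"
    and convex_ccw: "\<And>k j. k \<in> {1..num_sides g ms t} \<Longrightarrow> j \<le> num_sides g ms t \<Longrightarrow>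
          V j \<in> left_half_plane (V (k - 1)) (V k)"
    and arg_quadruple: "\<And>k. k \<le> g \<Longrightarrow>
          V (4 * k) = cis (2 * pi / real (num_sectors g ms t) * real k)"
    and arg_pair: "\<And>j. j \<in> {1..length ms + t - 1} \<Longrightarrow>
          V (4 * g + 2 * j) = cis (2 * pi / real (num_sectors g ms t) * real (g + j))"
    and equally_spaced: "\<And>k i. k \<in> {1..g} \<Longrightarrow> i \<le> 4 \<Longrightarrow>
          V (4 * k - 4 + i) = V (4 * k - 4) * cis (real i * (2 * pi / real (num_sectors g ms t)) / 4)"
    and angle: "\<And>i k. i \<in> {1..length ms} \<Longrightarrow> k = 4 * g + 2 * i - 1 \<Longrightarrow>
          interior_angle (V (k - 1)) (V k) (V (k + 1)) = 2 * pi / real (ms ! (i - 1))"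
    and isometry: "\<And>k. k \<in> {1..num_sides g ms t} \<Longrightarrow> disk_isometry (\<gamma> k)"
    and glue_a: "\<And>k. k \<in> {1..g} \<Longrightarrow> hyperbolic (\<gamma> (4 * k - 3)) \<and>
          \<gamma> (4 * k - 3) (V (4 * k - 4)) = V (4 * k - 1) \<and>
          \<gamma> (4 * k - 3) (V (4 * k - 3)) = V (4 * k - 2) \<and>
          (\<forall>z\<in>cball 0 1. \<gamma> (4 * k - 1) (\<gamma> (4 * k - 3) z) = z)"
    and glue_b: "\<And>k. k \<in> {1..g} \<Longrightarrow> hyperbolic (\<gamma> (4 * k)) \<and>
          \<gamma> (4 * k) (V (4 * k - 1)) = V (4 * k - 2) \<and>
          \<gamma> (4 * k) (V (4 * k)) = V (4 * k - 3) \<and>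
          (\<forall>z\<in>cball 0 1. \<gamma> (4 * k - 2) (\<gamma> (4 * k) z) = z)"
    and glue_elliptic: "\<And>k. elliptic_index g ms k \<Longrightarrow> elliptic (\<gamma> k) \<and>
          \<gamma> k (V k) = V k \<and> \<gamma> k (V (k - 1)) = V (k + 1) \<and>
          (\<forall>z\<in>cball 0 1. \<gamma> (k + 1) (\<gamma> k z) = z)"
    and glue_parabolic: "\<And>j k. j \<in> {1..t - 1} \<Longrightarrow> k = 4 * g + 2 * length ms + 2 * j - 1 \<Longrightarrow>
          parabolic (\<gamma> k) \<and>
          \<gamma> k (V k) = V k \<and> \<gamma> k (V (k - 1)) = V (k + 1) \<and>
          (\<forall>z\<in>cball 0 1. \<gamma> (k + 1) (\<gamma> k z) = z)"
    and diameter: "\<And>i k. num_sectors g ms t = 2 \<Longrightarrow> i \<in> {1..length ms} \<Longrightarrow> ms ! (i - 1) = 2 \<Longrightarrow>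
          k = 4 * g + 2 * i - 1 \<Longrightarrow>
          V k = 0 \<and> (\<forall>z\<in>cball 0 1. \<gamma> k z = - z \<and> \<gamma> (k + 1) z = - z)"
    and isometric: "\<And>k. k \<in> {1..num_sides g ms t} \<Longrightarrow>
          \<not> (num_sectors g ms t = 2 \<and>
             (\<exists>i\<in>{1..length ms}. ms ! (i - 1) = 2 \<and> k \<in> {4 * g + 2 * i - 1, 4 * g + 2 * i})) \<Longrightarrow>
          \<gamma> k 0 \<noteq> 0 \<and> geodesic (V (k - 1)) (V k) \<subseteq> isometric_circle (\<gamma> k)"

text \<open>The second end point of the complete geodesic that starts at \<open>p\<close> on the circle and passes through
  \<open>z\<close> in the open disk. For \<open>m\<^sub>i = 2\<close> both complete geodesics through \<open>V\<^sub>k\<close> coincide, with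
  \<open>P\<^sub>k = V\<^bsub>k-1\<^esub>\<close> and \<open>Q\<^sub>k = V\<^bsub>k+1\<^esub>\<close>.\<close>

definition geodesic_end :: "complex \<Rightarrow> complex \<Rightarrow> complex" where
  "geodesic_end p z = (THE q. q \<in> sphere 0 1 \<and> z \<in> geodesic p q)"

definition P_point :: "(nat \<Rightarrow> complex) \<Rightarrow> nat \<Rightarrow> complex" where
  "P_point V k = geodesic_end (V (k + 1)) (V k)"

definition Q_point :: "(nat \<Rightarrow> complex) \<Rightarrow> nat \<Rightarrow> complex" where
  "Q_point V k = geodesic_end (V (k - 1)) (V k)"

section \<open>The natural extension\<close>

definition boundary_partition ::
    "nat \<Rightarrow> nat list \<Rightarrow> nat \<Rightarrow> (nat \<Rightarrow> complex) \<Rightarrow> (nat \<Rightarrow> complex) \<Rightarrow> bool" where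
  "boundary_partition g ms t V A \<longleftrightarrow>
     (\<forall>k\<in>{1..num_sides g ms t}.
        if elliptic_index g ms k then A k \<in> arc_oo (V (k - 1)) (V (k + 1)) else A k = V k) \<and>
     A 0 = A (num_sides g ms t)"

definition natural_extension ::
    "nat \<Rightarrow> (nat \<Rightarrow> complex \<Rightarrow> complex) \<Rightarrow> (nat \<Rightarrow> complex) \<Rightarrow> complex \<times> complex \<Rightarrow> complex \<times> complex" where
  "natural_extension N \<gamma> A = (\<lambda>(u, w).
     let k = (THE k. k \<in> {1..N} \<and> w \<in> arc_co (A (k - 1)) (A k)) in (\<gamma> k u, \<gamma> k w))"

section \<open>Global attractors\<close>

text \<open>Null sets for the product of arc length with itself on the torus.\<close>

definition torus_null :: "(complex \<times> complex) set \<Rightarrow> bool" where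
  "torus_null Z \<longleftrightarrow> negligible {p :: real \<times> real. (cis (fst p), cis (snd p)) \<in> Z}"

text \<open>A closed set \<open>D\<close> is a global attractor of \<open>F : X \<rightarrow> X\<close> if every point of \<open>X\<close> is mapped to it, \<open>F\<close> does
  not leave it, the iterated images decrease to it (up to closure), and it is a bijectivity domain
  of \<open>F\<close> up to a null set. The exceptional set is unavoidable: for half-open partitions \<open>F\<close>
  is bijective on the attractor only up to boundary segments.

  The iterated images are those of the trapping region \<open>D \<inter> X\<close>, into which every orbit falls. They
  cannot be those of all of \<open>X\<close>: the number of steps needed to enter \<open>D\<close> is unbounded near the
  diagonal, and a natural extension of a surjective boundary map by bijections \<open>\<gamma>\<^sub>k\<close>
  maps \<open>X\<close>, the complement of the diagonal, onto itself, so that \<open>\<Inter>n. (F ^^ n) ` X\<close> would just be \<open>X\<close>.\<close>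

definition global_attractor ::
    "(complex \<times> complex \<Rightarrow> complex \<times> complex) \<Rightarrow> (complex \<times> complex) set \<Rightarrow> (complex \<times> complex) set \<Rightarrow> bool" where
  "global_attractor F X D \<longleftrightarrow>
     (\<forall>x\<in>X. \<exists>n. (F ^^ n) x \<in> D) \<and>
     F ` (D \<inter> X) \<subseteq> D \<inter> X \<and>
     D = closure (\<Inter>n. (F ^^ n) ` (D \<inter> X)) \<and>
     (\<exists>Z. torus_null Z \<and> bij_betw F (D - Z) (D - Z))"

section \<open>The set \<open>\<Omega>\<close>\<close>

definition v_pow :: "nat \<Rightarrow> real \<Rightarrow> complex" where
  "v_pow l \<alpha> = cis (\<alpha> * pi / real l)"

text \<open>Integer iterates of a bijection of the circle.\<close>

definition int_iterate :: "(complex \<Rightarrow> complex) \<Rightarrow> int \<Rightarrow> complex \<Rightarrow> complex" where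
  "int_iterate c j =
     (if 0 \<le> j then c ^^ nat j else inv_into (sphere 0 1) c ^^ nat (- j))"

definition Omega_square :: "nat \<Rightarrow> (complex \<times> complex) set" where
  "Omega_square l = (let v = v_pow l in
     arc_cc (v (1/2)) 1 \<times> arc_cc 1 (v (1/2)) \<union>
     arc_cc (v 1) (v (1/2)) \<times> arc_cc (v (1/2)) (v 1) \<union>
     arc_cc (v (3/2)) (v 1) \<times> arc_cc (v 1) (v (3/2)) \<union>
     arc_cc (v 2) (v (3/2)) \<times> arc_cc (v (3/2)) (v 2))"

definition Omega_two :: "nat \<Rightarrow> (complex \<times> complex) set" where
  "Omega_two l = arc_cc (v_pow l 2) 1 \<times> arc_cc 1 (v_pow l 2)"

definition Omega_cusp :: "nat \<Rightarrow> (complex \<times> complex) set" where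
  "Omega_cusp l =
     arc_cc (v_pow l 1) 1 \<times> arc_cc 1 (v_pow l 1) \<union>
     arc_cc (v_pow l 2) (v_pow l 1) \<times> arc_cc (v_pow l 1) (v_pow l 2)"

text \<open>The pair \<open>(I, J)\<close> for an elliptic sector of order \<open>m \<ge> 3\<close>. The rotation \<open>c\<close> moves \<open>a\<close> clockwise, and
  the exponent \<open>J + 1\<close>, respectively \<open>j + 1\<close>, is the first one for which \<open>a\<close> leaves the open
  arc. In the special case \<open>c\<^bsup>j+1\<^esup>(a) = 1\<close>, whence \<open>c\<^bsup>-i\<^esup>(a) = c(1) = v\<^sup>2\<close> for \<open>i = m - j - 2\<close>; the
  strip \<open>I + 1 = i + 1\<close> would be degenerate, hence \<open>I = i - 1\<close>.\<close>

definition elliptic_IJ :: "nat \<Rightarrow> nat \<Rightarrow> (complex \<Rightarrow> complex) \<Rightarrow> complex \<Rightarrow> nat \<times> nat" where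
  "elliptic_IJ l m c a =
     (if \<exists>j. int_iterate c j a = 1
      then (let j = (LEAST j. (c ^^ (j + 1)) a = 1); i = m - j - 2 in (i - 1, j))
      else (let J = (LEAST J. (c ^^ (J + 1)) a \<notin> arc_oo 1 (v_pow l 2)) in (m - J - 2, J)))"

definition U_strip :: "nat \<Rightarrow> (complex \<Rightarrow> complex) \<Rightarrow> complex \<Rightarrow> nat \<Rightarrow> nat \<Rightarrow> (complex \<times> complex) set" where
  "U_strip l c a I i =
     arc_cc (v_pow l 2) (int_iterate c (1 - int i) 1) \<times>
     arc_cc (int_iterate c (1 - int i) a) (if i \<le> I then int_iterate c (- int i) a else v_pow l 2)"

definition L_strip :: "nat \<Rightarrow> (complex \<Rightarrow> complex) \<Rightarrow> complex \<Rightarrow> nat \<Rightarrow> nat \<Rightarrow> (complex \<times> complex) set" where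
  "L_strip l c a J j =
     arc_cc (int_iterate c (int j - 1) (v_pow l 2)) 1 \<times>
     arc_cc (if j \<le> J then int_iterate c (int j) a else 1) (int_iterate c (int j - 1) a)"

definition Omega_elliptic :: "nat \<Rightarrow> nat \<Rightarrow> (complex \<Rightarrow> complex) \<Rightarrow> complex \<Rightarrow> (complex \<times> complex) set" where
  "Omega_elliptic l m c a = (case elliptic_IJ l m c a of (I, J) \<Rightarrow>
     (\<Union>i\<in>{1..I + 1}. U_strip l c a I i) \<union> (\<Union>j\<in>{1..J + 1}. L_strip l c a J j))"

text \<open>The set \<open>\<Omega>\<^sub>n\<close>; with \<open>\<rho> = v\<^bsup>2(n-1)\<^esup>\<close>, multiplication by \<open>\<rho>\<close> is \<open>R\<^bsup>n-1\<^esup>\<close>.\<close>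

definition Omega_sector ::
    "nat \<Rightarrow> nat list \<Rightarrow> nat \<Rightarrow> (nat \<Rightarrow> complex \<Rightarrow> complex) \<Rightarrow> (nat \<Rightarrow> complex) \<Rightarrow> nat \<Rightarrow> (complex \<times> complex) set" where
  "Omega_sector g ms t \<gamma> A n =
     (let l = num_sectors g ms t in
      if n \<le> g then Omega_square l
      else if n \<le> g + length ms then
        (let m = ms ! (n - g - 1); k = 4 * g + 2 * (n - g) - 1; \<rho> = v_pow l (2 * (real n - 1)) in
         if m = 2 then Omega_two l else Omega_elliptic l m (\<lambda>z. \<gamma> k (\<rho> * z) / \<rho>) (A k / \<rho>))
      else Omega_cusp l)"

definition Omega ::
    "nat \<Rightarrow> nat list \<Rightarrow> nat \<Rightarrow> (nat \<Rightarrow> complex \<Rightarrow> complex) \<Rightarrow> (nat \<Rightarrow> complex) \<Rightarrow> (complex \<times> complex) set" where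
  "Omega g ms t \<gamma> A =
     (\<Union>n\<in>{1..num_sectors g ms t}.
        (\<lambda>(u, w). (v_pow (num_sectors g ms t) (2 * (real n - 1)) * u,
                   v_pow (num_sectors g ms t) (2 * (real n - 1)) * w)) ` Omega_sector g ms t \<gamma> A n)"

end

theory Submission
  imports Defs
begin

text \<open>Cut the circle into the arcs under single ideal sides and under pairs of sides meeting at an elliptic
  vertex. Around an elliptic vertex of order \<open>m\<close> the circle is parametrised by \<open>[0, m)\<close> so that both
  pairings become shifts by 1; in these coordinates a half-open version of the set of strips consists
  of all pairs lying in different arcs together with explicit integer strips, and \<open>F\<close> permutes it
  bijectively. Its closure is \<open>\<Omega>\<close>.

  A point whose orbit avoids this set always has both coordinates in a common arc, and leaves that arc
  by a side pairing or by a rotation about an elliptic vertex. Such a map does not decrease the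
  chord between the coordinates, and preserves it only if the images are the end points of the arc
  that the map avoids or, for a diametral side pair, always; but no other arc has these two end points, and
  diametral pairs do not occur twice in a row. By compactness the orbit would have to
  start on the diagonal.\<close>


section \<open>Arcs of the circle\<close>

text \<open>The obstacle is that one step of \<open>F\<close> may shorten the chord: at an elliptic
  vertex the pairing is chosen by the second coordinate alone, and the first may lie outside its
  isometric circle. Therefore all steps spent in one sector are combined into a single rotation
  about the vertex \<open>p\<close>. Turning clockwise or counter-clockwise until the sector is left
  gives the same rotation modulo a full turn, determined by the unit interval in which both
  coordinates start. Its effect on chords is read off from distances to \<open>p\<close>, because |z
  - w| / (|z - p| |w - p|) is invariant under rotations about \<open>p\<close>; since
  \<open>p\<close> lies on the bisector of the sector and not beyond the centre, points under the
  sector are at most as far from \<open>p\<close> as points outside it. Half-open arcs are used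
  because a pairing carries such an arc exactly onto the complement of another one, which makes
  \<open>F\<close> bijective on the half-open domain with no exceptional points. The price is that
  invariance of the closure needs its own argument, as \<open>F\<close> jumps at the partition
  points.\<close>

lemma sphere_eq_cis_plus:
  assumes "z \<in> sphere 0 1"
  shows "z = cis (\<alpha> + Arg2pi (z / cis \<alpha>))"
proof -
  have "cmod (z / cis \<alpha>) = 1"
    using assms by (simp add: norm_divide)
  then have "cis (Arg2pi (z / cis \<alpha>)) = z / cis \<alpha>"
    unfolding complex_norm_eq_1_exp by (simp only: cis_conv_exp)
  then have "cis \<alpha> * cis (Arg2pi (z / cis \<alpha>)) = z"
    by (simp only:) simp
  then show ?thesis
    by (simp only: cis_mult)
qed

lemma sphere_eq_cis: "z \<in> sphere 0 1 \<Longrightarrow> z = cis (Arg2pi z)"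
  using sphere_eq_cis_plus [of z 0] by simp

lemma Arg2pi_cis_divide:
  assumes "\<alpha> \<le> \<beta>" "\<beta> < \<alpha> + 2 * pi"
  shows "Arg2pi (cis \<beta> / cis \<alpha>) = \<beta> - \<alpha>"
  by (rule Arg2pi_unique [of 1]) (use assms in \<open>auto simp: cis_divide cis_conv_exp [symmetric] simp del: of_real_diff\<close>)

lemma Arg2pi_cis: "0 \<le> \<beta> \<Longrightarrow> \<beta> < 2 * pi \<Longrightarrow> Arg2pi (cis \<beta>) = \<beta>"
  using Arg2pi_cis_divide [of 0 \<beta>] by simp

lemma cis_inj_on_period: "inj_on cis {\<alpha>..<\<alpha> + 2 * pi}"
proof (rule inj_onI)
  fix x y assume *: "x \<in> {\<alpha>..<\<alpha> + 2 * pi}" "y \<in> {\<alpha>..<\<alpha> + 2 * pi}" "cis x = cis y"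
  have "x - \<alpha> = Arg2pi (cis x / cis \<alpha>)"
    using *(1) by (subst Arg2pi_cis_divide) auto
  also have "\<dots> = Arg2pi (cis y / cis \<alpha>)"
    by (simp only: *(3))
  also have "\<dots> = y - \<alpha>"
    using *(2) by (subst Arg2pi_cis_divide) auto
  finally show "x = y" by simp
qed

lemma cis_image_period: "cis ` {\<alpha>..<\<alpha> + 2 * pi} = sphere 0 1"
proof -
  have "z \<in> cis ` {\<alpha>..<\<alpha> + 2 * pi}" if "z \<in> sphere 0 1" for z
    using sphere_eq_cis_plus [OF that, of \<alpha>] Arg2pi [of "z / cis \<alpha>"]
    by (intro image_eqI [where x = "\<alpha> + Arg2pi (z / cis \<alpha>)"]) auto
  then show ?thesis by auto
qed

lemma cis_add_2pi [simp]: "cis (\<alpha> + 2 * pi) = cis \<alpha>"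
  by (simp add: complex_eq_iff)

lemma
  assumes "\<alpha> \<le> \<beta>" "\<beta> < \<alpha> + 2 * pi"
  shows arc_co_cis: "arc_co (cis \<alpha>) (cis \<beta>) = cis ` {\<alpha>..<\<beta>}"
    and arc_cc_cis: "arc_cc (cis \<alpha>) (cis \<beta>) = cis ` {\<alpha>..\<beta>}"
proof -
  have *: "{z \<in> sphere 0 1. P (Arg2pi (z / cis \<alpha>))} = cis ` {\<delta>. \<alpha> \<le> \<delta> \<and> \<delta> < \<alpha> + 2 * pi \<and> P (\<delta> - \<alpha>)}"
    (is "?L = ?R") for P
  proof
    show "?L \<subseteq> ?R"
    proof
      fix z assume z: "z \<in> ?L"
      then have "z = cis (\<alpha> + Arg2pi (z / cis \<alpha>))" using sphere_eq_cis_plus by blast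
      then show "z \<in> ?R"
        by (rule image_eqI) (use z Arg2pi_ge_0 [of "z / cis \<alpha>"] Arg2pi_lt_2pi [of "z / cis \<alpha>"] in simp)
    qed
    show "?R \<subseteq> ?L"
      by (auto simp: Arg2pi_cis_divide)
  qed
  show "arc_co (cis \<alpha>) (cis \<beta>) = cis ` {\<alpha>..<\<beta>}"
    unfolding arc_co_def Arg2pi_cis_divide [OF assms] * [of "\<lambda>a. a < \<beta> - \<alpha>"]
    by (rule arg_cong [where f = "image cis"]) (use assms in auto)
  show "arc_cc (cis \<alpha>) (cis \<beta>) = cis ` {\<alpha>..\<beta>}"
    unfolding arc_cc_def Arg2pi_cis_divide [OF assms] * [of "\<lambda>a. a \<le> \<beta> - \<alpha>"]
    by (rule arg_cong [where f = "image cis"]) (use assms in auto)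
qed

lemma sphere_pair_cases:
  assumes "x \<in> sphere 0 1" "y \<in> sphere 0 1" "x \<noteq> y"
  obtains \<alpha> \<beta> where "x = cis \<alpha>" "y = cis \<beta>" "\<alpha> < \<beta>" "\<beta> < \<alpha> + 2 * pi"
proof -
  define \<alpha> where "\<alpha> = Arg2pi x"
  have x: "x = cis \<alpha>" unfolding \<alpha>_def by (rule sphere_eq_cis [OF assms(1)])
  have y: "y = cis (\<alpha> + Arg2pi (y / cis \<alpha>))" by (rule sphere_eq_cis_plus [OF assms(2)])
  show ?thesis
    by (rule that [OF x y]) (use Arg2pi [of "y / cis \<alpha>"] x y assms(3) in \<open>auto simp: order_less_le\<close>)
qed

text \<open>The reason for working with half-open arcs: complements stay in the same family, so that
  a gluing that exchanges the inside and the outside of two arcs does so without boundary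
  cases.\<close>

lemma sphere_minus_arc_co:
  assumes "x \<in> sphere 0 1" "y \<in> sphere 0 1" "x \<noteq> y"
  shows "sphere 0 1 - arc_co x y = arc_co y x"
proof -
  obtain \<alpha> \<beta> where *: "x = cis \<alpha>" "y = cis \<beta>" "\<alpha> < \<beta>" "\<beta> < \<alpha> + 2 * pi"
    by (rule sphere_pair_cases [OF assms])
  have "arc_co y x = cis ` {\<beta>..<\<alpha> + 2 * pi}"
    using arc_co_cis [of \<beta> "\<alpha> + 2 * pi"] * by simp
  also have "\<dots> = cis ` ({\<alpha>..<\<alpha> + 2 * pi} - {\<alpha>..<\<beta>})"
    using * by (intro arg_cong2 [where f = image]) auto
  also have "\<dots> = cis ` {\<alpha>..<\<alpha> + 2 * pi} - cis ` {\<alpha>..<\<beta>}"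
    by (rule inj_on_image_set_diff [OF cis_inj_on_period [of \<alpha>]]) (use * in auto)
  finally have "arc_co y x = cis ` {\<alpha>..<\<alpha> + 2 * pi} - cis ` {\<alpha>..<\<beta>}" .
  moreover have "arc_co x y = cis ` {\<alpha>..<\<beta>}"
    using * by (simp add: arc_co_cis)
  ultimately show ?thesis by (simp only: cis_image_period)
qed

lemma arc_co_self [simp]: "arc_co x x = {}"
proof -
  have "Arg2pi (x / x) = 0" by (cases "x = 0") (auto simp: Arg2pi_eq_0)
  then show ?thesis by (auto simp: arc_co_def not_less Arg2pi_ge_0)
qed

lemma closure_cis_image:
  assumes "\<alpha> < \<beta>"
  shows "closure (cis ` {\<alpha>..<\<beta>}) = cis ` {\<alpha>..\<beta>}"
proof
  have "closed (cis ` {\<alpha>..\<beta>})"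
    by (intro compact_imp_closed compact_continuous_image continuous_on_cis continuous_on_id) auto
  then show "closure (cis ` {\<alpha>..<\<beta>}) \<subseteq> cis ` {\<alpha>..\<beta>}"
    by (intro closure_minimal image_mono) auto
  have "cis ` closure {\<alpha>..<\<beta>} \<subseteq> closure (cis ` {\<alpha>..<\<beta>})"
    by (intro image_closure_subset continuous_on_cis continuous_on_id closure_subset closed_closure)
  then show "cis ` {\<alpha>..\<beta>} \<subseteq> closure (cis ` {\<alpha>..<\<beta>})"
    using assms by simp
qed

lemma closure_arc_co:
  assumes "x \<in> sphere 0 1" "y \<in> sphere 0 1" "x \<noteq> y"
  shows "closure (arc_co x y) = arc_cc x y"
  by (rule sphere_pair_cases [OF assms]) (simp add: arc_co_cis arc_cc_cis closure_cis_image)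

lemma arc_cc_eq_insert:
  assumes "x \<in> sphere 0 1" "y \<in> sphere 0 1"
  shows "arc_cc x y = insert y (arc_co x y)"
proof -
  have x: "x = cis (Arg2pi x)" using assms(1) by (rule sphere_eq_cis)
  have zy: "z = y" if "z \<in> sphere 0 1" "Arg2pi (z / x) = Arg2pi (y / x)" for z
    using that(2) sphere_eq_cis_plus [OF that(1), of "Arg2pi x"]
      sphere_eq_cis_plus [OF assms(2), of "Arg2pi x"] by (simp only: x [symmetric])
  show ?thesis
  proof (rule set_eqI)
    fix z show "z \<in> arc_cc x y \<longleftrightarrow> z \<in> insert y (arc_co x y)"
      using zy [of z] assms(2) unfolding arc_cc_def arc_co_def
      by (cases "z \<in> sphere 0 1") (auto simp del: mem_sphere_0)
  qed
qed

lemma rotate_arc: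
  assumes "\<rho> \<in> sphere 0 1"
  shows "(*) \<rho> ` arc_cc x y = arc_cc (\<rho> * x) (\<rho> * y)"
proof -
  have [simp]: "\<rho> \<noteq> 0" using assms by auto
  have "z \<in> (*) \<rho> ` arc_cc x y" if "z \<in> arc_cc (\<rho> * x) (\<rho> * y)" for z
    by (rule image_eqI [of _ _ "z / \<rho>"])
       (use that assms in \<open>auto simp: arc_cc_def norm_divide\<close>)
  moreover have "\<rho> * z \<in> arc_cc (\<rho> * x) (\<rho> * y)" if "z \<in> arc_cc x y" for z
    using that assms by (auto simp: arc_cc_def norm_mult)
  ultimately show ?thesis by auto
qed

text \<open>The sign of \<open>circle_orientation x y z\<close> tells the cyclic order of three points of the circle;
  unlike \<open>Arg2pi\<close> it is manifestly preserved by isometries.\<close>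

definition circle_orientation :: "complex \<Rightarrow> complex \<Rightarrow> complex \<Rightarrow> real" where
  "circle_orientation x y z = Im ((x - y) * (y - z) * (z - x) / (x * y * z))"

text \<open>A chord between two points of the circle is \<open>2 * \<i>\<close> times the sine of
  half the angle difference times a phase; the three phases multiply to \<open>x * y * z\<close>,
  which the definition divides out. What is left is purely imaginary.\<close>

lemma circle_orientation_cis:
  "circle_orientation (cis \<alpha>) (cis \<beta>) (cis \<gamma>) =
     8 * sin ((\<beta> - \<alpha>) / 2) * sin ((\<gamma> - \<beta>) / 2) * sin ((\<gamma> - \<alpha>) / 2) * (-1)"
proof -
  have d: "cis (2 * s) - cis (2 * t) = 2 * \<i> * of_real (sin (s - t)) * (cis s * cis t)" for s t
  proof -
    have "2 * \<i> * of_real (sin (s - t)) = cis (s - t) - cis (t - s)"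
      using sin_minus [of "s - t"] cos_minus [of "s - t"] by (simp add: complex_eq_iff)
    moreover have "s - t + (s + t) = 2 * s" "t - s + (s + t) = 2 * t" by auto
    ultimately show ?thesis
      by (simp add: cis_mult left_diff_distrib)
  qed
  define a b c where "a = \<alpha> / 2" "b = \<beta> / 2" "c = \<gamma> / 2"
  have e: "\<alpha> = 2 * a" "\<beta> = 2 * b" "\<gamma> = 2 * c" by (auto simp: a_b_c_def)
  have m: "cis (2 * s) = cis s * cis s" for s by (simp add: cis_mult)
  have n: "cis s \<noteq> 0" for s by simp
  have "(cis \<alpha> - cis \<beta>) * (cis \<beta> - cis \<gamma>) * (cis \<gamma> - cis \<alpha>) / (cis \<alpha> * cis \<beta> * cis \<gamma>) =
      (2 * \<i>) ^ 3 * of_real (sin (a - b) * sin (b - c) * sin (c - a))"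
    unfolding e d unfolding m using n [of a] n [of b] n [of c] by (simp add: field_simps power3_eq_cube)
  also have "\<dots> = \<i> * of_real (- 8 * (sin (a - b) * sin (b - c) * sin (c - a)))"
    by (simp add: power3_eq_cube)
  finally have "circle_orientation (cis \<alpha>) (cis \<beta>) (cis \<gamma>) = - 8 * (sin (a - b) * sin (b - c) * sin (c - a))"
    unfolding circle_orientation_def by (simp only: Im_i_times Re_complex_of_real)
  moreover have "sin (a - b) = - sin (b - a)" "sin (b - c) = - sin (c - b)"
    by (metis minus_diff_eq sin_minus)+
  ultimately show ?thesis
    by (simp add: a_b_c_def diff_divide_distrib)
qed

text \<open>With all angles lifted to one period starting at \<open>x\<close>, two of the three sine
  factors are positive, and the third has the sign of the difference between the angles of
  \<open>y\<close> and \<open>z\<close>.\<close>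

lemma mem_arc_co_iff_orientation:
  assumes "x \<in> sphere 0 1" "y \<in> sphere 0 1" "z \<in> sphere 0 1" "x \<noteq> y"
  shows "z \<in> arc_co x y \<longleftrightarrow> z = x \<or> circle_orientation x z y < 0"
proof -
  obtain \<alpha> \<beta> where *: "x = cis \<alpha>" "y = cis \<beta>" "\<alpha> < \<beta>" "\<beta> < \<alpha> + 2 * pi"
    by (rule sphere_pair_cases [OF assms(1,2,4)])
  have "z \<in> cis ` {\<alpha>..<\<alpha> + 2 * pi}" using assms(3) by (simp only: cis_image_period)
  then obtain \<delta> where d: "z = cis \<delta>" "\<alpha> \<le> \<delta>" "\<delta> < \<alpha> + 2 * pi"
    by auto
  have "z \<in> arc_co x y \<longleftrightarrow> \<delta> < \<beta>"
    using inj_on_image_mem_iff [OF cis_inj_on_period, of \<delta> \<alpha> "{\<alpha>..<\<beta>}"] * d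
    by (simp add: arc_co_cis)
  moreover have "z = x \<longleftrightarrow> \<delta> = \<alpha>"
    using inj_on_eq_iff [OF cis_inj_on_period, of \<delta> \<alpha> \<alpha>] * d by auto
  moreover have "circle_orientation x z y < 0 \<longleftrightarrow> \<delta> < \<beta>" if "\<delta> \<noteq> \<alpha>"
  proof -
    have "0 < sin ((\<delta> - \<alpha>) / 2)" "0 < sin ((\<beta> - \<alpha>) / 2)"
      using that * d by (auto intro!: sin_gt_zero)
    then have "circle_orientation x z y < 0 \<longleftrightarrow> 0 < sin ((\<beta> - \<delta>) / 2)"
      unfolding * d circle_orientation_cis by (auto simp: zero_less_mult_iff)
    also have "\<dots> \<longleftrightarrow> \<delta> < \<beta>"
    proof (cases "\<delta> < \<beta>")
      case True
      then show ?thesis using * d by (auto intro!: sin_gt_zero)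
    next
      case False
      then have "0 \<le> sin ((\<delta> - \<beta>) / 2)" using * d by (auto intro!: sin_ge_zero)
      moreover have "sin ((\<beta> - \<delta>) / 2) = - sin ((\<delta> - \<beta>) / 2)"
        by (metis minus_diff_eq minus_divide_left sin_minus)
      ultimately show ?thesis using False by auto
    qed
    finally show ?thesis .
  qed
  ultimately show ?thesis using * by auto
qed

section \<open>Moebius transformations of the disk\<close>

lemma of_real_cmod_square: "complex_of_real (cmod z) ^ 2 = z * cnj z"
  by (metis complex_norm_square of_real_power)

lemma Moebius_denominator_nz:
  assumes "cmod c < 1" "z \<in> cball 0 1"
  shows "1 - cnj c * z \<noteq> 0"
proof
  assume "1 - cnj c * z = 0"
  then have "cmod (cnj c * z) = 1" by (metis eq_iff_diff_eq_0 norm_one)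
  moreover have "cmod c * cmod z \<le> cmod c * 1" using assms by (intro mult_left_mono) auto
  ultimately show False using assms by (simp add: norm_mult)
qed

text \<open>On the circle \<open>cnj z\<close> is the inverse of \<open>z\<close>. The last formula
  makes the modulus of the denominator an affine function of \<open>Re (cnj c * z)\<close>, which
  later turns the isometric circle condition into a condition on a sinusoid.\<close>

lemma Moebius_denominator_sphere:
  assumes "z \<in> sphere 0 1"
  shows "z * cnj (1 - cnj c * z) = z - c" "cmod (1 - cnj c * z) = cmod (z - c)"
    "cmod (1 - cnj c * z) ^ 2 = 1 + cmod c ^ 2 - 2 * Re (cnj c * z)"
proof -
  have z: "z * cnj z = 1" using assms by (simp add: complex_norm_square [symmetric])
  show 1: "z * cnj (1 - cnj c * z) = z - c"
    using z by (simp add: algebra_simps)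
  show "cmod (1 - cnj c * z) = cmod (z - c)"
    using assms by (simp add: 1 [symmetric] norm_mult del: complex_cnj_diff)
  have "cmod (1 - cnj c * z) ^ 2 = 1 + cmod c ^ 2 * cmod z ^ 2 - 2 * Re (cnj c * z)"
    unfolding cmod_power2 by (simp add: power2_eq_square algebra_simps)
  then show "cmod (1 - cnj c * z) ^ 2 = 1 + cmod c ^ 2 - 2 * Re (cnj c * z)"
    using assms by simp
qed

lemma Moebius_function_diff:
  assumes "cmod c < 1" "z \<in> cball 0 1" "w \<in> cball 0 1"
  shows "Moebius_function \<theta> c z - Moebius_function \<theta> c w =
     cis \<theta> * of_real (1 - cmod c ^ 2) * (z - w) / ((1 - cnj c * z) * (1 - cnj c * w))"
proof -
  have e: "of_real (1 - cmod c ^ 2) = 1 - c * cnj c" by (simp add: of_real_cmod_square)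
  show ?thesis
    unfolding e using Moebius_denominator_nz [OF assms(1,2)] Moebius_denominator_nz [OF assms(1,3)]
    by (simp add: Moebius_function_def cis_conv_exp divide_simps) (simp add: algebra_simps)
qed

lemma norm_Moebius_function_sphere:
  assumes "cmod c < 1" "z \<in> sphere 0 1"
  shows "cmod (Moebius_function \<theta> c z) = 1"
  using Moebius_denominator_sphere(2) [OF assms(2), of c] Moebius_denominator_nz [OF assms(1), of z] assms
  by (auto simp: Moebius_function_def norm_mult norm_divide)

text \<open>Each denominator \<open>D u\<close> occurs in two of the three differences and once in
  the product of the images, where it comes with \<open>cnj (D u)\<close>. The quotient of the two
  expressions is therefore a real number with the squared moduli of the denominators below and the
  cube of \<open>1 - cmod c ^ 2\<close> above.\<close>

lemma circle_orientation_Moebius: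
  fixes \<theta> :: real
  assumes "cmod c < 1" "x \<in> sphere 0 1" "y \<in> sphere 0 1" "z \<in> sphere 0 1"
  defines "T \<equiv> Moebius_function \<theta> c"
  shows "\<exists>K>0. circle_orientation (T x) (T y) (T z) = K * circle_orientation x y z"
proof -
  define D where "D u = 1 - cnj c * u" for u
  have nz: "D u \<noteq> 0" "u \<noteq> 0" and Tu: "T u = cis \<theta> * u * cnj (D u) / D u" if "u \<in> sphere 0 1" for u
    using that Moebius_denominator_nz [OF assms(1), of u] Moebius_denominator_sphere(1) [OF that, of c]
    by (auto simp: D_def T_def Moebius_function_def cis_conv_exp mult.assoc)
  have diff: "T u - T w = cis \<theta> * of_real (1 - cmod c ^ 2) * (u - w) / (D u * D w)"
    if "u \<in> sphere 0 1" "w \<in> sphere 0 1" for u w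
    unfolding T_def D_def by (rule Moebius_function_diff) (use that assms(1) in auto)
  define k where "k = complex_of_real (1 - cmod c ^ 2)"
  define K where "K = (1 - cmod c ^ 2) ^ 3 / (cmod (D x) ^ 2 * cmod (D y) ^ 2 * cmod (D z) ^ 2)"
  have Keq: "of_real K = k ^ 3 /
      ((D x * cnj (D x)) * (D y * cnj (D y)) * (D z * cnj (D z)))"
    unfolding K_def k_def by (simp add: of_real_cmod_square del: complex_cnj_diff complex_cnj_mult)
  have alg: "(e * k * p / (dx * dy)) * (e * k * q / (dy * dz)) * (e * k * r / (dz * dx)) /
      ((e * x * cx / dx) * (e * y * cy / dy) * (e * z * cz / dz)) =
      k ^ 3 / ((dx * cx) * (dy * cy) * (dz * cz)) * (p * q * r / (x * y * z))"
    if "e \<noteq> 0" "dx \<noteq> 0" "dy \<noteq> 0" "dz \<noteq> 0" "cx \<noteq> 0" "cy \<noteq> 0" "cz \<noteq> 0" "x \<noteq> 0" "y \<noteq> 0" "z \<noteq> 0"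
    for e k p q r dx dy dz cx cy cz x y z :: complex
    using that by (simp add: field_simps power3_eq_cube)
  have "(T x - T y) * (T y - T z) * (T z - T x) / (T x * T y * T z) =
    of_real K * ((x - y) * (y - z) * (z - x) / (x * y * z))"
    unfolding diff [OF assms(2,3)] diff [OF assms(3,4)] diff [OF assms(4,2)]
    unfolding Keq k_def [symmetric] Tu [OF assms(2)] Tu [OF assms(3)] Tu [OF assms(4)]
    by (rule alg) (use nz [OF assms(2)] nz [OF assms(3)] nz [OF assms(4)] in auto)
  moreover have "Im (of_real K * w) = K * Im w" for w by simp
  ultimately have "circle_orientation (T x) (T y) (T z) = K * circle_orientation x y z"
    unfolding circle_orientation_def by (simp only:)
  moreover have "cmod c ^ 2 < 1" using assms(1) by (simp add: abs_square_less_1)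
  then have "0 < K" unfolding K_def using nz assms by (intro divide_pos_pos mult_pos_pos) auto
  ultimately show ?thesis by blast
qed

lemma Moebius_function_right_inverse:
  assumes "cmod c < 1" "y \<in> cball 0 1"
  shows "Moebius_function \<theta> c (Moebius_function 0 (- c) (cis (- \<theta>) * y)) = y"
proof -
  define y' where "y' = cis (- \<theta>) * y"
  have "y' \<in> cball 0 1" using assms by (simp add: y'_def norm_mult)
  then have D: "1 + cnj c * y' \<noteq> 0" using Moebius_denominator_nz [of "- c" y'] assms(1) by simp
  have "cmod c ^ 2 < 1" using assms(1) by (simp add: abs_square_less_1)
  then have k: "1 - c * cnj c \<noteq> 0"
    by (metis complex_norm_square eq_iff_diff_eq_0 less_irrefl of_real_eq_1_iff)
  define z where "z = (y' + c) / (1 + cnj c * y')"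
  have n: "z - c = y' * (1 - c * cnj c) / (1 + cnj c * y')"
    and d: "1 - cnj c * z = (1 - c * cnj c) / (1 + cnj c * y')"
    unfolding z_def using D by (simp_all add: divide_simps) (simp_all add: algebra_simps)
  have "Moebius_function \<theta> c z = cis \<theta> * y'"
    unfolding Moebius_function_def cis_conv_exp [symmetric] n d mult.assoc using D k by (simp add: divide_simps)
  then show ?thesis
    by (simp add: z_def y'_def Moebius_function_def cis_mult mult.assoc [symmetric])
qed

lemma continuous_on_Moebius_function:
  assumes "cmod c < 1"
  shows "continuous_on (cball 0 1) (Moebius_function \<theta> c)"
  unfolding Moebius_function_def
  by (intro continuous_intros) (use Moebius_denominator_nz [OF assms] in auto)

lemma disk_isometryE:
  assumes "disk_isometry T"
  obtains \<theta> c where "cmod c < 1" "T = Moebius_function \<theta> c"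
  using assms by (auto simp: disk_isometry_def)

lemma disk_isometry_continuous_on: "disk_isometry T \<Longrightarrow> continuous_on (cball 0 1) T"
  by (auto elim!: disk_isometryE intro: continuous_on_Moebius_function)

lemma disk_isometry_sphere: "disk_isometry T \<Longrightarrow> z \<in> sphere 0 1 \<Longrightarrow> T z \<in> sphere 0 1"
  by (auto elim!: disk_isometryE simp: norm_Moebius_function_sphere)

lemma Moebius_function_inj:
  assumes "cmod c < 1"
  shows "inj_on (Moebius_function \<theta> c) (cball 0 1)"
proof (rule inj_onI)
  fix z w :: complex
  assume zw: "z \<in> cball 0 1" "w \<in> cball 0 1" "Moebius_function \<theta> c z = Moebius_function \<theta> c w"
  have "cmod c ^ 2 < 1" using assms by (simp add: abs_square_less_1)
  then have "complex_of_real (1 - cmod c ^ 2) \<noteq> 0" by (simp only: of_real_eq_0_iff)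
  then show "z = w"
    using Moebius_function_diff [OF assms zw(1,2), of \<theta>] zw
      Moebius_denominator_nz [OF assms zw(1)] Moebius_denominator_nz [OF assms zw(2)]
    by (simp del: of_real_diff)
qed

lemma disk_isometry_inj: "disk_isometry T \<Longrightarrow> inj_on T (cball 0 1)"
  by (auto elim!: disk_isometryE intro: Moebius_function_inj)

lemma disk_isometry_image_sphere:
  assumes "disk_isometry T"
  shows "T ` sphere 0 1 = sphere 0 1"
proof -
  obtain \<theta> c where c: "cmod c < 1" "T = Moebius_function \<theta> c"
    using assms by (rule disk_isometryE)
  have "y \<in> T ` sphere 0 1" if "y \<in> sphere 0 1" for y
  proof (rule image_eqI)
    show "y = T (Moebius_function 0 (- c) (cis (- \<theta>) * y))"
      using that c by (simp add: Moebius_function_right_inverse)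
    show "Moebius_function 0 (- c) (cis (- \<theta>) * y) \<in> sphere 0 1"
      using that c norm_Moebius_function_sphere [of "- c"] by (simp add: norm_mult)
  qed
  then show ?thesis using disk_isometry_sphere [OF assms] by blast
qed

lemma disk_isometry_eq_iff:
  "disk_isometry T \<Longrightarrow> x \<in> sphere 0 1 \<Longrightarrow> y \<in> sphere 0 1 \<Longrightarrow> T x = T y \<longleftrightarrow> x = y"
  using inj_on_eq_iff [OF disk_isometry_inj, of T x y] by auto

lemma disk_isometry_mem_arc_co:
  assumes T: "disk_isometry T" and x: "x \<in> sphere 0 1" and y: "y \<in> sphere 0 1" and z: "z \<in> sphere 0 1"
  shows "T z \<in> arc_co (T x) (T y) \<longleftrightarrow> z \<in> arc_co x y"
proof (cases "x = y")
  case True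
  then show ?thesis by simp
next
  case False
  obtain \<theta> c where c: "cmod c < 1" "T = Moebius_function \<theta> c"
    using T by (rule disk_isometryE)
  obtain K where "K > 0" "circle_orientation (T x) (T z) (T y) = K * circle_orientation x z y"
    using circle_orientation_Moebius [OF c(1) x z y, of \<theta>] c(2) by auto
  then show ?thesis
    using disk_isometry_eq_iff [OF T x y] disk_isometry_eq_iff [OF T z x] False
      mem_arc_co_iff_orientation [OF x y z]
      mem_arc_co_iff_orientation [of "T x" "T y" "T z"] disk_isometry_sphere [OF T] x y z
    by (auto simp: mult_less_0_iff)
qed

lemma disk_isometry_image_arc_co:
  assumes T: "disk_isometry T" and x: "x \<in> sphere 0 1" and y: "y \<in> sphere 0 1"
  shows "T ` arc_co x y = arc_co (T x) (T y)"
proof -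
  have "arc_co x y \<subseteq> sphere 0 1" "arc_co (T x) (T y) \<subseteq> T ` sphere 0 1"
    unfolding disk_isometry_image_sphere [OF T] by (auto simp: arc_co_def)
  then show ?thesis
    using disk_isometry_mem_arc_co [OF T x y] by (auto simp: subset_iff)
qed

lemma disk_isometry_image_arc_cc:
  assumes T: "disk_isometry T" and x: "x \<in> sphere 0 1" and y: "y \<in> sphere 0 1"
  shows "T ` arc_cc x y = arc_cc (T x) (T y)"
  using disk_isometry_sphere [OF T] x y
  by (simp add: arc_cc_eq_insert disk_isometry_image_arc_co [OF assms])

text \<open>The equality case of the Schwarz lemma: moving the fixed point to 0 turns the isometry
  into a Euclidean rotation. It is computed directly because the identity is needed on the boundary
  circle.\<close>

lemma Moebius_function_fixed_point:
  assumes c: "cmod c < 1" and p: "p \<in> ball 0 1" and pfix: "Moebius_function \<theta> c p = p"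
  obtains \<omega> where "cmod \<omega> = 1"
    "\<And>z. z \<in> cball 0 1 \<Longrightarrow> Moebius_function 0 p (Moebius_function \<theta> c z) = \<omega> * Moebius_function 0 p z"
proof -
  define D where "D u = 1 - cnj c * u" for u
  define T where "T = Moebius_function \<theta> c"
  define k where "k = 1 - c * cnj c"
  have pc: "p \<in> cball 0 1" "cmod p < 1" using p by auto
  have Dnz: "D u \<noteq> 0" if "u \<in> cball 0 1" for u
    unfolding D_def by (rule Moebius_denominator_nz [OF c that])
  have "cmod c ^ 2 < 1" using c by (simp add: abs_square_less_1)
  then have k: "k \<noteq> 0"
    unfolding k_def by (metis complex_norm_square eq_iff_diff_eq_0 less_irrefl of_real_eq_1_iff)
  \<comment> \<open>The derivative of the map at \<open>p\<close>: there
    \<open>cmod (D p) ^ 2\<close> equals \<open>1 - cmod c ^ 2\<close>.\<close>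
  define \<omega> where "\<omega> = cis \<theta> * cnj (D p) / D p"
  have "Moebius_function 0 p (T z) = \<omega> * Moebius_function 0 p z" if z: "z \<in> cball 0 1" for z
  proof -
    have Tz: "T z = cis \<theta> * (z - c) / D z" by (simp add: T_def D_def Moebius_function_def cis_conv_exp)
    have Tp: "p = cis \<theta> * (p - c) / D p" using pfix by (simp add: D_def Moebius_function_def cis_conv_exp)
    have "T z - T p = cis \<theta> * k * (z - p) / (D z * D p)"
      using Moebius_function_diff [OF c z pc(1), of \<theta>] unfolding k_def
      by (simp add: T_def D_def of_real_cmod_square)
    then have 1: "T z - p = cis \<theta> * k * (z - p) / (D z * D p)"
      using pfix by (simp add: T_def)
    have cp: "cnj p = cnj (cis \<theta>) * (cnj p - cnj c) / cnj (D p)"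
      by (subst Tp) (simp add: D_def)
    have cc: "cnj (cis \<theta>) * cis \<theta> = 1" by (simp add: cis_cnj cis_mult)
    have "cnj p * T z = (cnj (cis \<theta>) * cis \<theta>) * ((cnj p - cnj c) * (z - c)) / (cnj (D p) * D z)"
      by (subst cp, subst Tz) simp
    also have "\<dots> = ((cnj p - cnj c) * (z - c)) / (cnj (D p) * D z)" by (simp only: cc mult_1)
    finally have "1 - cnj p * T z = (cnj (D p) * D z - (cnj p - cnj c) * (z - c)) / (cnj (D p) * D z)"
      using Dnz [OF z] Dnz [OF pc(1)] by (simp add: diff_divide_distrib del: complex_cnj_diff)
    also have "cnj (D p) * D z - (cnj p - cnj c) * (z - c) = k * (1 - cnj p * z)"
      by (simp add: D_def k_def algebra_simps)
    finally have 2: "1 - cnj p * T z = k * (1 - cnj p * z) / (cnj (D p) * D z)" .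
    have alg: "(e * k * q / (dz * dp)) / (k * a / (cp * dz)) = e * cp / dp * (q / a)"
      if "dz \<noteq> 0" "dp \<noteq> 0" "cp \<noteq> 0" "k \<noteq> 0" "a \<noteq> 0" for e k q dz dp cp a :: complex
      using that by (simp add: divide_simps)
    show ?thesis
      unfolding Moebius_function_simple 1 2 \<omega>_def
      by (rule alg) (use Dnz [OF z] Dnz [OF pc(1)] k Moebius_denominator_nz [OF pc(2) z] in auto)
  qed
  moreover have "cmod \<omega> = 1"
    using Dnz [OF pc(1)] by (simp add: \<omega>_def norm_mult norm_divide del: complex_cnj_diff)
  ultimately show ?thesis using that unfolding T_def by blast
qed

lemma Moebius_function_chord:
  assumes "cmod c < 1" "z \<in> cball 0 1" "w \<in> cball 0 1"
  shows "cmod (Moebius_function \<theta> c z - Moebius_function \<theta> c w) =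
     (1 - cmod c ^ 2) * cmod (z - w) / (cmod (1 - cnj c * z) * cmod (1 - cnj c * w))"
proof -
  have "cmod c ^ 2 < 1" using assms by (simp add: abs_square_less_1)
  then have "cmod (of_real (1 - cmod c ^ 2)) = 1 - cmod c ^ 2"
    by (simp only: norm_of_real)
  then show ?thesis
    unfolding Moebius_function_diff [OF assms] by (simp only: norm_mult norm_divide norm_cis mult_1)
qed

lemma mem_isometric_circle_Moebius:
  assumes "cmod c < 1" "z \<in> cball 0 1"
  shows "z \<in> isometric_circle (Moebius_function \<theta> c) \<longleftrightarrow> cmod (1 - cnj c * z) ^ 2 = 1 - cmod c ^ 2"
proof -
  have nz: "1 - cnj c * z \<noteq> 0" using assms by (rule Moebius_denominator_nz)
  have "cmod c ^ 2 < 1" using assms by (simp add: abs_square_less_1)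
  then have k: "cmod (of_real (1 - cmod c ^ 2)) = 1 - cmod c ^ 2"
    by (simp only: norm_of_real)
  have "((\<lambda>z. exp (\<i> * of_real \<theta>) * (z - c) / (1 - cnj c * z)) has_field_derivative
     cis \<theta> * (1 - c * cnj c) / (1 - cnj c * z) ^ 2) (at z)"
    using nz by (auto intro!: derivative_eq_intros
        simp: cis_conv_exp power2_eq_square field_simps)
  then have "deriv (Moebius_function \<theta> c) z = cis \<theta> * of_real (1 - cmod c ^ 2) / (1 - cnj c * z) ^ 2"
    unfolding Moebius_function_def by (simp add: DERIV_imp_deriv of_real_cmod_square)
  then have "cmod (deriv (Moebius_function \<theta> c) z) = (1 - cmod c ^ 2) / cmod (1 - cnj c * z) ^ 2"
    by (simp only: norm_mult norm_divide norm_cis mult_1 k norm_power)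
  then show ?thesis
    unfolding isometric_circle_def using nz by (auto simp: divide_eq_eq)
qed

section \<open>Orbits along which a distance can only grow\<close>

text \<open>Along an orbit \<open>d\<close> increases to a limit \<open>l\<close>. A pattern of
  consecutive indices recurs infinitely often, and by compactness the orbit points at these times
  accumulate at some \<open>y\<close>, along whose next two images \<open>d\<close> is constantly
  \<open>l\<close>. So two consecutive maps fail to increase \<open>d\<close>, at least one of them
  is not exceptional, and \<open>strict\<close> gives \<open>l \<le> 0\<close>. The sets
  \<open>L i\<close> record which transitions really occur; their compact hulls \<open>C i\<close>
  are needed because the limit points may fall on the boundary.\<close>

lemma persistent_expansion:
  fixes T :: "'i \<Rightarrow> 'a::metric_space \<Rightarrow> 'a" and d :: "'a \<Rightarrow> real"
  assumes fin: "finite I"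
    and compact: "\<And>i. i \<in> I \<Longrightarrow> compact (C i)"
    and contT: "\<And>i. i \<in> I \<Longrightarrow> continuous_on (C i) (T i)"
    and contd: "continuous_on UNIV d"
    and LC: "\<And>i. i \<in> I \<Longrightarrow> L i \<subseteq> C i"
    and mono: "\<And>i z. i \<in> I \<Longrightarrow> z \<in> C i \<Longrightarrow> d z \<le> d (T i z)"
    and strict: "\<And>i i' x z. i \<in> I - D \<Longrightarrow> i' \<in> I \<Longrightarrow> x \<in> L i \<Longrightarrow> T i x \<in> L i' \<Longrightarrow>
        z \<in> C i \<Longrightarrow> T i z \<in> C i' \<Longrightarrow> d (T i z) = d z \<Longrightarrow> d z \<le> 0"
    and exceptional: "\<And>i i' x. i \<in> I \<Longrightarrow> i' \<in> I \<Longrightarrow> x \<in> L i \<Longrightarrow> T i x \<in> L i' \<Longrightarrow> i \<in> D \<Longrightarrow> i' \<notin> D"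
    and step: "\<And>x. x \<in> S \<Longrightarrow> \<exists>i\<in>I. x \<in> L i \<and> T i x \<in> S"
    and "x \<in> S"
  shows "d x \<le> 0"
proof -
  obtain h where h: "\<And>x. x \<in> S \<Longrightarrow> h x \<in> I \<and> x \<in> L (h x) \<and> T (h x) x \<in> S"
    using step by metis
  define z where "z = rec_nat x (\<lambda>_ y. T (h y) y)"
  define s where "s n = h (z n)" for n
  have z0: "z 0 = x" and zSuc: "z (Suc n) = T (s n) (z n)" for n
    by (simp_all add: z_def s_def)
  have zS: "z n \<in> S" for n
    by (induction n) (use \<open>x \<in> S\<close> h in \<open>auto simp: z0 zSuc s_def\<close>)
  have sI: "s n \<in> I" and zL: "z n \<in> L (s n)" for n
    using h [OF zS, of n] by (auto simp: s_def)
  have zC: "z n \<in> C (s n)" for n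
    using zL LC sI by blast
  have "incseq (\<lambda>n. d (z n))"
    by (rule incseq_SucI) (simp add: zSuc mono sI zC)
  moreover have "bounded (d ` (\<Union>i\<in>I. C i))"
    by (intro compact_imp_bounded compact_continuous_image continuous_on_subset [OF contd] compact_UN fin compact) auto
  then obtain B where "\<And>y. y \<in> (\<Union>i\<in>I. C i) \<Longrightarrow> \<bar>d y\<bar> \<le> B"
    by (auto simp: bounded_iff)
  then have "\<And>n. d (z n) \<le> B"
    using zC sI by (meson UN_I abs_le_D1)
  ultimately obtain l where lim: "(\<lambda>n. d (z n)) \<longlonglongrightarrow> l" and le: "\<And>n. d (z n) \<le> l"
    using incseq_convergent by blast
  \<comment> \<open>Three indices: two consecutive maps, and the set in which the second one must
    land.\<close>
  define f where "f n = (s n, s (Suc n), s (Suc (Suc n)))" for n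
  have "finite (range f)"
    by (rule finite_subset [of _ "I \<times> I \<times> I"]) (use fin sI in \<open>auto simp: f_def\<close>)
  then obtain n0 where inf: "infinite {n. f n = f n0}"
    using pigeonhole_infinite [of UNIV f] by auto
  define r where "r = enumerate {n. f n = f n0}"
  have r: "strict_mono r" "\<And>n. f (r n) = f n0"
    using strict_mono_enumerate [OF inf] enumerate_in_set [OF inf] by (auto simp: r_def)
  define i i' i'' where "i = s n0" "i' = s (Suc n0)" "i'' = s (Suc (Suc n0))"
  note ii = i_i'_i''_def
  have I: "i \<in> I" "i' \<in> I" "i'' \<in> I" using sI by (auto simp: ii)
  have sr: "s (r n) = i" "s (Suc (r n)) = i'" "s (Suc (Suc (r n))) = i''" for n
    using r(2) [of n] by (auto simp: f_def ii)
  have "\<forall>n. z (r n) \<in> C i" using zC [of "r _"] sr by simp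
  then obtain y q where y: "y \<in> C i" "strict_mono q" "((\<lambda>n. z (r n)) \<circ> q) \<longlonglongrightarrow> y"
    using compact [OF I(1)] unfolding compact_def by metis
  define p where "p n = r (q n)" for n
  have p: "strict_mono p" using r(1) y(2) by (auto simp: p_def strict_mono_def)
  have sp: "s (p n) = i" "s (Suc (p n)) = i'" "s (Suc (Suc (p n))) = i''" for n
    by (simp_all add: p_def sr)
  have l0: "(\<lambda>n. z (p n)) \<longlonglongrightarrow> y" using y(3) by (simp add: p_def o_def)
  have zp: "z (p n) \<in> C i" "z (Suc (p n)) \<in> C i'" "z (Suc (Suc (p n))) \<in> C i''" for n
    using zC [of "p n"] zC [of "Suc (p n)"] zC [of "Suc (Suc (p n))"] by (simp_all add: sp)
  have l1: "(\<lambda>n. z (Suc (p n))) \<longlonglongrightarrow> T i y"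
    using continuous_on_tendsto_compose [OF contT [OF I(1)] l0 y(1)] zp by (simp add: zSuc sp)
  have y1: "T i y \<in> C i'"
    by (rule Lim_in_closed_set [OF compact_imp_closed [OF compact [OF I(2)]] _ _ l1]) (use zp in auto)
  have l2: "(\<lambda>n. z (Suc (Suc (p n)))) \<longlonglongrightarrow> T i' (T i y)"
    using continuous_on_tendsto_compose [OF contT [OF I(2)] l1 y1] zp by (simp add: zSuc [of "Suc _"] sp)
  have y2: "T i' (T i y) \<in> C i''"
    by (rule Lim_in_closed_set [OF compact_imp_closed [OF compact [OF I(3)]] _ _ l2]) (use zp in auto)
  have dl: "d t = l" if "(\<lambda>n. z (g n)) \<longlonglongrightarrow> t" "strict_mono g" for t g
  proof (rule LIMSEQ_unique)
    show "(\<lambda>n. d (z (g n))) \<longlonglongrightarrow> d t"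
      using continuous_on_tendsto_compose [OF contd that(1)] by simp
    show "(\<lambda>n. d (z (g n))) \<longlonglongrightarrow> l"
      using LIMSEQ_subseq_LIMSEQ [OF lim that(2)] by (simp add: o_def)
  qed
  have d: "d y = l" "d (T i y) = l" "d (T i' (T i y)) = l"
    using dl [OF l0 p] dl [OF l1] dl [OF l2] p by (auto simp: strict_mono_def)
  have L: "z n0 \<in> L i" "T i (z n0) \<in> L i'" "T i' (T i (z n0)) \<in> L i''"
    using zL [of n0] zL [of "Suc n0"] zL [of "Suc (Suc n0)"] by (simp_all add: zSuc ii)
  have "l \<le> 0"
  proof (cases "i \<in> D")
    case False
    then show ?thesis using strict [of i i' "z n0" y] I L y(1) y1 d by simp
  next
    case True
    \<comment> \<open>An exceptional map may keep \<open>d\<close> constant, so the contradiction is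
      taken one step later, at \<open>T i y\<close>.\<close>
    then have "i' \<notin> D" using exceptional [of i i'] I L by blast
    then show ?thesis using strict [of i' i'' "T i (z n0)" "T i y"] I L y1 y2 d by simp
  qed
  then show ?thesis using le [of 0] z0 by simp
qed

section \<open>Combinatorics of an elliptic sector\<close>

text \<open>Position \<open>x \<in> [0, m)\<close> on the circle is measured around an elliptic vertex of order \<open>m\<close>, one unit
  being one rotation step; the sector occupies \<open>[0, m - 1)\<close> and \<open>a\<close> is the position of the
  partition point.\<close>

definition wrap_down :: "nat \<Rightarrow> real \<Rightarrow> real" where
  "wrap_down m x = (if x < 1 then x - 1 + real m else x - 1)"

definition wrap_up :: "nat \<Rightarrow> real \<Rightarrow> real" where
  "wrap_up m x = (if real m - 1 \<le> x then x + 1 - real m else x + 1)"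

definition elliptic_step :: "nat \<Rightarrow> real \<Rightarrow> real \<times> real \<Rightarrow> real \<times> real" where
  "elliptic_step m a = (\<lambda>(x, y). if y < a then (wrap_down m x, wrap_down m y) else (wrap_up m x, wrap_up m y))"

text \<open>The pairs with \<open>y\<close> in the sector that arise from pairs with
  \<open>x\<close> outside it, in \<open>[m - 1, m)\<close>, by steps that stay on the same side of
  \<open>a\<close>. Below \<open>a\<close>, at most \<open>\<lceil>a - y\<rceil> - 1\<close>
  clockwise steps can have preceded, each pushing \<open>x\<close> one unit further below
  \<open>m\<close>. Above \<open>a\<close>, at most \<open>\<lfloor>y - a\<rfloor>\<close>
  counter-clockwise steps can have preceded, the first of which carries \<open>x\<close> through
  \<open>m\<close> to \<open>[0, 1)\<close>.\<close>

definition elliptic_region :: "nat \<Rightarrow> real \<Rightarrow> (real \<times> real) set" where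
  "elliptic_region m a = {(x, y). 0 \<le> x \<and> x < real m \<and> 0 \<le> y \<and> y < real m - 1 \<and>
     (if y < a then real m - of_int \<lceil>a - y\<rceil> \<le> x else real m - 1 \<le> x \<or> x < of_int \<lfloor>y - a\<rfloor>)}"

text \<open>The domain is restricted by the second coordinate being in the sector, the image by the
  first one being there; this asymmetry is what allows the images of different sectors to fit
  together.\<close>

lemma bij_betw_elliptic_step:
  assumes m: "2 \<le> m" and a: "0 < a" "a < real m - 1"
  shows "bij_betw (elliptic_step m a) (elliptic_region m a)
    {(x, y). 0 \<le> x \<and> x < real m - 1 \<and> 0 \<le> y \<and> y < real m \<and> (real m - 1 \<le> y \<or> (x, y) \<in> elliptic_region m a)}"
    (is "bij_betw ?f ?A ?B")
proof (rule bij_betw_byWitness)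
  \<comment> \<open>The inverse has to recognize the direction of the last step. It was
    counter-clockwise exactly when \<open>x\<close> lies below
    \<open>\<lfloor>y - a\<rfloor>\<close>, also if \<open>y\<close> has just left the
    sector.\<close>
  define h where "h = (\<lambda>(x, y). if x < of_int \<lfloor>y - a\<rfloor> then (wrap_down m x, wrap_down m y)
     else (wrap_up m x, wrap_up m y))"
  have m2: "2 \<le> real m" using m by simp
  note assms = m2 a
  have fl: "\<lceil>a - y\<rceil> = - \<lfloor>y - a\<rfloor>" for y
    by (simp add: ceiling_def)
  have sh: "\<lfloor>y - 1 - a\<rfloor> = \<lfloor>y - a\<rfloor> - 1" "\<lfloor>y + 1 - a\<rfloor> = \<lfloor>y - a\<rfloor> + 1"
    "\<lfloor>y - 1 + real m - a\<rfloor> = \<lfloor>y - a\<rfloor> - 1 + int m" "\<lfloor>y + 1 - real m - a\<rfloor> = \<lfloor>y - a\<rfloor> + 1 - int m" for y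
    by linarith+
  have neg: "real_of_int \<lfloor>y - a\<rfloor> \<le> - 1" if "y < a" for y
    using floor_less_zero [of "y - a"] that by linarith
  have nn: "0 \<le> real_of_int \<lfloor>y - a\<rfloor>" if "a \<le> y" for y
    using zero_le_floor [of "y - a"] that by linarith
  have gap: "real_of_int (j + 1) \<le> real_of_int n" if "real_of_int j < real_of_int n" for j n
    using that by (simp only: of_int_less_iff of_int_le_iff)
  have bd: "real_of_int \<lfloor>y - a\<rfloor> \<le> y - a" "y - a < real_of_int \<lfloor>y - a\<rfloor> + 1" for y
    by linarith+
  have f: "?f (x, y) \<in> ?B \<and> h (?f (x, y)) = (x, y)" if xy: "(x, y) \<in> ?A" for x y
  proof -
    have r: "0 \<le> x" "x < real m" "0 \<le> y" "y < real m - 1" using xy by (auto simp: elliptic_region_def)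
    show ?thesis
    proof (cases "y < a")
      case True
      have x: "real m + of_int \<lfloor>y - a\<rfloor> \<le> x" using xy True by (simp add: elliptic_region_def fl)
      have "- real m < of_int \<lfloor>y - a\<rfloor>" using bd [of y] r assms by linarith
      then have "1 - real m \<le> of_int \<lfloor>y - a\<rfloor>" using gap [of "- int m" "\<lfloor>y - a\<rfloor>"] by simp
      then have x1: "1 \<le> x" using x by linarith
      show ?thesis
      proof (cases "y < 1")
        case y: True
        have "?f (x, y) = (x - 1, y - 1 + real m)" using True y x1 by (simp add: elliptic_step_def wrap_down_def)
        moreover have "\<not> x - 1 < real_of_int (\<lfloor>y - a\<rfloor> - 1 + int m)" using x by simp
        ultimately show ?thesis
          using r y x1 by (simp add: h_def sh wrap_up_def elliptic_region_def)
      next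
        case y: False
        have "?f (x, y) = (x - 1, y - 1)" using True y x1 by (simp add: elliptic_step_def wrap_down_def)
        moreover have "\<not> x - 1 < real_of_int (\<lfloor>y - a\<rfloor> - 1)" using neg [OF True] x1 by simp
        ultimately show ?thesis
          using r y x1 x True by (simp add: h_def sh wrap_up_def elliptic_region_def fl)
      qed
    next
      case False
      have x: "real m - 1 \<le> x \<or> x < of_int \<lfloor>y - a\<rfloor>" using xy False by (simp add: elliptic_region_def)
      have "of_int \<lfloor>y - a\<rfloor> < real m - 1" using bd [of y] r assms by linarith
      then have n: "of_int \<lfloor>y - a\<rfloor> \<le> real m - 2" using gap [of "\<lfloor>y - a\<rfloor>" "int m - 1"] by simp
      have n0: "0 \<le> real_of_int \<lfloor>y - a\<rfloor>" using nn [of y] False by simp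
      show ?thesis
      proof (cases "real m - 1 \<le> x")
        case True
        then have "?f (x, y) = (x + 1 - real m, y + 1)" using False r by (simp add: elliptic_step_def wrap_up_def)
        moreover have "x + 1 - real m < real_of_int (\<lfloor>y - a\<rfloor> + 1)" using n0 r unfolding of_int_add by linarith
        ultimately show ?thesis
          using r True False m2 a by (simp add: h_def sh wrap_down_def elliptic_region_def)
            (intro conjI; use r True m2 in linarith)
      next
        case x': False
        then have "?f (x, y) = (x + 1, y + 1)" using False r by (simp add: elliptic_step_def wrap_up_def)
        moreover have "x + 1 < real_of_int (\<lfloor>y - a\<rfloor> + 1)" using x x' by simp
        moreover have "x + 1 < real m - 1" using n x x' by linarith
        ultimately show ?thesis
          using r x x' False assms by (simp add: h_def sh wrap_down_def elliptic_region_def) linarith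
      qed
    qed
  qed
  have g: "h (x, y) \<in> ?A \<and> ?f (h (x, y)) = (x, y)" if xy: "(x, y) \<in> ?B" for x y
  proof -
    have r: "0 \<le> x" "x < real m - 1" "0 \<le> y" "y < real m" using xy by auto
    show ?thesis
    proof (cases "x < of_int \<lfloor>y - a\<rfloor>")
      case True
      then have "1 \<le> real_of_int \<lfloor>y - a\<rfloor>" using order.strict_trans1 [OF r(1) True] gap [of 0 "\<lfloor>y - a\<rfloor>"] by simp
      then have y: "a + 1 \<le> y" using bd [of y] by linarith
      show ?thesis
      proof (cases "x < 1")
        case x: True
        have "h (x, y) = (x - 1 + real m, y - 1)" using True x y assms by (simp add: h_def wrap_down_def)
        then show ?thesis
          using r x y assms by (simp add: elliptic_step_def sh wrap_up_def elliptic_region_def)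
      next
        case x: False
        have "h (x, y) = (x - 1, y - 1)" using True x y assms by (simp add: h_def wrap_down_def)
        then show ?thesis
          using r x y assms True by (simp add: elliptic_step_def sh wrap_up_def elliptic_region_def)
      qed
    next
      case False
      show ?thesis
      proof (cases "real m - 1 \<le> y")
        case True
        have "of_int \<lfloor>y - a\<rfloor> < real m - 1" using False r by linarith
        then have "of_int \<lfloor>y - a\<rfloor> \<le> real m - 2" using gap [of "\<lfloor>y - a\<rfloor>" "int m - 1"] by simp
        then have y: "y + 1 - real m < a"
          using bd [of y] by linarith
        have "h (x, y) = (x + 1, y + 1 - real m)" using False True r by (simp add: h_def wrap_up_def)
        then show ?thesis
          using r True y False assms by (simp add: elliptic_step_def sh wrap_down_def elliptic_region_def fl)
      next
        case yF: False
        then have reg: "(x, y) \<in> elliptic_region m a" using xy by auto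
        have ya: "y < a" using reg False r by (auto simp: elliptic_region_def split: if_splits)
        have x: "real m + of_int \<lfloor>y - a\<rfloor> \<le> x" using reg ya by (simp add: elliptic_region_def fl)
        then have "real_of_int \<lfloor>y - a\<rfloor> < - 1" using r by linarith
        then have "real_of_int \<lfloor>y - a\<rfloor> \<le> - 2" using gap [of "\<lfloor>y - a\<rfloor>" "- 1"] by simp
        then have y: "y + 1 < a" using bd [of y] by linarith
        have "h (x, y) = (x + 1, y + 1)" using False yF r by (simp add: h_def wrap_up_def)
        then show ?thesis
          using r x y ya assms by (simp add: elliptic_step_def sh wrap_down_def elliptic_region_def fl)
      qed
    qed
  qed
  have f': "?f z \<in> ?B \<and> h (?f z) = z" if "z \<in> ?A" for z
    by (rule f [of "fst z" "snd z", unfolded prod.collapse, OF that])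
  have g': "h z \<in> ?A \<and> ?f (h z) = z" if "z \<in> ?B" for z
    by (rule g [of "fst z" "snd z", unfolded prod.collapse, OF that])
  show "\<forall>z\<in>?A. h (?f z) = z"
    by (rule ballI, rule conjunct2 [OF f'])
  show "?f ` ?A \<subseteq> ?B"
    by (rule image_subsetI, rule conjunct1 [OF f'])
  show "\<forall>z\<in>?B. ?f (h z) = z"
    by (rule ballI, rule conjunct2 [OF g'])
  show "h ` ?B \<subseteq> ?A"
    by (rule image_subsetI, rule conjunct1 [OF g'])
qed

text \<open>The direction never changes before the exit, as moving away from \<open>a\<close> keeps
  \<open>y\<close> on its side. Leaving downwards takes \<open>\<lfloor>y\<rfloor> + 1\<close>
  steps, leaving upwards \<open>m - 1 - \<lfloor>y\<rfloor>\<close>; the two numbers add up to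
  \<open>m\<close>, so both are the same rotation. Either the coordinates get separated by the
  sector on the way, or they lie in the same unit interval and leave together.\<close>

lemma elliptic_exit:
  assumes m: "2 \<le> m" and a: "0 < a" "a < real m - 1"
    and xy: "0 \<le> x" "x < real m - 1" "0 \<le> y" "y < real m - 1"
  shows "\<exists>n>0. (\<forall>j<n. snd ((elliptic_step m a ^^ j) (x, y)) < real m - 1) \<and>
    (case (elliptic_step m a ^^ n) (x, y) of (x', y') \<Rightarrow>
       0 \<le> x' \<and> x' < real m \<and> 0 \<le> y' \<and> y' < real m \<and>
       (x' < real m - 1 \<and> real m - 1 \<le> y' \<or> real m - 1 \<le> x' \<and> y' < real m - 1 \<or>
       (real m - 1 \<le> x' \<and> real m - 1 \<le> y' \<and> \<lfloor>x\<rfloor> = \<lfloor>y\<rfloor> \<and>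
        x' = x + (real m - 1 - of_int \<lfloor>y\<rfloor>) \<and> y' = y + (real m - 1 - of_int \<lfloor>y\<rfloor>))))"
    (is "\<exists>n>0. ?A n x y \<and> ?B n x y")
proof -
  let ?f = "elliptic_step m a"
  have step: "\<exists>n>0. ?A n x y \<and> ?B n x y"
    if h: "?f (x, y) = (x', y')" "y < real m - 1" "\<exists>n>0. ?A n x' y' \<and> ?B n x' y'" "\<lfloor>x\<rfloor> - \<lfloor>y\<rfloor> = \<lfloor>x'\<rfloor> - \<lfloor>y'\<rfloor>"
      "x' - x = of_int (\<lfloor>y'\<rfloor> - \<lfloor>y\<rfloor>)" "y' - y = of_int (\<lfloor>y'\<rfloor> - \<lfloor>y\<rfloor>)" for x y x' y'
  proof -
    obtain n where n': "0 < n \<and> ?A n x' y' \<and> ?B n x' y'" using h(3) ..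
    note n = conjunct1 [OF n'] conjunct1 [OF conjunct2 [OF n']] conjunct2 [OF conjunct2 [OF n']]
    have it: "(?f ^^ Suc j) (x, y) = (?f ^^ j) (x', y')" for j
      by (simp only: funpow_Suc_right o_apply h(1))
    have A: "?A (Suc n) x y"
    proof (intro allI impI)
      fix j assume j: "j < Suc n"
      show "snd ((?f ^^ j) (x, y)) < real m - 1"
      proof (cases j)
        case 0
        then show ?thesis using h(2) by simp
      next
        case (Suc i)
        then have "i < n" using j by simp
        then show ?thesis using n(2) unfolding Suc it by simp
      qed
    qed
    have B: "?B (Suc n) x y"
    proof -
      obtain p q where pq: "(?f ^^ n) (x', y') = (p, q)" by (rule prod.exhaust)
      have e: "\<lfloor>x\<rfloor> = \<lfloor>y\<rfloor> \<longleftrightarrow> \<lfloor>x'\<rfloor> = \<lfloor>y'\<rfloor>"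
        "x + (real m - 1 - of_int \<lfloor>y\<rfloor>) = x' + (real m - 1 - of_int \<lfloor>y'\<rfloor>)"
        "y + (real m - 1 - of_int \<lfloor>y\<rfloor>) = y' + (real m - 1 - of_int \<lfloor>y'\<rfloor>)"
        subgoal using h(4) by linarith
        subgoal using h(5) unfolding of_int_diff by linarith
        subgoal using h(6) unfolding of_int_diff by linarith
        done
      show ?thesis
        using n(3) unfolding it pq split_conv e .
    qed
    show ?thesis
      by (rule exI [of _ "Suc n"], rule conjI [OF zero_less_Suc conjI [OF A B]])
  qed
  have One: "\<exists>n>0. ?A n x y \<and> ?B n x y"
    if "?f (x, y) = (x', y')" "y < real m - 1" "0 \<le> x'" "x' < real m" "0 \<le> y'" "y' < real m"
      "x' < real m - 1 \<and> real m - 1 \<le> y' \<or> real m - 1 \<le> x' \<and> y' < real m - 1 \<or>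
       (real m - 1 \<le> x' \<and> real m - 1 \<le> y' \<and> \<lfloor>x\<rfloor> = \<lfloor>y\<rfloor> \<and>
        x' = x + (real m - 1 - of_int \<lfloor>y\<rfloor>) \<and> y' = y + (real m - 1 - of_int \<lfloor>y\<rfloor>))" for x y x' y'
  proof (intro exI [of _ "1::nat"] conjI)
    show "?A 1 x y" using that(2) by simp
    have "(?f ^^ 1) (x, y) = (x', y')" using that(1) by simp
    then show "?B 1 x y" using that(3-) by (simp only: split_conv simp_thms)
  qed simp
  \<comment> \<open>Clockwise, by induction on the number of whole units left below
    \<open>y\<close>.\<close>
  have down: "\<exists>n>0. ?A n x y \<and> ?B n x y"
    if "0 \<le> x" "x < real m - 1" "0 \<le> y" "y < a" "nat \<lfloor>y\<rfloor> = q" for q x y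
    using that
  proof (induction q arbitrary: x y)
    case 0
    then have "\<lfloor>y\<rfloor> < 1" by simp
    then have y1: "y < 1" by linarith
    then have fl: "\<lfloor>y\<rfloor> = 0" using 0 by linarith
    show ?case
    proof (cases "x < 1")
      case True
      then have fx: "\<lfloor>x\<rfloor> = 0" using 0 by linarith
      have "?f (x, y) = (x - 1 + real m, y - 1 + real m)"
        using 0 y1 True by (simp add: elliptic_step_def wrap_down_def)
      then show ?thesis by (rule One) (use 0 a y1 fl fx True in simp_all)
    next
      case False
      have "?f (x, y) = (x - 1, y - 1 + real m)"
        using 0 y1 False by (simp add: elliptic_step_def wrap_down_def)
      then show ?thesis by (rule One) (use 0 a y1 False in simp_all)
    qed
  next
    case (Suc q)
    then have "1 \<le> \<lfloor>y\<rfloor>" by linarith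
    then have y1: "1 \<le> y" by linarith
    show ?case
    proof (cases "x < 1")
      case True
      have "?f (x, y) = (x - 1 + real m, y - 1)"
        using Suc.prems y1 True by (simp add: elliptic_step_def wrap_down_def)
      then show ?thesis by (rule One) (use Suc.prems a y1 True in simp_all)
    next
      case False
      have f: "?f (x, y) = (x - 1, y - 1)"
        using Suc.prems y1 False by (simp add: elliptic_step_def wrap_down_def)
      have IH: "\<exists>n>0. ?A n (x - 1) (y - 1) \<and> ?B n (x - 1) (y - 1)"
        by (rule Suc.IH) (use Suc.prems y1 False in simp_all)
      show ?thesis
        by (rule step [OF f _ IH]) (use Suc.prems a y1 False in simp_all)
    qed
  qed
  \<comment> \<open>Counter-clockwise, by induction on the number of whole units left between
    \<open>y\<close> and the last unit of the sector.\<close>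
  have up: "\<exists>n>0. ?A n x y \<and> ?B n x y"
    if "0 \<le> x" "x < real m - 1" "a \<le> y" "y < real m - 1" "m - 2 - nat \<lfloor>y\<rfloor> = q" for q x y
    using that
  proof (induction q arbitrary: x y)
    case 0
    have "0 \<le> \<lfloor>y\<rfloor>" using 0 a by simp
    then have "int m - 2 \<le> \<lfloor>y\<rfloor>" using 0 m by linarith
    then have y2: "real m - 2 \<le> y" by linarith
    then have fl: "\<lfloor>y\<rfloor> = int m - 2" using 0 by linarith
    show ?case
    proof (cases "real m - 2 \<le> x")
      case True
      then have fx: "\<lfloor>x\<rfloor> = int m - 2" using 0 by linarith
      have "?f (x, y) = (x + 1, y + 1)"
        using 0 y2 True by (simp add: elliptic_step_def wrap_up_def)
      then show ?thesis by (rule One) (use 0 a y2 fl fx True in simp_all)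
    next
      case False
      have "?f (x, y) = (x + 1, y + 1)"
        using 0 y2 False by (simp add: elliptic_step_def wrap_up_def)
      then show ?thesis by (rule One) (use 0 a y2 False in simp_all)
    qed
  next
    case (Suc q)
    have f0: "0 \<le> \<lfloor>y\<rfloor>" using Suc.prems a by simp
    then have "\<lfloor>y\<rfloor> < int m - 2" using Suc.prems m by linarith
    then have y2: "y < real m - 2" by linarith
    have f: "?f (x, y) = (x + 1, y + 1)"
      using Suc.prems by (simp add: elliptic_step_def wrap_up_def)
    show ?case
    proof (cases "real m - 2 \<le> x")
      case True
      from f show ?thesis by (rule One) (use Suc.prems a y2 True in simp_all)
    next
      case False
      have "nat (\<lfloor>y\<rfloor> + 1) = Suc (nat \<lfloor>y\<rfloor>)" using f0 by linarith
      have IH: "\<exists>n>0. ?A n (x + 1) (y + 1) \<and> ?B n (x + 1) (y + 1)"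
        by (rule Suc.IH) (use \<open>nat (_ + 1) = _\<close> Suc.prems y2 False in simp_all)
      show ?thesis
        by (rule step [OF f _ IH]) (use Suc.prems a y2 False in simp_all)
    qed
  qed
  show ?thesis
    using down [of x y] up [of x y] xy by (cases "y < a") auto
qed

section \<open>Rotations about a point of the disk\<close>

text \<open>The orbit of \<open>q\<close> under the hyperbolic rotations about \<open>p\<close>, where \<open>m\<close> units make a full turn.\<close>

definition rotation_orbit :: "complex \<Rightarrow> complex \<Rightarrow> nat \<Rightarrow> real \<Rightarrow> complex" where
  "rotation_orbit p q m x = Moebius_function 0 (- p) (cis (2 * pi * x / real m) * Moebius_function 0 p q)"

context
  fixes p q :: complex and m :: nat
  assumes p: "p \<in> ball 0 1" and q: "q \<in> sphere 0 1" and m: "2 \<le> m"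
begin

private lemma p': "cmod p < 1" "cmod (- p) < 1"
  using p by auto

lemma rotation_orbit_cis:
  obtains \<beta> where "\<And>x. rotation_orbit p q m x = Moebius_function 0 (- p) (cis (\<beta> + 2 * pi * x / real m))"
proof -
  have "Moebius_function 0 p q \<in> sphere 0 1"
    using norm_Moebius_function_sphere [OF p'(1) q] by simp
  then have "Moebius_function 0 p q = cis (Arg2pi (Moebius_function 0 p q))"
    by (rule sphere_eq_cis)
  then have "cis t * Moebius_function 0 p q = cis (Arg2pi (Moebius_function 0 p q) + t)" for t
    by (metis cis_mult add.commute)
  then show ?thesis using that unfolding rotation_orbit_def by simp
qed

lemma disk_isometry_uncentre: "disk_isometry (Moebius_function 0 (- p))"
  unfolding disk_isometry_def using p'(2) by blast

lemma rotation_orbit_sphere: "rotation_orbit p q m x \<in> sphere 0 1"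
  by (rule rotation_orbit_cis) (use norm_Moebius_function_sphere [OF p'(2)] in simp)

lemma centre_rotation_orbit:
  "Moebius_function 0 p (rotation_orbit p q m x) = cis (2 * pi * x / real m) * Moebius_function 0 p q"
proof -
  have "cis (2 * pi * x / real m) * Moebius_function 0 p q \<in> cball 0 1"
    using norm_Moebius_function_sphere [OF p'(1) q] by (simp add: norm_mult)
  then show ?thesis
    using Moebius_function_right_inverse [OF p'(1), of _ 0] by (simp add: rotation_orbit_def)
qed

lemma rotation_orbit_eqI:
  assumes "z \<in> sphere 0 1" "Moebius_function 0 p z = cis (2 * pi * x / real m) * Moebius_function 0 p q"
  shows "z = rotation_orbit p q m x"
proof -
  have "Moebius_function 0 p z = Moebius_function 0 p (rotation_orbit p q m x)"
    using assms by (simp only: centre_rotation_orbit)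
  then show ?thesis
    using inj_onD [OF Moebius_function_inj [OF p'(1)]] assms(1) rotation_orbit_sphere [of x] by simp
qed

lemma rotation_orbit_0: "rotation_orbit p q m 0 = q"
  using rotation_orbit_eqI [OF q, of 0] by simp

lemma rotation_orbit_period: "rotation_orbit p q m (x + real m) = rotation_orbit p q m x"
proof (rule rotation_orbit_cis)
  fix \<beta>
  assume *: "\<And>x. rotation_orbit p q m x = Moebius_function 0 (- p) (cis (\<beta> + 2 * pi * x / real m))"
  have "\<beta> + 2 * pi * (x + real m) / real m = (\<beta> + 2 * pi * x / real m) + 2 * pi"
    using m by (simp add: field_simps)
  then show ?thesis unfolding * by (simp only: cis_add_2pi)
qed

lemma
  assumes "x \<le> y" "y < x + real m"
  shows arc_co_rotation_orbit:
      "arc_co (rotation_orbit p q m x) (rotation_orbit p q m y) = rotation_orbit p q m ` {x..<y}"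
    and arc_cc_rotation_orbit:
      "arc_cc (rotation_orbit p q m x) (rotation_orbit p q m y) = rotation_orbit p q m ` {x..y}"
    and rotation_orbit_eq_iff: "rotation_orbit p q m x = rotation_orbit p q m y \<longleftrightarrow> x = y"
proof -
  obtain \<beta> where *: "\<And>x. rotation_orbit p q m x = Moebius_function 0 (- p) (cis (\<beta> + 2 * pi * x / real m))"
    by (rule rotation_orbit_cis) blast
  define c h where "c = 2 * pi / real m" and "h x = \<beta> + c * x" for x
  have c: "0 < c" "c * real m = 2 * pi" using m by (auto simp: c_def)
  have o: "rotation_orbit p q m x = Moebius_function 0 (- p) (cis (h x))" for x
    by (simp add: * h_def c_def field_simps)
  have "c * y < c * (x + real m)" using assms c by (intro mult_strict_left_mono) auto
  then have le: "h x \<le> h y" "h y < h x + 2 * pi"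
    using assms c by (simp_all add: h_def algebra_simps)
  have hh: "h ((t - \<beta>) / c) = t" for t using c by (simp add: h_def)
  have mono: "h s \<le> h t \<longleftrightarrow> s \<le> t" "h s < h t \<longleftrightarrow> s < t" for s t using c by (auto simp: h_def)
  have co: "{h x..<h y} = h ` {x..<y}" and cc: "{h x..h y} = h ` {x..y}"
  proof -
    have "t \<in> h ` {x..<y}" if "t \<in> {h x..<h y}" for t
      by (rule image_eqI [of _ _ "(t - \<beta>) / c"]) (use that mono [of _ "(t - \<beta>) / c"] mono [of "(t - \<beta>) / c"] in \<open>auto simp: hh\<close>)
    then show "{h x..<h y} = h ` {x..<y}" using mono by auto
    have "t \<in> h ` {x..y}" if "t \<in> {h x..h y}" for t
      by (rule image_eqI [of _ _ "(t - \<beta>) / c"]) (use that mono [of _ "(t - \<beta>) / c"] mono [of "(t - \<beta>) / c"] in \<open>auto simp: hh\<close>)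
    then show "{h x..h y} = h ` {x..y}" using mono by auto
  qed
  have s: "cis t \<in> sphere 0 1" for t by simp
  show "arc_co (rotation_orbit p q m x) (rotation_orbit p q m y) = rotation_orbit p q m ` {x..<y}"
    unfolding o disk_isometry_image_arc_co [OF disk_isometry_uncentre s s, symmetric]
      arc_co_cis [OF le] co image_image ..
  show "arc_cc (rotation_orbit p q m x) (rotation_orbit p q m y) = rotation_orbit p q m ` {x..y}"
    unfolding o disk_isometry_image_arc_cc [OF disk_isometry_uncentre s s, symmetric]
      arc_cc_cis [OF le] cc image_image ..
  have "x = y" if "rotation_orbit p q m x = rotation_orbit p q m y"
  proof -
    have "cis (h x) = cis (h y)"
      using that unfolding o disk_isometry_eq_iff [OF disk_isometry_uncentre s s] .
    then have "h x = h y"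
      by (rule inj_onD [OF cis_inj_on_period [of "h x"]]) (use le in auto)
    then show ?thesis using c by (simp add: h_def)
  qed
  then show "rotation_orbit p q m x = rotation_orbit p q m y \<longleftrightarrow> x = y" by auto
qed

lemma rotation_orbit_cover:
  assumes "z \<in> sphere 0 1"
  obtains x where "x\<^sub>0 \<le> x" "x < x\<^sub>0 + real m" "z = rotation_orbit p q m x"
proof -
  \<comment> \<open>A full turn is not an arc, as its end points coincide; it is cut one unit before
    its end into an arc and its complement.\<close>
  define y where "y = x\<^sub>0 + real m - 1"
  have r: "x\<^sub>0 \<le> y" "y < x\<^sub>0 + real m" "y \<le> x\<^sub>0 + real m" "x\<^sub>0 + real m < y + real m" using m by (auto simp: y_def)
  have ne: "rotation_orbit p q m x\<^sub>0 \<noteq> rotation_orbit p q m y"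
    using rotation_orbit_eq_iff [OF r(1,2)] m by (auto simp: y_def)
  have "sphere 0 1 - rotation_orbit p q m ` {x\<^sub>0..<y} = rotation_orbit p q m ` {y..<x\<^sub>0 + real m}"
    using sphere_minus_arc_co [OF rotation_orbit_sphere rotation_orbit_sphere ne]
      arc_co_rotation_orbit [OF r(3,4)]
    by (simp only: arc_co_rotation_orbit [OF r(1,2)] rotation_orbit_period)
  then have "z \<in> rotation_orbit p q m ` {x\<^sub>0..<y} \<or> z \<in> rotation_orbit p q m ` {y..<x\<^sub>0 + real m}"
    using assms by blast
  moreover have "rotation_orbit p q m ` {x\<^sub>0..<y} \<subseteq> rotation_orbit p q m ` {x\<^sub>0..<x\<^sub>0 + real m}"
    "rotation_orbit p q m ` {y..<x\<^sub>0 + real m} \<subseteq> rotation_orbit p q m ` {x\<^sub>0..<x\<^sub>0 + real m}"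
    using r by (auto intro!: image_mono)
  ultimately have "z \<in> rotation_orbit p q m ` {x\<^sub>0..<x\<^sub>0 + real m}" by blast
  then show ?thesis by (elim imageE) (rule that, auto)
qed

text \<open>An isometry fixing \<open>p\<close> is multiplication by one unimodular factor after
  centring at \<open>p\<close>, and its value at a single point determines this factor.\<close>

lemma isometry_rotation_orbit:
  assumes "disk_isometry T" "T p = p" "T (rotation_orbit p q m s) = rotation_orbit p q m (s + e)"
  shows "T (rotation_orbit p q m x) = rotation_orbit p q m (x + e)"
proof -
  obtain \<theta> c where c: "cmod c < 1" "T = Moebius_function \<theta> c"
    using assms(1) by (rule disk_isometryE)
  obtain \<omega> where w: "\<And>z. z \<in> cball 0 1 \<Longrightarrow> Moebius_function 0 p (T z) = \<omega> * Moebius_function 0 p z"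
    using Moebius_function_fixed_point [OF c(1) p] assms(2) unfolding c(2) by metis
  define h where "h x = cis (2 * pi * x / real m)" for x
  have hadd: "h (x + y) = h x * h y" for x y
    by (simp add: h_def cis_mult ring_distribs add_divide_distrib)
  have w': "Moebius_function 0 p (T (rotation_orbit p q m x)) = \<omega> * h x * Moebius_function 0 p q" for x
    using w [of "rotation_orbit p q m x"] rotation_orbit_sphere [of x]
    by (simp add: centre_rotation_orbit h_def)
  have "\<omega> * h s * Moebius_function 0 p q = h (s + e) * Moebius_function 0 p q"
    unfolding w' [symmetric] assms(3) by (simp add: centre_rotation_orbit h_def)
  moreover have "Moebius_function 0 p q \<noteq> 0" "h s \<noteq> 0"
    using norm_Moebius_function_sphere [OF p'(1) q, of 0] by (auto simp: h_def)
  ultimately have "\<omega> = h e" by (simp add: hadd)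
  then have "Moebius_function 0 p (T (rotation_orbit p q m x)) = h (x + e) * Moebius_function 0 p q"
    unfolding w' by (simp add: hadd)
  then show ?thesis
    unfolding h_def by (intro rotation_orbit_eqI disk_isometry_sphere [OF assms(1)] rotation_orbit_sphere)
qed

text \<open>Centring at \<open>p\<close> turns the chord of two boundary points into
  \<open>1 - cmod p ^ 2\<close> times the chord divided by both distances to \<open>p\<close>, and
  Euclidean rotations preserve this quantity. How a rotation about \<open>p\<close> stretches chords
  is thus a matter of distances to \<open>p\<close>.\<close>

lemma rotation_orbit_chord:
  fixes e x y :: real
  defines "\<phi> \<equiv> rotation_orbit p q m"
  shows "cmod (\<phi> (x + e) - \<phi> (y + e)) * (cmod (\<phi> x - p) * cmod (\<phi> y - p)) =
    cmod (\<phi> x - \<phi> y) * (cmod (\<phi> (x + e) - p) * cmod (\<phi> (y + e) - p))"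
proof -
  have S: "\<phi> x \<in> sphere 0 1" "\<phi> x \<in> cball 0 1" for x using rotation_orbit_sphere [of x] by (simp_all add: \<phi>_def)
  have nz: "cmod (\<phi> x - p) \<noteq> 0" for x using S(1) [of x] p by auto
  have "cmod p ^ 2 < 1" using p by (simp add: abs_square_less_1)
  then have k: "1 - cmod p ^ 2 \<noteq> 0" by simp
  have M: "cmod (cis (2 * pi * x / real m) * Moebius_function 0 p q - cis (2 * pi * y / real m) * Moebius_function 0 p q) =
     (1 - cmod p ^ 2) * cmod (\<phi> x - \<phi> y) / (cmod (\<phi> x - p) * cmod (\<phi> y - p))" for x y
    using Moebius_function_chord [OF p'(1) S(2) S(2), of 0 x y]
    by (simp only: Moebius_denominator_sphere(2) [OF S(1)]) (simp add: \<phi>_def centre_rotation_orbit)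
  have "cis (2 * pi * (x + e) / real m) = cis (2 * pi * e / real m) * cis (2 * pi * x / real m)" for x
    by (simp add: cis_mult ring_distribs add_divide_distrib add.commute)
  then have "cmod (cis (2 * pi * (x + e) / real m) * Moebius_function 0 p q - cis (2 * pi * (y + e) / real m) * Moebius_function 0 p q) =
    cmod (cis (2 * pi * e / real m) * (cis (2 * pi * x / real m) * Moebius_function 0 p q - cis (2 * pi * y / real m) * Moebius_function 0 p q))"
    by (simp add: right_diff_distrib mult.assoc)
  also have "\<dots> = cmod (cis (2 * pi * x / real m) * Moebius_function 0 p q - cis (2 * pi * y / real m) * Moebius_function 0 p q)"
    by (simp only: norm_mult norm_cis mult_1)
  finally have "(1 - cmod p ^ 2) * (cmod (\<phi> (x + e) - \<phi> (y + e)) / (cmod (\<phi> (x + e) - p) * cmod (\<phi> (y + e) - p))) =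
    (1 - cmod p ^ 2) * (cmod (\<phi> x - \<phi> y) / (cmod (\<phi> x - p) * cmod (\<phi> y - p)))"
    unfolding M times_divide_eq_right .
  then have "cmod (\<phi> (x + e) - \<phi> (y + e)) / (cmod (\<phi> (x + e) - p) * cmod (\<phi> (y + e) - p)) =
    cmod (\<phi> x - \<phi> y) / (cmod (\<phi> x - p) * cmod (\<phi> y - p))"
    using k by (simp only: mult_cancel_left) blast
  then show ?thesis
    using nz [of x] nz [of y] nz [of "x + e"] nz [of "y + e"] by (simp add: frac_eq_eq)
qed

end

section \<open>The polygon and its partition\<close>

locale partitioned_polygon = canonical_polygon +
  fixes A :: "nat \<Rightarrow> complex"
  assumes partition: "boundary_partition g ms t V A"
begin

abbreviation "N \<equiv> num_sides g ms t"
abbreviation "l \<equiv> num_sectors g ms t"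
abbreviation "ell \<equiv> elliptic_index g ms"

definition ord :: "nat \<Rightarrow> nat" where
  "ord k = ms ! ((k - 1 - 4 * g) div 2)"

text \<open>The argument of \<open>V k\<close>, measured in sectors; also for the elliptic vertices, which lie on the
  bisectors of their sectors, and for the cusps.\<close>

definition sector_arg :: "nat \<Rightarrow> real" where
  "sector_arg k = (if k \<le> 4 * g then real k / 4 else real g + (real k - 4 * real g) / 2)"

definition \<theta> :: "nat \<Rightarrow> real" where
  "\<theta> k = 2 * pi / real l * sector_arg k"

text \<open>The side to which side \<open>k\<close> is glued: first with third and second with
  fourth in a quadruple, neighbours in a pair. Since \<open>4 * g\<close> is even, the first side of
  a pair has odd index.\<close>

definition paired :: "nat \<Rightarrow> nat" where
  "paired k = (if k \<le> 4 * g then if (k - 1) mod 4 < 2 then k + 2 else k - 2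
     else if odd k then k + 1 else k - 1)"

lemma N_eq: "N = 4 * g + 2 * (l - g)" "g \<le> l" "l = g + length ms + (t - 1)"
  using cusp by (auto simp: num_sides_def num_sectors_def)

lemma ell_cases:
  assumes "ell k"
  obtains i where "i < length ms" "k = 4 * g + 2 * i + 1" "ord k = ms ! i"
proof -
  obtain i where "i \<in> {1..length ms}" "k = 4 * g + 2 * i - 1"
    using assms by (auto simp: elliptic_index_def)
  moreover from this obtain j where "i = Suc j" by (cases i) auto
  ultimately show ?thesis
    by (intro that [of j]) (auto simp: ord_def)
qed

lemma ell_iff: "ell k \<longleftrightarrow> (\<exists>i<length ms. k = 4 * g + 2 * i + 1)"
proof
  assume "ell k"
  then show "\<exists>i<length ms. k = 4 * g + 2 * i + 1" by (rule ell_cases) blast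
next
  assume "\<exists>i<length ms. k = 4 * g + 2 * i + 1"
  then obtain i where "i < length ms" "k = 4 * g + 2 * i + 1" by blast
  then show "ell k"
    unfolding elliptic_index_def by (intro bexI [of _ "i + 1"]) auto
qed

lemma ellD:
  assumes "ell k"
  shows "1 \<le> k" "k + 1 \<le> N" "k \<in> {1..N}" "k + 1 \<in> {1..N}" "4 * g < k" "odd k" "\<not> ell (k + 1)" "\<not> ell (k - 1)"
    "2 \<le> ord k"
proof -
  obtain i where i: "i < length ms" "k = 4 * g + 2 * i + 1" "ord k = ms ! i"
    using assms by (rule ell_cases)
  show "1 \<le> k" "k + 1 \<le> N" "k \<in> {1..N}" "k + 1 \<in> {1..N}" "4 * g < k" "odd k"
    using i by (auto simp: num_sides_def)
  then show "\<not> ell (k + 1)" "\<not> ell (k - 1)"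
    unfolding ell_iff by presburger+
  show "2 \<le> ord k" using signature i by (auto simp: signature_def)
qed

lemma not_ell_0 [simp]: "\<not> ell 0" "\<not> ell N"
  by (auto dest: ellD(1,2))

text \<open>Positivity of the area: for genus 0 a single sector would leave the area
  \<open>- 1 / m\<close> for a cone point of order \<open>m\<close> with \<open>t = 1\<close>, and
  no cone point with \<open>t \<le> 2\<close> leaves at most 0.\<close>

lemma l_cases: "1 \<le> l" "g = 0 \<Longrightarrow> 2 \<le> l"
proof -
  have s: "0 < 2 * real g - 2 + (\<Sum>i<length ms. 1 - 1 / real (ms ! i)) + real t"
    using signature by (simp add: signature_def)
  have le: "(\<Sum>i<length ms. 1 - 1 / real (ms ! i)) \<le> (\<Sum>i<length ms. 1)"
    by (rule sum_mono) simp
  show 2: "2 \<le> l" if "g = 0"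
  proof (rule ccontr)
    assume "\<not> 2 \<le> l"
    then have "length ms + t \<le> 2" using that cusp by (auto simp: num_sectors_def)
    then consider "length ms = 0" | "length ms = 1" "t = 1" using cusp by linarith
    then show False
    proof cases
      case 1
      then show ?thesis using s that \<open>length ms + t \<le> 2\<close> by simp
    next
      case 2
      then have "2 \<le> ms ! 0" using signature by (auto simp: signature_def)
      then show ?thesis using s that 2 by simp
    qed
  qed
  show "1 \<le> l"
    using 2 cusp by (cases "g = 0") (auto simp: num_sectors_def)
qed

text \<open>Two cone points of order 2 in two sectors force \<open>g = 0\<close> and
  \<open>t = 1\<close>, hence area 0. Consequently there is at most one diametral pair of
  sides.\<close>

lemma one_order_2:
  assumes "l = 2" "ell k" "ell k'" "ord k = 2" "ord k' = 2"
  shows "k = k'"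
proof (rule ccontr)
  assume "k \<noteq> k'"
  obtain i where i: "i < length ms" "k = 4 * g + 2 * i + 1" "ord k = ms ! i"
    using assms by (auto elim: ell_cases)
  obtain i' where i': "i' < length ms" "k' = 4 * g + 2 * i' + 1" "ord k' = ms ! i'"
    using assms by (auto elim: ell_cases)
  have ne: "i \<noteq> i'" using i i' \<open>k \<noteq> k'\<close> by auto
  have "length ms \<le> 2" using assms(1) cusp by (auto simp: num_sectors_def)
  then have *: "length ms = 2" "{i, i'} = {0, 1}" using i i' ne by auto
  then have "g = 0" "t = 1" using assms(1) cusp by (auto simp: num_sectors_def)
  moreover have "ms ! 0 = 2" "ms ! 1 = 2" using * i i' assms by (auto simp: doubleton_eq_iff)
  moreover have "{..<2::nat} = {0, 1}" by auto
  ultimately show False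
    using signature * by (simp add: signature_def)
qed

lemma \<theta>_0: "\<theta> 0 = 0" and \<theta>_N: "\<theta> N = 2 * pi"
proof -
  have "sector_arg N = real l"
    using N_eq by (auto simp: sector_arg_def of_nat_diff)
  then show "\<theta> N = 2 * pi" using l_cases by (simp add: \<theta>_def)
qed (simp add: \<theta>_def sector_arg_def)

lemma sector_arg_less:
  assumes "j < k"
  shows "sector_arg j < sector_arg k"
proof -
  have "real j < real k" "j \<le> 4 * g \<Longrightarrow> real j \<le> 4 * real g" "\<not> k \<le> 4 * g \<Longrightarrow> 4 * real g < real k"
    using assms by linarith+
  then show ?thesis using assms by (auto simp: sector_arg_def field_simps)
qed

lemma \<theta>_less_iff [simp]: "\<theta> j < \<theta> k \<longleftrightarrow> j < k"
proof -
  have c: "0 < 2 * pi / real l" using l_cases by simp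
  show ?thesis unfolding \<theta>_def mult_less_cancel_left_pos [OF c]
    using sector_arg_less [of j k] sector_arg_less [of k j] by (cases j k rule: linorder_cases) auto
qed

lemma \<theta>_le_iff [simp]: "\<theta> j \<le> \<theta> k \<longleftrightarrow> j \<le> k"
  by (simp add: linorder_not_less [symmetric])

lemma \<theta>_bounds: "0 \<le> \<theta> k" "k \<le> N \<Longrightarrow> \<theta> k \<le> 2 * pi"
  using \<theta>_le_iff [of 0 k] \<theta>_le_iff [of k N] unfolding \<theta>_0 \<theta>_N by auto

end

section \<open>Position of the vertices\<close>

lemma equidistant_on_bisector:
  assumes "cmod (p - cis (a + d)) = cmod (p - cis (a - d))" "0 < d" "d < pi"
  shows "p = of_real (Re (p * cis (- a))) * cis a"
proof -
  define p' where "p' = p * cis (- a)"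
  have c: "cmod (p - cis (a + e)) = cmod (p' - cis e)" for e
  proof -
    have "cmod (p - cis (a + e)) = cmod ((p - cis (a + e)) * cis (- a))" by (simp add: norm_mult)
    then show ?thesis by (simp add: p'_def left_diff_distrib cis_mult)
  qed
  have "cmod (p' - cis d) ^ 2 = cmod (p' - cis (- d)) ^ 2"
    using assms(1) c [of d] c [of "- d"] by simp
  then have "(Im p' - sin d) ^ 2 = (Im p' + sin d) ^ 2"
    unfolding cmod_power2 by simp
  moreover have "(Im p' + sin d) ^ 2 - (Im p' - sin d) ^ 2 = 4 * (Im p' * sin d)"
    by (simp add: power2_eq_square algebra_simps)
  ultimately have "Im p' * sin d = 0" by linarith
  then have "Im p' = 0" using sin_gt_zero [OF assms(2,3)] by simp
  then have "p' = of_real (Re p')" by (simp add: complex_eq_iff)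
  then have "p' * cis a = of_real (Re p') * cis a" by (rule arg_cong)
  moreover have "p' * cis a = p" by (simp add: p'_def mult.assoc cis_mult)
  ultimately show ?thesis unfolding p'_def [symmetric] by (simp only:)
qed

text \<open>After centring at the vertex, the sector ends are symmetric about the bisector, at
  angles \<phi> and -\<phi> with \<phi> = pi - pi / m. As this is at least pi / 2, the real part of
  \<zeta> is not positive, which reads \<open>(1 + s ^ 2) * cos d \<le> 2 * s\<close> and keeps the
  vertex on the sector's side of the centre. For \<open>s = 0\<close> both cosines must
  vanish.\<close>

lemma interior_angle_on_bisector:
  assumes s: "\<bar>s\<bar> < 1" and d: "0 < d" "d \<le> pi / 2" and m: "2 \<le> m"
    and angle: "interior_angle (cis (a - d)) (of_real s * cis a) (cis (a + d)) = 2 * pi / real m"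
  shows "0 \<le> s" and "s = 0 \<Longrightarrow> d = pi / 2 \<and> m = 2"
proof -
  define \<zeta> where "\<zeta> = (cis d - of_real s) / (1 - of_real s * cis d)"
  have ca: "cnj (cis a) * cis (a + e) = cis e" "cnj (cis a) = cis (- a)" for e
    by (simp_all add: cis_cnj cis_mult)
  have M: "Moebius_function 0 (of_real s * cis a) (cis (a + e)) = cis a * ((cis e - of_real s) / (1 - of_real s * cis e))" for e
  proof -
    have "cis (a + e) - of_real s * cis a = cis a * (cis e - of_real s)"
      by (simp add: right_diff_distrib cis_mult)
    moreover have "cnj (of_real s * cis a) * cis (a + e) = of_real s * cis e"
      by (simp only: complex_cnj_mult complex_cnj_complex_of_real mult.assoc ca(1))
    ultimately show ?thesis
      unfolding Moebius_function_simple by (simp only: times_divide_eq_right)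
  qed
  have cnj: "(cis (- d) - of_real s) / (1 - of_real s * cis (- d)) = cnj \<zeta>"
    by (simp only: \<zeta>_def complex_cnj_divide complex_cnj_diff complex_cnj_mult complex_cnj_one
        complex_cnj_complex_of_real cis_cnj)
  have nz: "1 - of_real s * cis d \<noteq> 0"
    using Moebius_denominator_nz [of "of_real s" "cis d"] s by simp
  define r where "r = 1 / cmod (1 - of_real s * cis d) ^ 2"
  have r: "r > 0" using nz by (simp add: r_def)
  have "\<zeta> = (cis d - of_real s) * cnj (1 - of_real s * cis d) * of_real r"
    unfolding \<zeta>_def r_def complex_div_cnj [of "cis d - of_real s"]
    by (simp only: of_real_divide of_real_power of_real_1 times_divide_eq_right mult_1_right)
  moreover have "(cis d - of_real s) * cnj (1 - of_real s * cis d) =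
      Complex ((1 + s ^ 2) * cos d - 2 * s) ((1 - s ^ 2) * sin d)"
  proof (rule complex_eqI)
    have "s * (sin d ^ 2 + cos d ^ 2) = s" by simp
    then have "s * (sin d * sin d) + s * (cos d * cos d) = s"
      unfolding power2_eq_square distrib_left .
    then show "Re ((cis d - of_real s) * cnj (1 - of_real s * cis d)) =
        Re (Complex ((1 + s ^ 2) * cos d - 2 * s) ((1 - s ^ 2) * sin d))"
      by (simp add: power2_eq_square algebra_simps)
  qed (simp add: power2_eq_square algebra_simps)
  ultimately have Re: "Re \<zeta> = ((1 + s ^ 2) * cos d - 2 * s) * r" and Im: "Im \<zeta> = ((1 - s ^ 2) * sin d) * r"
    by simp_all
  have "s ^ 2 < 1" using s by (simp add: abs_square_less_1)
  then have "0 < 1 - s ^ 2" by simp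
  moreover have "0 < sin d" by (rule sin_gt_zero) (use d in auto)
  ultimately have Im_pos: "0 < Im \<zeta>" unfolding Im using r by (intro mult_pos_pos)
  have "cmod (Moebius_function 0 (of_real s) (cis d)) = 1"
    by (rule norm_Moebius_function_sphere) (use s in auto)
  then have n: "\<zeta> \<in> sphere 0 1"
    unfolding Moebius_function_simple \<zeta>_def mem_sphere_0 by (simp only: complex_cnj_complex_of_real)
  define \<phi> where "\<phi> = Arg2pi \<zeta>"
  have \<zeta>: "\<zeta> = cis \<phi>" unfolding \<phi>_def by (rule sphere_eq_cis [OF n])
  have \<phi>: "0 < \<phi>" "\<phi> < pi"
    using Arg2pi_lt_pi [of \<zeta>] Im_pos unfolding \<phi>_def by blast+
  have "interior_angle (cis (a - d)) (of_real s * cis a) (cis (a + d)) = Arg2pi (cnj \<zeta> / \<zeta>)"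
  proof -
    have 1: "Moebius_function 0 (of_real s * cis a) (cis (a - d)) = cis a * cnj \<zeta>"
      using M [of "- d"] unfolding cnj by simp
    have 2: "Moebius_function 0 (of_real s * cis a) (cis (a + d)) = cis a * \<zeta>"
      unfolding M \<zeta>_def ..
    have "cis a * cnj \<zeta> / (cis a * \<zeta>) = cnj \<zeta> / \<zeta>" by (rule mult_divide_mult_cancel_left) simp
    then show ?thesis unfolding interior_angle_def 1 2 by (rule arg_cong)
  qed
  also have "cnj \<zeta> / \<zeta> = cis (2 * pi - 2 * \<phi>)"
  proof -
    have "cnj \<zeta> / \<zeta> = cis (- \<phi> - \<phi>)" unfolding \<zeta> cis_cnj cis_divide ..
    also have "\<dots> = cis (- \<phi> - \<phi> + 2 * pi)" by (rule cis_add_2pi [symmetric])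
    also have "\<dots> = cis (2 * pi - 2 * \<phi>)" by (rule arg_cong) simp
    finally show ?thesis .
  qed
  also have "Arg2pi \<dots> = 2 * pi - 2 * \<phi>" by (rule Arg2pi_cis) (use \<phi> in auto)
  finally have \<phi>m: "\<phi> = pi - pi / real m" using angle by simp
  have pm: "0 < pi / real m" "pi / real m \<le> pi / 2"
    subgoal using m by simp
    subgoal by (rule divide_left_mono) (use m in auto)
    done
  have "Re \<zeta> = - cos (pi / real m)" by (simp add: \<zeta> \<phi>m)
  moreover have "0 \<le> cos (pi / real m)" using pm by (intro cos_ge_zero) auto
  ultimately have "((1 + s ^ 2) * cos d - 2 * s) * r \<le> 0" using Re by linarith
  then have "(1 + s ^ 2) * cos d - 2 * s \<le> 0"
    using mult_pos_pos [of "(1 + s ^ 2) * cos d - 2 * s" r] r by linarith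
  moreover have cd: "0 \<le> (1 + s ^ 2) * cos d" using d by (intro mult_nonneg_nonneg cos_ge_zero) auto
  ultimately show "0 \<le> s" by linarith
  assume "s = 0"
  then have "cos d = 0" using \<open>(1 + s ^ 2) * cos d - 2 * s \<le> 0\<close> cd by simp
  moreover have "cos d > 0" if "d < pi / 2" using d that by (intro cos_gt_zero) auto
  ultimately have "d = pi / 2" using d by force
  moreover have "Re \<zeta> = 0" using Re \<open>s = 0\<close> \<open>cos d = 0\<close> by simp
  then have "cos (pi / real m) = 0" using \<open>Re \<zeta> = - cos (pi / real m)\<close> by simp
  moreover have "cos (pi / real m) > 0" if "m \<noteq> 2"
  proof (rule cos_gt_zero)
    show "pi / real m < pi / 2" using m that by (intro divide_strict_left_mono) auto
  qed (use pm in auto)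
  ultimately show "d = pi / 2 \<and> m = 2" by force
qed

lemma Moebius_function_interior_iff:
  assumes "cmod c < 1" "z \<in> cball 0 1" "Moebius_function \<alpha> c z \<in> sphere 0 1"
  shows "z \<in> sphere 0 1"
  using Moebius_function_norm_lt_1 [OF assms(1), of z \<alpha>] assms(2,3) by (cases "cmod z < 1") auto

lemma left_half_plane_arc:
  assumes "z \<in> left_half_plane p q" "p \<in> sphere 0 1" "q \<in> sphere 0 1" "z \<in> sphere 0 1"
  shows "z \<in> arc_cc q p"
proof -
  obtain T a b \<zeta> where T: "disk_isometry T" "- 1 \<le> a" "a < b" "b \<le> 1" "T (of_real a) = p" "T (of_real b) = q"
    "cmod \<zeta> \<le> 1" "0 \<le> Im \<zeta>" "z = T \<zeta>"
    using assms(1) by (auto simp: left_half_plane_def)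
  obtain \<alpha> c where c: "cmod c < 1" "T = Moebius_function \<alpha> c" using T(1) by (rule disk_isometryE)
  \<comment> \<open>Isometries keep the open disk apart from the circle, so ideal end points come
    from the ends of the diameter, and the ideal points on the left come from the upper half
    circle.\<close>
  have "\<bar>a\<bar> = 1" "\<bar>b\<bar> = 1" "\<zeta> \<in> sphere 0 1"
    using Moebius_function_interior_iff [OF c(1), of "of_real a" \<alpha>]
      Moebius_function_interior_iff [OF c(1), of "of_real b" \<alpha>]
      Moebius_function_interior_iff [OF c(1), of \<zeta> \<alpha>] T assms c by auto
  then have ab: "a = - 1" "b = 1" using T by auto
  have "Arg2pi \<zeta> \<le> Arg2pi (- 1)"
    using T(8) Arg2pi_of_real [of "- 1"] by (simp add: Arg2pi_le_pi)
  then have "\<zeta> \<in> arc_cc 1 (- 1)" using \<open>\<zeta> \<in> sphere 0 1\<close> by (simp add: arc_cc_def)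
  then have "T \<zeta> \<in> arc_cc (T 1) (T (- 1))"
    using disk_isometry_image_arc_cc [OF T(1), of 1 "- 1"] by auto
  then show ?thesis using T ab by simp
qed

text \<open>Convexity supplies an isometry that carries a part of the diameter to the side. Without
  such a witness the side would be empty and its inclusion in an isometric circle would say
  nothing.\<close>

lemma left_half_plane_ends:
  assumes "z \<in> left_half_plane p q"
  shows "p \<in> geodesic p q" "q \<in> geodesic p q"
proof -
  obtain T a b where T: "disk_isometry T" "- 1 \<le> a" "a < b" "b \<le> 1" "T (complex_of_real a) = p" "T (of_real b) = q"
    using assms by (auto simp: left_half_plane_def)
  show "p \<in> geodesic p q" unfolding geodesic_def mem_Collect_eq
    using T by (intro exI [of _ T] exI [of _ a] exI [of _ b] exI [of _ a]) auto
  show "q \<in> geodesic p q" unfolding geodesic_def mem_Collect_eq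
    using T by (intro exI [of _ T] exI [of _ a] exI [of _ b] exI [of _ b]) auto
qed

context partitioned_polygon begin

lemma V_cball: "k \<le> N \<Longrightarrow> V k \<in> cball 0 1"
  using ideal_vertex [of k] elliptic_vertex [of k] by (cases "ell k") auto

text \<open>The vertex then is the centre 0 and its pairings are the half-turn about 0, which has no
  isometric circle.\<close>

definition diametral :: "nat \<Rightarrow> bool" where
  "diametral k \<longleftrightarrow> l = 2 \<and> ell k \<and> ord k = 2"

lemma diametral_zero:
  assumes "diametral k"
  shows "V k = 0"
proof -
  obtain i where i: "i < length ms" "k = 4 * g + 2 * i + 1" "ord k = ms ! i"
    using assms unfolding diametral_def by (auto elim: ell_cases)
  show ?thesis
    using diameter [of "i + 1" k] i assms by (simp add: diametral_def)
qed

text \<open>The isometric circle condition at the two ends of a side in numerical form.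
  \<open>diametral (k - 1)\<close> excludes the second side of a diametral pair.\<close>

lemma side_isometric_circle:
  assumes k: "k \<in> {1..N}" and nd: "\<not> diametral k" "\<not> diametral (k - 1)"
  obtains \<alpha> c where "\<gamma> k = Moebius_function \<alpha> c" "cmod c < 1" "c \<noteq> 0"
    "cmod (1 - cnj c * V (k - 1)) ^ 2 = 1 - cmod c ^ 2" "cmod (1 - cnj c * V k) ^ 2 = 1 - cmod c ^ 2"
proof -
  have "\<not> (l = 2 \<and> (\<exists>i\<in>{1..length ms}. ms ! (i - 1) = 2 \<and> k \<in> {4 * g + 2 * i - 1, 4 * g + 2 * i}))"
  proof
    assume "l = 2 \<and> (\<exists>i\<in>{1..length ms}. ms ! (i - 1) = 2 \<and> k \<in> {4 * g + 2 * i - 1, 4 * g + 2 * i})"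
    then obtain i where i: "l = 2" "i \<in> {1..length ms}" "ms ! (i - 1) = 2" "k \<in> {4 * g + 2 * i - 1, 4 * g + 2 * i}"
      by blast
    then obtain j where "i = Suc j" by (cases i) auto
    then have "ell (4 * g + 2 * i - 1)" "ord (4 * g + 2 * i - 1) = 2"
      using i by (auto simp: ell_iff ord_def)
    then have "diametral (4 * g + 2 * i - 1)" using i by (simp add: diametral_def)
    then show False using i nd by auto
  qed
  then have *: "\<gamma> k 0 \<noteq> 0" "geodesic (V (k - 1)) (V k) \<subseteq> isometric_circle (\<gamma> k)"
    using isometric [OF k] by auto
  obtain \<alpha> c where c: "cmod c < 1" "\<gamma> k = Moebius_function \<alpha> c"
    using isometry [OF k] by (rule disk_isometryE)
  have "V 0 \<in> left_half_plane (V (k - 1)) (V k)" using convex_ccw [OF k] by simp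
  then have "V (k - 1) \<in> isometric_circle (\<gamma> k)" "V k \<in> isometric_circle (\<gamma> k)"
    using left_half_plane_ends * by blast+
  moreover have "V (k - 1) \<in> cball 0 1" "V k \<in> cball 0 1" using V_cball k by auto
  moreover have "c \<noteq> 0" using * c by (auto simp: Moebius_function_def)
  ultimately show ?thesis
    using that [OF c(2,1)] mem_isometric_circle_Moebius [OF c(1)] unfolding c(2) by blast
qed

lemma V_quadruple: "k \<le> 4 * g \<Longrightarrow> V k = cis (\<theta> k)"
proof -
  assume k: "k \<le> 4 * g"
  show "V k = cis (\<theta> k)"
  proof (cases "k = 0")
    case True
    then show ?thesis by (simp add: closed_up \<theta>_0)
  next
    case False
    define q where "q = (k - 1) div 4 + 1"
    define i where "i = (k - 1) mod 4 + 1"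
    have qi: "q \<in> {1..g}" "i \<le> 4" "k = 4 * q - 4 + i" "4 * q - 4 = 4 * (q - 1)" "q - 1 \<le> g"
      using k False by (auto simp: q_def i_def)
    have "V k = cis (2 * pi / real l * real (q - 1)) * cis (real i * (2 * pi / real l) / 4)"
      using equally_spaced [OF qi(1,2)] arg_quadruple [of "q - 1"] qi by simp
    also have "\<dots> = cis (2 * pi / real l * (real k / 4))"
    proof -
      have "real k = 4 * real (q - 1) + real i" using qi by simp
      moreover have "real l \<noteq> 0" using l_cases by simp
      ultimately show ?thesis unfolding cis_mult by (intro arg_cong [where f = cis]) (simp add: field_simps)
    qed
    finally show ?thesis using k by (simp add: \<theta>_def sector_arg_def)
  qed
qed

lemma V_even:
  assumes "4 * g < k" "k \<le> N" "even k"
  shows "V k = cis (\<theta> k)"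
proof -
  obtain j where j: "k = 4 * g + 2 * j"
  proof -
    have "even (k - 4 * g)" using assms by simp
    then obtain j where "k - 4 * g = 2 * j" by (rule evenE)
    then show ?thesis using that [of j] assms by simp
  qed
  then have "j \<in> {1..length ms + t - 1}" using assms cusp by (auto simp: num_sides_def)
  then show ?thesis using arg_pair [of j] j assms by (simp add: \<theta>_def sector_arg_def)
qed

lemma odd_neighbours:
  assumes "4 * g < k" "k \<le> N" "odd k"
  shows "2 \<le> l" "k + 1 \<le> N" "V (k - 1) = cis (\<theta> k - pi / real l)" "V (k + 1) = cis (\<theta> k + pi / real l)"
    "\<theta> (k - 1) = \<theta> k - pi / real l" "\<theta> (k + 1) = \<theta> k + pi / real l" "0 < pi / real l" "pi / real l \<le> pi / 2"
proof -
  have "even N" using N_eq(1) by simp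
  then show k1: "k + 1 \<le> N" using assms by (cases "k = N") auto
  have "4 * g < N" using assms by simp
  then have "g < l" using N_eq(1) by simp
  then show l: "2 \<le> l" using l_cases by (cases "g = 0") auto
  show "0 < pi / real l" using l by simp
  show "pi / real l \<le> pi / 2" by (rule divide_left_mono) (use l in auto)
  show *: "\<theta> (k - 1) = \<theta> k - pi / real l" "\<theta> (k + 1) = \<theta> k + pi / real l"
  proof -
    have "k - 1 \<le> 4 * g \<Longrightarrow> k = 4 * g + 1" using assms by linarith
    then have "sector_arg (k - 1) = sector_arg k - 1 / 2" "sector_arg (k + 1) = sector_arg k + 1 / 2"
      using assms by (auto simp: sector_arg_def of_nat_diff field_simps)
    then show "\<theta> (k - 1) = \<theta> k - pi / real l" "\<theta> (k + 1) = \<theta> k + pi / real l"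
      by (simp_all add: \<theta>_def right_diff_distrib distrib_left)
  qed
  show "V (k + 1) = cis (\<theta> k + pi / real l)"
    using V_even [of "k + 1"] k1 assms * by simp
  show "V (k - 1) = cis (\<theta> k - pi / real l)"
    using V_even [of "k - 1"] V_quadruple [of "k - 1"] assms * by (cases "4 * g < k - 1") auto
qed

text \<open>Both ends of side \<open>k\<close> lie on the isometric circle of \<gamma>, so their
  Euclidean distance is preserved. As \<open>V k\<close> is fixed and \<open>V (k - 1)\<close> goes
  to \<open>V (k + 1)\<close>, the vertex is equidistant from its neighbours. This covers elliptic
  and parabolic pairs alike.\<close>

lemma middle_vertex_on_bisector:
  assumes k: "4 * g < k" "k \<le> N" "odd k" and \<gamma>: "\<gamma> k (V k) = V k" "\<gamma> k (V (k - 1)) = V (k + 1)"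
    and nd: "\<not> diametral k"
  shows "V k = of_real (Re (V k * cis (- \<theta> k))) * cis (\<theta> k)"
proof -
  note o = odd_neighbours [OF k]
  have "\<not> ell (k - 1)" using k by (auto dest: ellD)
  then have nd': "\<not> diametral (k - 1)" by (simp add: diametral_def)
  have kN: "k \<in> {1..N}" using k by auto
  obtain \<alpha> c where c: "\<gamma> k = Moebius_function \<alpha> c" "cmod c < 1" "c \<noteq> 0"
    "cmod (1 - cnj c * V (k - 1)) ^ 2 = 1 - cmod c ^ 2" "cmod (1 - cnj c * V k) ^ 2 = 1 - cmod c ^ 2"
    by (rule side_isometric_circle [OF kN nd nd'])
  have "cmod c ^ 2 < 1" using c by (simp add: abs_square_less_1)
  have VV: "V k \<in> cball 0 1" "V (k - 1) \<in> cball 0 1" using k V_cball by auto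
  have "cmod (1 - cnj c * V k) = cmod (1 - cnj c * V (k - 1))"
    by (rule power2_eq_imp_eq) (use c(4,5) in auto)
  then have "cmod (V k - V (k + 1)) = (1 - cmod c ^ 2) * cmod (V k - V (k - 1)) / (cmod (1 - cnj c * V k) ^ 2)"
    using Moebius_function_chord [OF c(2) VV, of \<alpha>] \<gamma> c(1) by (simp add: power2_eq_square)
  also have "\<dots> = cmod (V k - V (k - 1))" unfolding c(5) using \<open>cmod c ^ 2 < 1\<close> by simp
  finally show ?thesis
    using equidistant_on_bisector [of "V k" "\<theta> k" "pi / real l"] o by simp
qed

text \<open>Only the cusps need an argument. The bisector meets the circle in two antipodal points,
  and with the far one \<open>V (k + 1)\<close> would lie to the right of side \<open>k\<close>,
  against convexity.\<close>

lemma V_ideal: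
  assumes k: "k \<le> N" "\<not> ell k"
  shows "V k = cis (\<theta> k)"
proof (cases "k \<le> 4 * g \<or> even k")
  case True
  show ?thesis
  proof (cases "k \<le> 4 * g")
    case False
    then show ?thesis using V_even [of k] True k by simp
  qed (rule V_quadruple)
next
  case False
  then have k': "4 * g < k" "odd k" by simp_all
  note o = odd_neighbours [OF k'(1) k(1) k'(2)]
  have kN: "k \<in> {1..N}" using k k' by auto
  obtain i where i: "k = 4 * g + 2 * i + 1"
  proof -
    have "odd (k - 4 * g)" using k' by simp
    then obtain i where "k - 4 * g = 2 * i + 1" by (rule oddE)
    then have "k = 4 * g + 2 * i + 1" using k' by linarith
    then show ?thesis by (rule that)
  qed
  have "length ms \<le> i"
  proof (rule ccontr)
    assume "\<not> length ms \<le> i"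
    then have "ell k" unfolding ell_iff using i by (intro exI [of _ i]) simp
    then show False using k(2) by simp
  qed
  define j where "j = i - length ms"
  have j: "i = length ms + j" using \<open>length ms \<le> i\<close> by (simp add: j_def)
  have jt: "j + 1 \<in> {1..t - 1}" using i j k(1) by (simp add: num_sides_def)
  have kj: "k = 4 * g + 2 * length ms + 2 * (j + 1) - 1" using i j by simp
  have g: "\<gamma> k (V k) = V k" "\<gamma> k (V (k - 1)) = V (k + 1)"
    by (rule glue_parabolic [OF jt kj, THEN conjunct2, THEN conjunct1],
        rule glue_parabolic [OF jt kj, THEN conjunct2, THEN conjunct2, THEN conjunct1])
  have nd: "\<not> diametral k" using k by (simp add: diametral_def)
  define s where "s = Re (V k * cis (- \<theta> k))"
  have V: "V k = of_real s * cis (\<theta> k)"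
    unfolding s_def by (rule middle_vertex_on_bisector [OF k'(1) k(1) k'(2) g nd])
  have Vs: "V k \<in> sphere 0 1" by (rule ideal_vertex [OF k])
  then have "\<bar>s\<bar> = 1" by (simp add: V norm_mult)
  moreover have "s \<noteq> - 1"
  proof
    assume "s = - 1"
    define d where "d = pi / real l"
    note o' = o [folded d_def]
    have d: "0 < d" "d \<le> pi / 2" by (fact o')+
    then have Vk: "V k = cis (\<theta> k + pi)" unfolding V using \<open>s = - 1\<close> by (simp add: complex_eq_iff)
    have "V (k + 1) \<in> left_half_plane (V (k - 1)) (V k)"
      by (rule convex_ccw [OF kN o(2)])
    then have "V (k + 1) \<in> arc_cc (V k) (V (k - 1))"
      by (rule left_half_plane_arc) (use o Vs in auto)
    moreover have "V (k - 1) = cis ((\<theta> k - d) + 2 * pi)" "V (k + 1) = cis ((\<theta> k + d) + 2 * pi)"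
      by (simp_all only: cis_add_2pi o'(3,4))
    moreover have "arc_cc (cis (\<theta> k + pi)) (cis ((\<theta> k - d) + 2 * pi)) = cis ` {\<theta> k + pi..(\<theta> k - d) + 2 * pi}"
      using d pi_gt_zero by (intro arc_cc_cis; linarith)
    ultimately have "cis ((\<theta> k + d) + 2 * pi) \<in> cis ` {\<theta> k + pi..(\<theta> k - d) + 2 * pi}"
      by (simp only: Vk)
    moreover have "cis ((\<theta> k + d) + 2 * pi) \<in> cis ` {\<theta> k + pi..(\<theta> k - d) + 2 * pi} \<longleftrightarrow>
       (\<theta> k + d) + 2 * pi \<in> {\<theta> k + pi..(\<theta> k - d) + 2 * pi}"
      using d pi_gt_zero by (intro inj_on_image_mem_iff [OF cis_inj_on_period [of "\<theta> k + pi"]]) auto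
    ultimately show False using d by auto
  qed
  ultimately have "s = 1" by linarith
  then show ?thesis by (simp add: V)
qed

text \<open>Strict positivity is what separates points under the sector from points outside it by
  their distance to \<open>V k\<close>; at the centre all these distances agree.\<close>

lemma V_elliptic:
  assumes "ell k"
  obtains s where "V k = of_real s * cis (\<theta> k)" "0 \<le> s" "s < 1" "\<not> diametral k \<Longrightarrow> 0 < s"
proof (cases "diametral k")
  case True
  show ?thesis by (rule that [of 0]) (use diametral_zero [OF True] True in auto)
next
  case False
  note k = ellD [OF assms]
  have kN: "k \<le> N" using k by simp
  note o = odd_neighbours [OF k(5) kN k(6)]
  have g: "\<gamma> k (V k) = V k" "\<gamma> k (V (k - 1)) = V (k + 1)"
    by (rule glue_elliptic [OF assms, THEN conjunct2, THEN conjunct1],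
        rule glue_elliptic [OF assms, THEN conjunct2, THEN conjunct2, THEN conjunct1])
  define s where "s = Re (V k * cis (- \<theta> k))"
  have V: "V k = of_real s * cis (\<theta> k)"
    unfolding s_def by (rule middle_vertex_on_bisector [OF k(5) kN k(6) g False])
  have "\<bar>s\<bar> < 1" using elliptic_vertex [OF assms] by (simp add: V norm_mult)
  obtain i where i: "i < length ms" "k = 4 * g + 2 * i + 1" "ord k = ms ! i"
    using assms by (rule ell_cases)
  have "interior_angle (V (k - 1)) (V k) (V (k + 1)) = 2 * pi / real (ord k)"
    using angle [of "i + 1" k] i by simp
  then have a: "interior_angle (cis (\<theta> k - pi / real l)) (of_real s * cis (\<theta> k)) (cis (\<theta> k + pi / real l)) = 2 * pi / real (ord k)"
    unfolding o(3,4) V .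
  note s = interior_angle_on_bisector [OF \<open>\<bar>s\<bar> < 1\<close> o(7,8) k(9) a]
  have "s \<noteq> 0"
  proof
    assume "s = 0"
    then have "pi / real l = pi / 2" "ord k = 2" using s(2) by auto
    then have "l = 2" using o(1) by (simp add: field_simps)
    then show False using False assms \<open>ord k = 2\<close> by (simp add: diametral_def)
  qed
  then show ?thesis using that [of s] V s(1) \<open>\<bar>s\<bar> < 1\<close> by auto
qed

end

section \<open>Pieces of the circle\<close>

lemma mem_cis_image_iff:
  assumes "0 \<le> a" "b \<le> 2 * pi" "z \<in> sphere 0 1"
  shows "z \<in> cis ` {a..<b} \<longleftrightarrow> a \<le> Arg2pi z \<and> Arg2pi z < b"
proof -
  have z: "z = cis (Arg2pi z)" using assms(3) by (rule sphere_eq_cis)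
  have "cis (Arg2pi z) \<in> cis ` {a..<b} \<longleftrightarrow> Arg2pi z \<in> {a..<b}"
    using assms Arg2pi_ge_0 [of z] Arg2pi_lt_2pi [of z]
    by (intro inj_on_image_mem_iff [OF cis_inj_on_period [of 0]]) auto
  then show ?thesis unfolding z [symmetric] by simp
qed

lemma exists_step:
  fixes f :: "nat \<Rightarrow> real"
  assumes "f 0 \<le> x" "x < f n"
  obtains k where "k \<in> {1..n}" "f (k - 1) \<le> x" "x < f k"
proof -
  define k where "k = (LEAST k. x < f k)"
  have 1: "x < f k" unfolding k_def using assms(2) by (rule LeastI)
  have 2: "k \<le> n" unfolding k_def using assms(2) by (rule Least_le)
  have 3: "k \<noteq> 0"
  proof
    assume "k = 0"
    then show False using 1 assms(1) by simp
  qed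
  then have "\<not> x < f (k - 1)" unfolding k_def by (intro not_less_Least) simp
  then show ?thesis using that [of k] 1 2 3 by simp
qed

lemma inv_on_cball:
  assumes "\<forall>z\<in>cball 0 1. (g :: complex \<Rightarrow> complex) (f z) = z" "z \<in> cball 0 1" "f z = w"
  shows "g w = z"
  using assms by blast

context partitioned_polygon begin

definition top :: "nat \<Rightarrow> nat" where
  "top k = (if ell k then k + 1 else k)"

text \<open>A piece is named by its first side: an ideal side stands for itself, and the first side
  of an elliptic pair for both, so the index after an elliptic vertex is dropped.\<close>

definition pieces :: "nat set" where
  "pieces = {k \<in> {1..N}. \<not> ell (k - 1)}"

definition S :: "nat \<Rightarrow> complex set" where
  "S k = arc_co (V (k - 1)) (V (top k))"

lemma piece:
  assumes "k \<in> pieces"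
  shows "k \<in> {1..N}" "1 \<le> k" "k \<le> N" "\<not> ell (k - 1)" "top k \<le> N" "\<not> ell (top k)" "k \<le> top k" "k - 1 < top k"
    "V (k - 1) = cis (\<theta> (k - 1))" "V (top k) = cis (\<theta> (top k))"
    "0 \<le> \<theta> (k - 1)" "\<theta> (k - 1) < \<theta> (top k)" "\<theta> (top k) \<le> 2 * pi"
proof -
  show 1: "k \<in> {1..N}" "1 \<le> k" "k \<le> N" "\<not> ell (k - 1)" using assms by (auto simp: pieces_def)
  show 2: "top k \<le> N" "\<not> ell (top k)" using ellD(2,7) [of k] 1 by (auto simp: top_def)
  show 3: "k \<le> top k" "k - 1 < top k" using 1 by (auto simp: top_def)
  show "V (k - 1) = cis (\<theta> (k - 1))" by (rule V_ideal) (use 1 in auto)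
  show "V (top k) = cis (\<theta> (top k))" by (rule V_ideal [OF 2])
  show "0 \<le> \<theta> (k - 1)" "\<theta> (k - 1) < \<theta> (top k)" "\<theta> (top k) \<le> 2 * pi"
    using \<theta>_bounds(1) \<theta>_bounds(2) [OF 2(1)] 3 by simp_all
qed

text \<open>A quarter turn is the bound under which \<open>arc_inside_isometric_circle\<close> is
  stated. A half turn can occur only for an elliptic piece with \<open>l = 2\<close>, and a width
  below it is what \<open>ends_in_other_piece\<close> asks for.\<close>

lemma piece_width:
  assumes "k \<in> pieces"
  shows "\<theta> (top k) - \<theta> (k - 1) \<le> pi" "ell k \<Longrightarrow> \<theta> (top k) - \<theta> (k - 1) = 2 * pi / real l"
    "\<not> ell k \<Longrightarrow> \<theta> (top k) - \<theta> (k - 1) \<le> pi / 2" "ell k \<Longrightarrow> 2 \<le> l"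
proof -
  note p = piece [OF assms]
  show e: "ell k \<Longrightarrow> \<theta> (top k) - \<theta> (k - 1) = 2 * pi / real l" and l2: "ell k \<Longrightarrow> 2 \<le> l"
    using odd_neighbours [OF ellD(5) p(3) ellD(6)] by (auto simp: top_def)
  show i: "\<theta> (top k) - \<theta> (k - 1) \<le> pi / 2" if "\<not> ell k"
  proof -
    have t: "top k = k" using that by (simp add: top_def)
    consider "k \<le> 4 * g" | "4 * g < k" "odd k" | "4 * g < k" "even k" by linarith
    then show ?thesis
    proof cases
      case 1
      then have eq: "sector_arg k - sector_arg (k - 1) = 1 / 4"
        using p(2) by (simp add: sector_arg_def of_nat_diff field_simps)
      have "\<theta> (top k) - \<theta> (k - 1) = (pi / 2) / real l"
        unfolding t \<theta>_def right_diff_distrib [symmetric] eq by simp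
      also have "\<dots> \<le> (pi / 2) / 1" using l_cases by (intro divide_left_mono) auto
      finally show ?thesis by simp
    next
      case 2
      then show ?thesis using odd_neighbours [OF 2(1) p(3) 2(2)] unfolding t by simp
    next
      case 3
      have "4 * g < k - 1" "k - 1 \<le> N" "odd (k - 1)" using 3 p(2,3) by (auto simp: less_diff_conv; presburger)+
      note o = odd_neighbours [OF this]
      have "k - 1 + 1 = k" using p(2) by simp
      then show ?thesis using o unfolding t by simp
    qed
  qed
  show "\<theta> (top k) - \<theta> (k - 1) \<le> pi"
  proof (cases "ell k")
    case True
    have "2 * pi / real l \<le> 2 * pi / 2" by (rule divide_left_mono) (use l2 [OF True] in auto)
    then show ?thesis using e [OF True] by simp
  next
    case False
    then show ?thesis using i pi_gt_zero by linarith
  qed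
qed

lemma S_ends:
  assumes "k \<in> pieces"
  shows "V (k - 1) \<in> sphere 0 1" "V (top k) \<in> sphere 0 1" "V (k - 1) \<noteq> V (top k)"
    and S_eq_cis: "S k = cis ` {\<theta> (k - 1)..<\<theta> (top k)}"
    and closure_S: "closure (S k) = cis ` {\<theta> (k - 1)..\<theta> (top k)}"
proof -
  note p = piece [OF assms] note w = piece_width(1) [OF assms]
  show 1: "V (k - 1) \<in> sphere 0 1" "V (top k) \<in> sphere 0 1" unfolding p(9,10) by simp_all
  have lt: "\<theta> (top k) < \<theta> (k - 1) + 2 * pi" using w pi_gt_zero by linarith
  show "V (k - 1) \<noteq> V (top k)"
  proof
    assume "V (k - 1) = V (top k)"
    then have "cis (\<theta> (k - 1)) = cis (\<theta> (top k))" unfolding p(9,10) .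
    then have "\<theta> (k - 1) = \<theta> (top k)"
      by (rule inj_onD [OF cis_inj_on_period [of "\<theta> (k - 1)"]]) (use p(12) lt in \<open>simp_all del: \<theta>_less_iff \<theta>_le_iff\<close>)
    then show False using p(12) by simp
  qed
  show s: "S k = cis ` {\<theta> (k - 1)..<\<theta> (top k)}"
    unfolding S_def p(9,10) by (rule arc_co_cis [OF less_imp_le [OF p(12)] lt])
  show "closure (S k) = cis ` {\<theta> (k - 1)..\<theta> (top k)}"
    unfolding s by (rule closure_cis_image [OF p(12)])
qed

lemma S_subset: "S k \<subseteq> sphere 0 1"
  by (auto simp: S_def arc_co_def)

lemma mem_S_iff:
  assumes "k \<in> pieces" "z \<in> sphere 0 1"
  shows "z \<in> S k \<longleftrightarrow> \<theta> (k - 1) \<le> Arg2pi z \<and> Arg2pi z < \<theta> (top k)"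
  unfolding S_eq_cis [OF assms(1)]
  by (rule mem_cis_image_iff [OF piece(11) [OF assms(1)] piece(13) [OF assms(1)] assms(2)])

lemma pieces_ordered:
  assumes "k \<in> pieces" "k' \<in> pieces" "k < k'"
  shows "top k \<le> k' - 1"
  using piece(4) [OF assms(2)] assms(3) by (cases "k' = k + 1") (auto simp: top_def)

lemma pieces_disjoint:
  assumes "k \<in> pieces" "k' \<in> pieces" "z \<in> S k" "z \<in> S k'"
  shows "k = k'"
proof -
  have z: "z \<in> sphere 0 1" using assms(3) S_subset by blast
  note 1 = assms(3) [unfolded mem_S_iff [OF assms(1) z]] and 2 = assms(4) [unfolded mem_S_iff [OF assms(2) z]]
  have "\<theta> (k' - 1) < \<theta> (top k)" "\<theta> (k - 1) < \<theta> (top k')" using 1 2 by linarith+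
  then have "k' - 1 < top k" "k - 1 < top k'" by simp_all
  then show ?thesis
    using pieces_ordered [OF assms(1,2)] pieces_ordered [OF assms(2,1)] by (cases k k' rule: linorder_cases) auto
qed

lemma pieces_cover:
  assumes z: "z \<in> sphere 0 1"
  obtains k where "k \<in> pieces" "z \<in> S k"
proof -
  obtain k where k: "k \<in> {1..N}" "\<theta> (k - 1) \<le> Arg2pi z" "Arg2pi z < \<theta> k"
    by (rule exists_step [of \<theta> "Arg2pi z" N]) (use Arg2pi [of z] in \<open>auto simp: \<theta>_0 \<theta>_N\<close>)
  show ?thesis
  proof (cases "ell (k - 1)")
    case False
    then have p: "k \<in> pieces" using k by (simp add: pieces_def)
    have "\<theta> k \<le> \<theta> (top k)" using piece(7) [OF p] by simp
    then show ?thesis using that [OF p] k unfolding mem_S_iff [OF p z] by linarith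
  next
    case True
    have p: "k - 1 \<in> pieces" using ellD [OF True] by (simp add: pieces_def)
    have t: "top (k - 1) = k" using True k by (simp add: top_def)
    have "\<theta> (k - 1 - 1) \<le> \<theta> (k - 1)" by simp
    then have "\<theta> (k - 1 - 1) \<le> Arg2pi z" using k(2) by linarith
    then have "z \<in> S (k - 1)" unfolding mem_S_iff [OF p z] t using k(3) by blast
    then show ?thesis by (rule that [OF p])
  qed
qed

section \<open>Arguments of the partition points and the cells of the map\<close>

definition \<alpha> :: "nat \<Rightarrow> real" where
  "\<alpha> k = (if ell k then Arg2pi (A k) else \<theta> k)"

lemma A_ideal:
  assumes "k \<le> N" "\<not> ell k"
  shows "A k = V k"
proof -
  have "A k = V k" if "k \<in> {1..N}" "\<not> ell k" for k
    using partition that unfolding boundary_partition_def by metis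
  moreover have "1 \<le> N" using N_eq l_cases by (cases "g = 0") auto
  then have "A 0 = V 0"
    using partition calculation [of N] closed_up by (simp add: boundary_partition_def)
  ultimately show ?thesis using assms by (cases "k = 0") auto
qed

lemma ell_piece: "ell k \<Longrightarrow> k \<in> pieces"
  using ellD(3,8) by (simp add: pieces_def)

lemma A_elliptic:
  assumes "ell k"
  shows "A k \<in> sphere 0 1" "A k \<in> S k" "A k \<noteq> V (k - 1)" "\<theta> (k - 1) < \<alpha> k" "\<alpha> k < \<theta> (k + 1)"
proof -
  note p = ell_piece [OF assms]
  have t: "top k = k + 1" using assms by (simp add: top_def)
  have arc: "A k \<in> arc_oo (V (k - 1)) (V (k + 1))"
    using partition ellD(3) [OF assms] assms unfolding boundary_partition_def by metis
  then show s: "A k \<in> sphere 0 1" and S: "A k \<in> S k" by (auto simp: arc_oo_def S_def arc_co_def t)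
  have "0 < Arg2pi (A k / V (k - 1))" using arc by (simp add: arc_oo_def)
  moreover have "V (k - 1) \<noteq> 0" using S_ends(1) [OF p] by auto
  moreover have "Arg2pi 1 = 0" by (simp add: Arg2pi_eq_0)
  ultimately show ne: "A k \<noteq> V (k - 1)" by auto
  have a: "\<alpha> k = Arg2pi (A k)" using assms by (simp add: \<alpha>_def)
  show "\<alpha> k < \<theta> (k + 1)" using S mem_S_iff [OF p s] unfolding a t by simp
  have "A k = cis (\<alpha> k)" unfolding a by (rule sphere_eq_cis [OF s])
  then have "\<alpha> k \<noteq> \<theta> (k - 1)" using ne piece(9) [OF p] by auto
  moreover have "\<theta> (k - 1) \<le> \<alpha> k" using S mem_S_iff [OF p s] unfolding a by simp
  ultimately show "\<theta> (k - 1) < \<alpha> k" by simp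
qed

lemma A_cis: "k \<le> N \<Longrightarrow> A k = cis (\<alpha> k)"
proof (cases "ell k")
  case True
  then show ?thesis unfolding \<alpha>_def using sphere_eq_cis [OF A_elliptic(1) [OF True]] by simp
next
  case False
  assume "k \<le> N"
  then show ?thesis using A_ideal V_ideal False by (simp add: \<alpha>_def)
qed

lemma \<alpha>_step:
  assumes "k < N"
  shows "\<alpha> k < \<alpha> (k + 1)"
proof -
  consider "ell k" | "ell (k + 1)" | "\<not> ell k" "\<not> ell (k + 1)" by blast
  then show ?thesis
  proof cases
    case 1
    then show ?thesis using A_elliptic(5) ellD(7) by (simp add: \<alpha>_def)
  next
    case 2
    then have "\<not> ell k" using ellD(8) by fastforce
    then show ?thesis using A_elliptic(4) [OF 2] by (simp add: \<alpha>_def)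
  qed (simp add: \<alpha>_def)
qed

lemma \<alpha>_mono: "j \<le> k \<Longrightarrow> k \<le> N \<Longrightarrow> \<alpha> j \<le> \<alpha> k"
proof (induction k rule: dec_induct)
  case (step n)
  then show ?case using \<alpha>_step [of n] by simp
qed simp

lemma \<alpha>_0: "\<alpha> 0 = 0" and \<alpha>_N: "\<alpha> N = 2 * pi"
  by (simp_all add: \<alpha>_def \<theta>_0 \<theta>_N)

lemma N_ge_2: "2 \<le> N"
  using N_eq l_cases by (cases "g = 0") auto

lemma cell_iff:
  assumes k: "k \<in> {1..N}" and z: "z \<in> sphere 0 1"
  shows "z \<in> arc_co (A (k - 1)) (A k) \<longleftrightarrow> \<alpha> (k - 1) \<le> Arg2pi z \<and> Arg2pi z < \<alpha> k"
proof -
  have lt: "\<alpha> (k - 1) < \<alpha> k" 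
  proof -
    have "k - 1 < N" "k - 1 + 1 = k" using k by auto
    then show ?thesis using \<alpha>_step [of "k - 1"] by simp
  qed
  have b: "0 \<le> \<alpha> (k - 1)" "\<alpha> k \<le> 2 * pi"
  proof -
    have "k - 1 \<le> N" "k \<le> N" using k by auto
    then show "0 \<le> \<alpha> (k - 1)" "\<alpha> k \<le> 2 * pi"
      using \<alpha>_mono [of 0 "k - 1"] \<alpha>_mono [of k N] by (simp_all add: \<alpha>_0 \<alpha>_N)
  qed
  \<comment> \<open>A cell is shorter than a full turn because \<open>N \<ge> 2\<close> leaves room
    for another cell after or before it.\<close>
  have "\<alpha> k < \<alpha> (k - 1) + 2 * pi"
  proof (cases "k = 1")
    case True
    then have "\<alpha> k < \<alpha> (k + 1)" "\<alpha> (k + 1) \<le> \<alpha> N"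
      using \<alpha>_step [of k] \<alpha>_mono [of "k + 1" N] N_ge_2 by auto
    then show ?thesis using b by (simp add: \<alpha>_N)
  next
    case False
    then have "\<alpha> 0 < \<alpha> (0 + 1)" "\<alpha> 1 \<le> \<alpha> (k - 1)"
      using \<alpha>_step [of 0] \<alpha>_mono [of 1 "k - 1"] N_ge_2 k by auto
    then show ?thesis using b by (simp add: \<alpha>_0)
  qed
  then have "arc_co (A (k - 1)) (A k) = cis ` {\<alpha> (k - 1)..<\<alpha> k}"
    using arc_co_cis [of "\<alpha> (k - 1)" "\<alpha> k"] lt A_cis [of k] A_cis [of "k - 1"] k by (simp add: le_diff_conv)
  then show ?thesis using mem_cis_image_iff [OF b z] by simp
qed

lemma cell_unique:
  assumes "j \<in> {1..N}" "k \<in> {1..N}" "w \<in> arc_co (A (j - 1)) (A j)" "w \<in> arc_co (A (k - 1)) (A k)"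
  shows "j = k"
proof -
  have z: "w \<in> sphere 0 1" using assms(3) by (auto simp: arc_co_def)
  have 1: "\<alpha> (k - 1) \<le> Arg2pi w" "Arg2pi w < \<alpha> k" "\<alpha> (j - 1) \<le> Arg2pi w" "Arg2pi w < \<alpha> j"
    using assms cell_iff [OF _ z] by blast+
  have "\<not> j < k"
  proof
    assume "j < k"
    then have "j \<le> k - 1" "k - 1 \<le> N" using assms by auto
    then show False using \<alpha>_mono [of j "k - 1"] 1 by linarith
  qed
  moreover have "\<not> k < j"
  proof
    assume "k < j"
    then have "k \<le> j - 1" "j - 1 \<le> N" using assms by auto
    then show False using \<alpha>_mono [of k "j - 1"] 1 by linarith
  qed
  ultimately show ?thesis by simp
qed

definition F :: "complex \<times> complex \<Rightarrow> complex \<times> complex" where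
  "F = natural_extension N \<gamma> A"

lemma F_eq:
  assumes k: "k \<in> {1..N}" and w: "w \<in> arc_co (A (k - 1)) (A k)"
  shows "F (u, w) = (\<gamma> k u, \<gamma> k w)"
proof -
  have z: "w \<in> sphere 0 1" using w by (auto simp: arc_co_def)
  have "(THE k. k \<in> {1..N} \<and> w \<in> arc_co (A (k - 1)) (A k)) = k"
  proof (rule the_equality)
    show "k \<in> {1..N} \<and> w \<in> arc_co (A (k - 1)) (A k)" using k w by blast
    fix j assume j: "j \<in> {1..N} \<and> w \<in> arc_co (A (j - 1)) (A j)"
    show "j = k" using cell_unique [OF _ k _ w, of j] j by blast
  qed
  then show ?thesis by (simp add: F_def natural_extension_def Let_def)
qed

lemma F_ideal:
  assumes k: "k \<in> pieces" "\<not> ell k" and w: "w \<in> S k"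
  shows "F (u, w) = (\<gamma> k u, \<gamma> k w)"
proof (rule F_eq)
  show kN: "k \<in> {1..N}" by (rule piece(1) [OF k(1)])
  have "A (k - 1) = V (k - 1)" "A k = V k"
    by (rule A_ideal, use piece(3,4) [OF k(1)] k(2) in auto)+
  then show "w \<in> arc_co (A (k - 1)) (A k)" using w k(2) by (simp add: S_def top_def)
qed

lemma cells_cover:
  assumes "w \<in> sphere 0 1"
  obtains k where "k \<in> {1..N}" "w \<in> arc_co (A (k - 1)) (A k)"
proof -
  obtain k where k: "k \<in> {1..N}" "\<alpha> (k - 1) \<le> Arg2pi w" "Arg2pi w < \<alpha> k"
    by (rule exists_step [of \<alpha> "Arg2pi w" N]) (use Arg2pi [of w] in \<open>auto simp: \<alpha>_0 \<alpha>_N\<close>)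
  then show ?thesis using that cell_iff [OF k(1) assms] by blast
qed

lemma F_off_diagonal:
  assumes "z \<in> off_diagonal"
  shows "F z \<in> off_diagonal"
proof -
  obtain u w where z: "z = (u, w)" "u \<in> sphere 0 1" "w \<in> sphere 0 1" "u \<noteq> w"
    using assms by (auto simp: off_diagonal_def)
  obtain k where k: "k \<in> {1..N}" "w \<in> arc_co (A (k - 1)) (A k)" using cells_cover [OF z(3)] by blast
  note T = isometry [OF k(1)]
  show ?thesis
    unfolding z(1) F_eq [OF k] off_diagonal_def
    using disk_isometry_sphere [OF T z(2)] disk_isometry_sphere [OF T z(3)] disk_isometry_eq_iff [OF T z(2,3)] z(4)
    by simp
qed

text \<open>The gluing reverses direction: the start of side \<open>k\<close> goes to the end of its
  partner. For the sides whose pairing is only given as an inverse this is read off from the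
  partner.\<close>

lemma glue_ideal:
  assumes k: "k \<in> pieces" "\<not> ell k"
  shows "\<gamma> k (V (k - 1)) = V (paired k) \<and> \<gamma> k (V k) = V (paired k - 1) \<and>
    paired k \<in> pieces \<and> \<not> ell (paired k) \<and> paired (paired k) = k \<and> paired k \<noteq> k"
proof -
  note p = piece [OF k(1)]
  have pi: "paired k \<in> pieces \<and> \<not> ell (paired k)" if "paired k \<le> 4 * g" "1 \<le> paired k"
    using that ellD(5) [of "paired k"] ellD(5) [of "paired k - 1"] N_eq(1) by (auto simp: pieces_def)
  have C: "V j \<in> cball 0 1" if "j \<le> N" for j using that by (rule V_cball)
  show ?thesis
  proof (cases "k \<le> 4 * g")
    case True
    define q where "q = (k - 1) div 4 + 1"
    have q: "q \<in> {1..g}" "k = 4 * q - 3 \<or> k = 4 * q - 2 \<or> k = 4 * q - 1 \<or> k = 4 * q"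
      using True p(2) by (auto simp: q_def)
    have qN: "4 * q \<le> N" using q(1) N_eq(1) by auto
    define Q where "Q = q - 1"
    have qQ: "q = Q + 1" using q(1) by (simp add: Q_def)
    note a = glue_a [OF q(1)] and b = glue_b [OF q(1)]
    note a1 = a [THEN conjunct2, THEN conjunct1] and a2 = a [THEN conjunct2, THEN conjunct2, THEN conjunct1]
      and a3 = a [THEN conjunct2, THEN conjunct2, THEN conjunct2]
    note b1 = b [THEN conjunct2, THEN conjunct1] and b2 = b [THEN conjunct2, THEN conjunct2, THEN conjunct1]
      and b3 = b [THEN conjunct2, THEN conjunct2, THEN conjunct2]
    have a4: "\<gamma> (4 * q - 1) (V (4 * q - 1)) = V (4 * q - 4)" "\<gamma> (4 * q - 1) (V (4 * q - 2)) = V (4 * q - 3)"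
      by (rule inv_on_cball [OF a3 C a1], use qN in simp, rule inv_on_cball [OF a3 C a2], use qN in simp)
    have b4: "\<gamma> (4 * q - 2) (V (4 * q - 2)) = V (4 * q - 1)" "\<gamma> (4 * q - 2) (V (4 * q - 3)) = V (4 * q)"
      by (rule inv_on_cball [OF b3 C b1], use qN in simp, rule inv_on_cball [OF b3 C b2], use qN in simp)
    have g4: "4 * q \<le> 4 * g" using q(1) by simp
    have pr: "paired (4 * q - 3) = 4 * q - 1" "paired (4 * q - 2) = 4 * q" "paired (4 * q - 1) = 4 * q - 3" "paired (4 * q) = 4 * q - 2"
    proof -
      have "Suc (4 * Q) mod 4 = 1" "Suc (Suc (4 * Q)) mod 4 = 2" "Suc (Suc (Suc (4 * Q))) mod 4 = 3"
        by presburger+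
      then show "paired (4 * q - 3) = 4 * q - 1" "paired (4 * q - 2) = 4 * q" "paired (4 * q - 1) = 4 * q - 3" "paired (4 * q) = 4 * q - 2"
        using g4 unfolding paired_def qQ by simp_all
    qed
    have ar: "4 * q - 3 - 1 = 4 * q - 4" "4 * q - 2 - 1 = 4 * q - 3" "4 * q - 1 - 1 = 4 * q - 2" "1 \<le> 4 * q - 3"
      using qQ by simp_all
    have ne: "4 * q - 1 \<noteq> 4 * q - 3" "4 * q \<noteq> 4 * q - 2" using qQ by simp_all
    have "paired k = 4 * q - 1 \<or> paired k = 4 * q \<or> paired k = 4 * q - 3 \<or> paired k = 4 * q - 2"
      using q(2) by (elim disjE) (simp_all only: pr simp_thms)
    then have pk: "paired k \<le> 4 * g" "1 \<le> paired k" using g4 qQ by auto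
    show ?thesis
      using q(2) pi [OF pk]
      by (elim disjE) (simp_all only: pr ar a1 a2 a4 b1 b2 b4 ne simp_thms ne [symmetric] not_False_eq_True)
  next
    case False
    define j where "j = (k + 1 - 4 * g) div 2 - length ms"
    \<comment> \<open>\<open>c\<close> is the first side of the \<open>j\<close>-th cusp pair, and
      \<open>k\<close> is \<open>c\<close> or \<open>c + 1\<close>.\<close>
    define c where "c = 4 * g + 2 * length ms + 2 * j - 1"
    have big: "4 * g + 2 * length ms < k"
    proof (rule ccontr)
      assume s: "\<not> 4 * g + 2 * length ms < k"
      define i where "i = (k - 1 - 4 * g) div 2"
      have "i < length ms" "k = 4 * g + 2 * i + 1 \<or> k - 1 = 4 * g + 2 * i + 1"
        using False s by (auto simp: i_def)
      then show False using k(2) p(4) ell_iff by blast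
    qed
    have j: "j \<in> {1..t - 1}" "k = c \<or> k = c + 1"
      using big p(3) by (auto simp: j_def c_def num_sides_def)
    have co: "odd c" "4 * g < c" "1 \<le> c" "c + 1 \<le> N" using j(1) by (auto simp: c_def num_sides_def)
    have ne: "\<not> ell c" "\<not> ell (c + 1)" "\<not> ell (c - 1)"
      using j(1) unfolding ell_iff by (auto simp: c_def)
    have pc: "c \<in> pieces" "c + 1 \<in> pieces" using co ne by (auto simp: pieces_def)
    have pr: "paired c = c + 1" "paired (c + 1) = c" using co by (auto simp: paired_def)
    note G = glue_parabolic [OF j(1) c_def]
    note g1 = G [THEN conjunct2, THEN conjunct1] and g2 = G [THEN conjunct2, THEN conjunct2, THEN conjunct1]
      and g3 = G [THEN conjunct2, THEN conjunct2, THEN conjunct2]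
    have g4: "\<gamma> (c + 1) (V c) = V c" "\<gamma> (c + 1) (V (c + 1)) = V (c - 1)"
      by (rule inv_on_cball [OF g3 C g1], use co in simp, rule inv_on_cball [OF g3 C g2], use co in simp)
    have ar: "c + 1 - 1 = c" "c + 1 \<noteq> c" by simp_all
    show ?thesis
      using j(2) pc ne by (elim disjE) (simp_all only: pr ar g1 g2 g4 simp_thms ar(2) [symmetric] not_False_eq_True)
  qed
qed

end

section \<open>The half-open domain of bijectivity\<close>

context partitioned_polygon begin

text \<open>Positions count rotation steps counter-clockwise from \<open>V (k - 1)\<close>.\<close>

definition orb :: "nat \<Rightarrow> real \<Rightarrow> complex" where
  "orb k = rotation_orbit (V k) (V (k - 1)) (ord k)"

lemma ell_orb:
  assumes "ell k"
  shows "V k \<in> ball 0 1" "V (k - 1) \<in> sphere 0 1" "2 \<le> ord k" "2 \<le> real (ord k)"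
    "V (k + 1) \<in> sphere 0 1"
  using elliptic_vertex [OF assms] S_ends(1,2) [OF ell_piece [OF assms]] ellD(9) [OF assms] assms
  by (auto simp: top_def)

context
  fixes k
  assumes ell: "ell k"
begin

lemmas orb_sphere = rotation_orbit_sphere [OF ell_orb(1-3) [OF ell], folded orb_def]
  and orb_period = rotation_orbit_period [OF ell_orb(1-3) [OF ell], folded orb_def]
  and orb_0 = rotation_orbit_0 [OF ell_orb(1-3) [OF ell], folded orb_def]
  and orb_arc_co = arc_co_rotation_orbit [OF ell_orb(1-3) [OF ell], folded orb_def]
  and orb_arc_cc = arc_cc_rotation_orbit [OF ell_orb(1-3) [OF ell], folded orb_def]
  and orb_eq_iff = rotation_orbit_eq_iff [OF ell_orb(1-3) [OF ell], folded orb_def]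
  and orb_eqI = rotation_orbit_eqI [OF ell_orb(1-3) [OF ell], folded orb_def]
  and orb_cover = rotation_orbit_cover [OF ell_orb(1-3) [OF ell], folded orb_def]
  and orb_isometry = isometry_rotation_orbit [OF ell_orb(1-3) [OF ell], folded orb_def]
  and orb_chord = rotation_orbit_chord [OF ell_orb(1-3) [OF ell], folded orb_def]

end

lemma orb_inj:
  assumes "ell k" "0 \<le> x" "x < real (ord k)" "0 \<le> y" "y < real (ord k)" "orb k x = orb k y"
  shows "x = y"
proof (cases "x \<le> y")
  case True
  then show ?thesis using orb_eq_iff [OF assms(1), of x y] assms by simp
next
  case False
  then show ?thesis using orb_eq_iff [OF assms(1), of y x] assms by simp
qed

text \<open>The interior angle is one rotation step, swept from \<open>V (k + 1)\<close> to
  \<open>V (k - 1)\<close>. So \<open>V (k + 1)\<close> has position -1, that is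
  \<open>ord k - 1\<close>.\<close>

lemma orb_top:
  assumes "ell k"
  shows "orb k (real (ord k) - 1) = V (k + 1)"
proof -
  note e = ell_orb [OF assms]
  obtain i where i: "i < length ms" "k = 4 * g + 2 * i + 1" "ord k = ms ! i"
    using assms by (rule ell_cases)
  define z where "z = Moebius_function 0 (V k) (V (k - 1)) / Moebius_function 0 (V k) (V (k + 1))"
  have n: "cmod (Moebius_function 0 (V k) (V (k - 1))) = 1" "cmod (Moebius_function 0 (V k) (V (k + 1))) = 1"
    using e by (auto intro!: norm_Moebius_function_sphere)
  have "Arg2pi z = 2 * pi / real (ord k)"
    using angle [of "i + 1" k] i by (simp add: interior_angle_def z_def)
  moreover have "z \<in> sphere 0 1" using n by (simp add: z_def norm_divide)
  ultimately have z: "z = cis (2 * pi / real (ord k))" using sphere_eq_cis by metis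
  have "Moebius_function 0 (V k) (V (k - 1)) = z * Moebius_function 0 (V k) (V (k + 1))"
    using n(2) by (auto simp: z_def)
  then have "cis (2 * pi * (- 1) / real (ord k)) * Moebius_function 0 (V k) (V (k - 1)) =
      (cis (2 * pi * (- 1) / real (ord k)) * z) * Moebius_function 0 (V k) (V (k + 1))"
    by (simp only: mult.assoc)
  also have "cis (2 * pi * (- 1) / real (ord k)) * z = 1" by (simp add: z cis_mult)
  finally have eq: "Moebius_function 0 (V k) (V (k + 1)) = cis (2 * pi * (- 1) / real (ord k)) * Moebius_function 0 (V k) (V (k - 1))"
    by (simp only: mult_1)
  have "V (k + 1) = orb k (- 1)"
    by (rule orb_eqI [OF assms e(5) eq])
  also have "\<dots> = orb k (- 1 + real (ord k))" by (rule orb_period [OF assms, symmetric])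
  also have "- 1 + real (ord k) = real (ord k) - 1" by simp
  finally show ?thesis ..
qed

text \<open>The pairing fixes \<open>V k\<close> and sends position 0 to \<open>ord k - 1\<close>,
  which is a shift by -1 modulo the period; one value determines the rotation.\<close>

lemma \<gamma>_orb:
  assumes "ell k"
  shows "\<gamma> k (orb k x) = orb k (x - 1)" "\<gamma> (k + 1) (orb k x) = orb k (x + 1)"
proof -
  note G = glue_elliptic [OF assms]
  have "\<gamma> k (orb k 0) = orb k (real (ord k) - 1)"
    unfolding orb_0 [OF assms] orb_top [OF assms]
    by (rule G [THEN conjunct2, THEN conjunct2, THEN conjunct1])
  also have "\<dots> = orb k (0 + - 1)"
    using orb_period [OF assms, of "- 1"] by simp
  finally have g: "\<gamma> k (orb k x) = orb k (x - 1)" for x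
    using orb_isometry [OF assms isometry [OF ellD(3) [OF assms]] G [THEN conjunct2, THEN conjunct1], of 0 "- 1"]
    by simp
  show "\<gamma> k (orb k x) = orb k (x - 1)" by (rule g)
  show "\<gamma> (k + 1) (orb k x) = orb k (x + 1)"
  proof (rule inv_on_cball [where g = "\<gamma> (k + 1)" and f = "\<gamma> k"])
    show "\<forall>z\<in>cball 0 1. \<gamma> (k + 1) (\<gamma> k z) = z" by (rule G [THEN conjunct2, THEN conjunct2, THEN conjunct2])
    show "orb k (x + 1) \<in> cball 0 1" using orb_sphere [OF assms, of "x + 1"] by simp
    show "\<gamma> k (orb k (x + 1)) = orb k x" unfolding g by simp
  qed
qed

lemma S_orb:
  assumes "ell k"
  shows "S k = orb k ` {0..<real (ord k) - 1}"
proof -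
  have "S k = arc_co (orb k 0) (orb k (real (ord k) - 1))"
    unfolding orb_0 [OF assms] orb_top [OF assms] S_def using assms by (simp add: top_def)
  then show ?thesis
    using orb_arc_co [OF assms, of 0 "real (ord k) - 1"] ell_orb(4) [OF assms] by simp
qed

lemma orb_mem_S:
  assumes "ell k" "0 \<le> x" "x < real (ord k)"
  shows "orb k x \<in> S k \<longleftrightarrow> x < real (ord k) - 1"
proof
  assume "orb k x \<in> S k"
  then obtain y where "0 \<le> y" "y < real (ord k) - 1" "orb k x = orb k y" unfolding S_orb [OF assms(1)] by auto
  then show "x < real (ord k) - 1" using orb_inj [OF assms, of y] by simp
next
  assume "x < real (ord k) - 1"
  then show "orb k x \<in> S k" unfolding S_orb [OF assms(1)] using assms(2) by simp
qed

definition apos :: "nat \<Rightarrow> real" where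
  "apos k = (SOME a. 0 < a \<and> a < real (ord k) - 1 \<and> A k = orb k a)"

lemma apos:
  assumes "ell k"
  shows "0 < apos k" "apos k < real (ord k) - 1" "A k = orb k (apos k)"
proof -
  obtain a where a: "0 \<le> a" "a < real (ord k) - 1" "A k = orb k a"
    using A_elliptic(2) [OF assms] unfolding S_orb [OF assms] by auto
  have "a \<noteq> 0" using a(3) A_elliptic(3) [OF assms] orb_0 [OF assms] by auto
  then have "\<exists>a. 0 < a \<and> a < real (ord k) - 1 \<and> A k = orb k a" using a by (intro exI [of _ a]) simp
  then have "0 < apos k \<and> apos k < real (ord k) - 1 \<and> A k = orb k (apos k)"
    unfolding apos_def by (rule someI_ex)
  then show "0 < apos k" "apos k < real (ord k) - 1" "A k = orb k (apos k)" by blast+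
qed

lemma F_elliptic:
  assumes "ell k" "0 \<le> y" "y < real (ord k) - 1"
  shows "F (u, orb k y) = (if y < apos k then (\<gamma> k u, \<gamma> k (orb k y)) else (\<gamma> (k + 1) u, \<gamma> (k + 1) (orb k y)))"
proof -
  note k = ellD [OF assms(1)] note a = apos [OF assms(1)] note e = assms(1)
  have A0: "A (k - 1) = orb k 0"
    unfolding orb_0 [OF e] by (rule A_ideal) (use k in auto)
  have A1: "A (k + 1) = orb k (real (ord k) - 1)"
    unfolding orb_top [OF assms(1)] by (rule A_ideal) (use k in auto)
  show ?thesis
  proof (cases "y < apos k")
    case True
    have "arc_co (A (k - 1)) (A k) = orb k ` {0..<apos k}"
      unfolding A0 a(3) by (rule orb_arc_co [OF e]) (use a in auto)
    then have "orb k y \<in> arc_co (A (k - 1)) (A k)" using True assms(2) by simp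
    then show ?thesis using True F_eq [OF k(3)] by simp
  next
    case False
    have "arc_co (A k) (A (k + 1)) = orb k ` {apos k..<real (ord k) - 1}"
      unfolding A1 a(3) by (rule orb_arc_co [OF e]) (use a in auto)
    then have "orb k y \<in> arc_co (A (k + 1 - 1)) (A (k + 1))" using False assms(3) by simp
    then show ?thesis using False F_eq [OF k(4)] by simp
  qed
qed

lemma orb_wrap:
  assumes "ell k"
  shows "orb k (wrap_down (ord k) x) = orb k (x - 1)" "orb k (wrap_up (ord k) x) = orb k (x + 1)"
  using orb_period [OF assms, of "x - 1"] orb_period [OF assms, of "x + 1 - real (ord k)"]
  by (simp_all add: wrap_down_def wrap_up_def)

definition orb2 :: "nat \<Rightarrow> real \<times> real \<Rightarrow> complex \<times> complex" where
  "orb2 k = map_prod (orb k) (orb k)"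

lemma F_orb2:
  assumes "ell k" "0 \<le> snd z" "snd z < real (ord k) - 1"
  shows "F (orb2 k z) = orb2 k (elliptic_step (ord k) (apos k) z)"
proof -
  obtain x y where z: "z = (x, y)" by fastforce
  show ?thesis
    using F_elliptic [OF assms(1), of y "orb k x"] assms unfolding z
    by (simp add: orb2_def elliptic_step_def \<gamma>_orb [OF assms(1)] \<gamma>_orb(2) [OF assms(1), unfolded Suc_eq_plus1 [symmetric]]
        orb_wrap [OF assms(1)])
qed

lemma orb2_inj:
  assumes "ell k"
  shows "inj_on (orb2 k) ({0..<real (ord k)} \<times> {0..<real (ord k)})"
proof (rule inj_onI)
  fix z z' assume z: "z \<in> {0..<real (ord k)} \<times> {0..<real (ord k)}" "z' \<in> {0..<real (ord k)} \<times> {0..<real (ord k)}"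
    "orb2 k z = orb2 k z'"
  have "fst z = fst z'" by (rule orb_inj [OF assms]) (use z in \<open>auto simp: orb2_def\<close>)
  moreover have "snd z = snd z'" by (rule orb_inj [OF assms]) (use z in \<open>auto simp: orb2_def\<close>)
  ultimately show "z = z'" by (rule prod_eqI)
qed

section \<open>Pieces of the half-open domain and their images\<close>

definition region :: "nat \<Rightarrow> (real \<times> real) set" where
  "region k = elliptic_region (ord k) (apos k)"

lemma regionD:
  assumes "z \<in> region k"
  shows "0 \<le> fst z" "fst z < real (ord k)" "0 \<le> snd z" "snd z < real (ord k) - 1"
    "z \<in> {0..<real (ord k)} \<times> {0..<real (ord k)}"
  using assms by (auto simp: region_def elliptic_region_def split: prod.splits)

definition W :: "nat \<Rightarrow> (complex \<times> complex) set" where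
  "W k = (if ell k then orb2 k ` region k else (sphere 0 1 - S k) \<times> S k)"

definition half_open_domain :: "(complex \<times> complex) set" where
  "half_open_domain = (\<Union>k\<in>pieces. W k)"

lemma W_subset:
  assumes "k \<in> pieces"
  shows "W k \<subseteq> sphere 0 1 \<times> S k"
proof (cases "ell k")
  case True
  have "orb2 k z \<in> sphere 0 1 \<times> S k" if "z \<in> region k" for z
  proof -
    have "orb k (snd z) \<in> S k" using orb_mem_S [OF True, of "snd z"] regionD [OF that] by simp
    then show ?thesis using orb_sphere [OF True, of "fst z"] unfolding orb2_def by (cases z) simp
  qed
  then show ?thesis using True unfolding W_def by (simp add: image_subset_iff)
qed (auto simp: W_def)

lemma half_open_domain_iff:
  assumes "k \<in> pieces" "w \<in> S k"
  shows "(u, w) \<in> half_open_domain \<longleftrightarrow> (u, w) \<in> W k"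
proof
  assume "(u, w) \<in> half_open_domain"
  then obtain j where j: "j \<in> pieces" "(u, w) \<in> W j" by (auto simp: half_open_domain_def)
  then have "w \<in> S j" using W_subset by blast
  then show "(u, w) \<in> W k" using pieces_disjoint [OF j(1) assms(1)] assms(2) j(2) by blast
qed (use assms in \<open>auto simp: half_open_domain_def\<close>)

lemma elliptic_W_iff:
  assumes "ell k" "0 \<le> x" "x < real (ord k)" "0 \<le> y" "y < real (ord k)"
  shows "(orb k x, orb k y) \<in> W k \<longleftrightarrow> (x, y) \<in> region k"
proof -
  have "(orb k x, orb k y) = orb2 k (x, y)" by (simp add: orb2_def)
  moreover have "orb2 k (x, y) \<in> orb2 k ` region k \<longleftrightarrow> (x, y) \<in> region k"
    by (rule inj_on_image_mem_iff [OF orb2_inj [OF assms(1)]]) (use assms regionD(5) in auto)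
  ultimately show ?thesis using assms(1) by (simp add: W_def)
qed

text \<open>Around an elliptic vertex, a first coordinate outside the sector has position at least
  \<open>ord k - 1\<close>, and every strip contains these positions because the ceiling of a
  positive number is at least 1.\<close>

lemma different_pieces:
  assumes k: "k \<in> pieces" and w: "w \<in> S k" and u: "u \<in> sphere 0 1" "u \<notin> S k"
  shows "(u, w) \<in> half_open_domain"
proof -
  have "(u, w) \<in> W k"
  proof (cases "ell k")
    case True
    obtain x where x: "0 \<le> x" "x < 0 + real (ord k)" "u = orb k x"
      using orb_cover [OF True u(1)] by blast
    obtain y where y: "0 \<le> y" "y < real (ord k) - 1" "w = orb k y"
      using w unfolding S_orb [OF True] by auto
    have xm: "real (ord k) - 1 \<le> x" using u(2) x orb_mem_S [OF True, of x] by auto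
    have "real (ord k) - of_int \<lceil>apos k - y\<rceil> \<le> x" if "y < apos k"
    proof -
      have "1 \<le> \<lceil>apos k - y\<rceil>" using that by simp
      then have "1 \<le> real_of_int \<lceil>apos k - y\<rceil>" by linarith
      then show ?thesis using xm by linarith
    qed
    then have "(x, y) \<in> region k"
      using x y xm unfolding region_def elliptic_region_def by simp
    then show ?thesis using elliptic_W_iff [OF True, of x y] x y by simp
  qed (use assms in \<open>simp add: W_def\<close>)
  then show ?thesis using k by (auto simp: half_open_domain_def)
qed

text \<open>On the domain, \<open>F\<close> turns a second coordinate in \<open>S k\<close> into a
  first coordinate in \<open>S (\<sigma> k)\<close>.\<close>

definition \<sigma> :: "nat \<Rightarrow> nat" where
  "\<sigma> k = (if ell k then k else paired k)"

lemma \<sigma>_pieces: "k \<in> pieces \<Longrightarrow> \<sigma> k \<in> pieces" "k \<in> pieces \<Longrightarrow> \<sigma> (\<sigma> k) = k"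
proof -
  assume k: "k \<in> pieces"
  show "\<sigma> k \<in> pieces" "\<sigma> (\<sigma> k) = k"
    using glue_ideal [OF k] k by (auto simp: \<sigma>_def)
qed

lemma \<gamma>_ideal_image:
  assumes k: "k \<in> pieces" "\<not> ell k"
  shows "\<gamma> k ` S k = sphere 0 1 - S (paired k)" "\<gamma> k ` (sphere 0 1 - S k) = S (paired k)"
proof -
  note G = glue_ideal [OF k] note T = isometry [OF piece(1) [OF k(1)]]
  have q: "paired k \<in> pieces" "\<not> ell (paired k)" using G by blast+
  have t: "top k = k" "top (paired k) = paired k" using k q by (simp_all add: top_def)
  note e = S_ends(1-3) [OF k(1), unfolded t] and e' = S_ends(1-3) [OF q(1), unfolded t]
  have S: "S k = arc_co (V (k - 1)) (V k)" "S (paired k) = arc_co (V (paired k - 1)) (V (paired k))"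
    by (simp_all add: S_def t)
  have V: "\<gamma> k (V (k - 1)) = V (paired k)" "\<gamma> k (V k) = V (paired k - 1)" using G by blast+
  show "\<gamma> k ` S k = sphere 0 1 - S (paired k)"
    unfolding S disk_isometry_image_arc_co [OF T e(1,2)] V sphere_minus_arc_co [OF e'] ..
  show "\<gamma> k ` (sphere 0 1 - S k) = S (paired k)"
    unfolding S sphere_minus_arc_co [OF e] disk_isometry_image_arc_co [OF T e(2,1)] V ..
qed

lemma map_prod_image_Times: "map_prod f h ` (X \<times> Y) = (f ` X) \<times> (h ` Y)"
  by force

text \<open>The pieces sort the domain by the second coordinate, their images sort it by the first.
  For an ideal side, inside and outside of the arc are exchanged. For an elliptic pair,
  \<open>bij_betw_elliptic_step\<close> describes the image, and the pairs whose second coordinate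
  has left the sector belong to the domain by \<open>different_pieces\<close>.\<close>

lemma bij_betw_piece:
  assumes k: "k \<in> pieces"
  shows "bij_betw F (W k) {z \<in> half_open_domain. fst z \<in> S (\<sigma> k)}"
proof (cases "ell k")
  case False
  note q = \<sigma>_pieces(1) [OF k]
  have \<sigma>: "\<sigma> k = paired k" "\<not> ell (\<sigma> k)" using False glue_ideal [OF k False] by (auto simp: \<sigma>_def)
  note T = isometry [OF piece(1) [OF k]]
  have F: "F z = map_prod (\<gamma> k) (\<gamma> k) z" if "z \<in> W k" for z
    using that False F_ideal [OF k False, of "snd z" "fst z"] by (auto simp: W_def)
  have "F ` W k = map_prod (\<gamma> k) (\<gamma> k) ` ((sphere 0 1 - S k) \<times> S k)"
    using F False by (auto simp: W_def)
  also have "\<dots> = S (\<sigma> k) \<times> (sphere 0 1 - S (\<sigma> k))"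
    unfolding \<sigma>(1) map_prod_image_Times \<gamma>_ideal_image [OF k False] ..
  also have "\<dots> = {z \<in> half_open_domain. fst z \<in> S (\<sigma> k)}"
  proof (rule set_eqI)
    fix z :: "complex \<times> complex"
    obtain u w where z: "z = (u, w)" by fastforce
    show "z \<in> S (\<sigma> k) \<times> (sphere 0 1 - S (\<sigma> k)) \<longleftrightarrow> z \<in> {z \<in> half_open_domain. fst z \<in> S (\<sigma> k)}"
    proof
      assume "z \<in> S (\<sigma> k) \<times> (sphere 0 1 - S (\<sigma> k))"
      then have *: "u \<in> S (\<sigma> k)" "w \<in> sphere 0 1" "w \<notin> S (\<sigma> k)" by (auto simp: z)
      then obtain j where j: "j \<in> pieces" "w \<in> S j" using pieces_cover by blast
      have "u \<notin> S j" using pieces_disjoint [OF q j(1) *(1)] *(3) j(2) by blast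
      then have "(u, w) \<in> half_open_domain" using different_pieces [OF j] *(1) S_subset by blast
      then show "z \<in> {z \<in> half_open_domain. fst z \<in> S (\<sigma> k)}" using * by (simp add: z)
    next
      assume "z \<in> {z \<in> half_open_domain. fst z \<in> S (\<sigma> k)}"
      then have *: "(u, w) \<in> half_open_domain" "u \<in> S (\<sigma> k)" by (auto simp: z)
      have "w \<notin> S (\<sigma> k)"
        using half_open_domain_iff [OF q, of w u] * \<sigma>(2) by (auto simp: W_def)
      moreover have "w \<in> sphere 0 1"
        using *(1) W_subset S_subset unfolding half_open_domain_def by blast
      ultimately show "z \<in> S (\<sigma> k) \<times> (sphere 0 1 - S (\<sigma> k))" using * by (simp add: z)
    qed
  qed
  finally have "F ` W k = {z \<in> half_open_domain. fst z \<in> S (\<sigma> k)}" .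
  moreover have "inj_on F (W k)"
  proof (rule inj_onI)
    fix z z' assume z: "z \<in> W k" "z' \<in> W k" "F z = F z'"
    then have s: "fst z \<in> sphere 0 1" "snd z \<in> sphere 0 1" "fst z' \<in> sphere 0 1" "snd z' \<in> sphere 0 1"
      using W_subset [OF k] S_subset by force+
    have "\<gamma> k (fst z) = \<gamma> k (fst z')" "\<gamma> k (snd z) = \<gamma> k (snd z')"
      using z(3) unfolding F [OF z(1)] F [OF z(2)] by (metis fst_map_prod, metis snd_map_prod)
    then show "z = z'" using disk_isometry_eq_iff [OF T] s by (simp add: prod_eq_iff)
  qed
  ultimately show ?thesis by (simp add: bij_betw_def)
next
  case True
  define m where "m = ord k"
  define B where "B = {(x, y). 0 \<le> x \<and> x < real m - 1 \<and> 0 \<le> y \<and> y < real m \<and>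
      (real m - 1 \<le> y \<or> (x, y) \<in> elliptic_region m (apos k))}"
  have \<sigma>: "\<sigma> k = k" using True by (simp add: \<sigma>_def)
  have Wk: "W k = orb2 k ` region k" using True by (simp add: W_def)
  have step: "bij_betw (elliptic_step m (apos k)) (region k) B"
    unfolding B_def region_def m_def
    by (rule bij_betw_elliptic_step) (use ell_orb(3) [OF True] apos [OF True] in auto)
  have Bsub: "B \<subseteq> {0..<real (ord k)} \<times> {0..<real (ord k)}" by (auto simp: B_def m_def)
  have "bij_betw (orb2 k) (region k) (W k)"
    unfolding Wk by (intro inj_on_imp_bij_betw inj_on_subset [OF orb2_inj [OF True]]) (use regionD(5) in blast)
  then have inv: "bij_betw (inv_into (region k) (orb2 k)) (W k) (region k)" by (rule bij_betw_inv_into)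
  have "bij_betw (orb2 k) B (orb2 k ` B)"
    by (intro inj_on_imp_bij_betw inj_on_subset [OF orb2_inj [OF True]] Bsub)
  then have comp: "bij_betw (orb2 k \<circ> (elliptic_step m (apos k) \<circ> inv_into (region k) (orb2 k))) (W k) (orb2 k ` B)"
    using bij_betw_trans [OF bij_betw_trans [OF inv step]] by blast
  have "F z = (orb2 k \<circ> (elliptic_step m (apos k) \<circ> inv_into (region k) (orb2 k))) z" if "z \<in> W k" for z
  proof -
    have "inv_into (region k) (orb2 k) z \<in> region k" "orb2 k (inv_into (region k) (orb2 k) z) = z"
      using that unfolding Wk by (auto intro: inv_into_into f_inv_into_f)
    then show ?thesis
      using F_orb2 [OF True, of "inv_into (region k) (orb2 k) z"] regionD(3,4) by (simp add: m_def)
  qed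
  then have 1: "bij_betw F (W k) (orb2 k ` B)"
    using comp by (simp cong: bij_betw_cong)
  have "orb2 k ` B = {z \<in> half_open_domain. fst z \<in> S (\<sigma> k)}"
  proof
    show "orb2 k ` B \<subseteq> {z \<in> half_open_domain. fst z \<in> S (\<sigma> k)}"
    proof (rule image_subsetI)
      fix z assume z: "z \<in> B"
      obtain x y where xy: "z = (x, y)" by fastforce
      have b: "0 \<le> x" "x < real (ord k) - 1" "0 \<le> y" "y < real (ord k)"
        "real (ord k) - 1 \<le> y \<or> (x, y) \<in> region k"
        using z by (simp_all add: B_def xy m_def region_def)
      have u: "orb k x \<in> S k" using orb_mem_S [OF True, of x] b by simp
      have "(orb k x, orb k y) \<in> half_open_domain"
      proof (cases "(x, y) \<in> region k")
        case r: True
        then show ?thesis using elliptic_W_iff [OF True, of x y] b k by (auto simp: half_open_domain_def)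
      next
        case False
        then have w: "orb k y \<notin> S k" using orb_mem_S [OF True, of y] b by auto
        obtain j where j: "j \<in> pieces" "orb k y \<in> S j"
          using pieces_cover [OF orb_sphere [OF True]] by blast
        have "orb k x \<notin> S j" using pieces_disjoint [OF k j(1) u] w j(2) by blast
        then show ?thesis using different_pieces [OF j] u S_subset by blast
      qed
      then show "orb2 k z \<in> {z \<in> half_open_domain. fst z \<in> S (\<sigma> k)}" using u by (simp add: xy orb2_def \<sigma>)
    qed
    show "{z \<in> half_open_domain. fst z \<in> S (\<sigma> k)} \<subseteq> orb2 k ` B"
    proof
      fix z assume "z \<in> {z \<in> half_open_domain. fst z \<in> S (\<sigma> k)}"
      moreover obtain u w where z: "z = (u, w)" by fastforce
      ultimately have uw: "(u, w) \<in> half_open_domain" "u \<in> S k" by (auto simp: \<sigma>)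
      obtain x where x: "0 \<le> x" "x < real (ord k) - 1" "u = orb k x"
        using uw(2) unfolding S_orb [OF True] by auto
      have "w \<in> sphere 0 1" using uw(1) W_subset S_subset unfolding half_open_domain_def by blast
      then obtain y where y: "0 \<le> y" "y < 0 + real (ord k)" "w = orb k y"
        using orb_cover [OF True] by blast
      have "real (ord k) - 1 \<le> y \<or> (x, y) \<in> region k"
      proof (cases "y < real (ord k) - 1")
        case y': True
        then have "w \<in> S k" using orb_mem_S [OF True, of y] y by simp
        then have "(u, w) \<in> W k" using half_open_domain_iff [OF k] uw by blast
        then show ?thesis using elliptic_W_iff [OF True, of x y] x y by simp
      qed simp
      then have "(x, y) \<in> B" using x y by (simp add: B_def m_def region_def)
      then show "z \<in> orb2 k ` B" by (rule rev_image_eqI) (simp add: z orb2_def x y)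
    qed
  qed
  then show ?thesis using 1 by simp
qed

text \<open>As \<sigma> is an involution of the pieces, the sets \<open>R k\<close> form a partition
  of the domain just as the sets \<open>W k\<close> do.\<close>

lemma bij_betw_half_open_domain: "bij_betw F half_open_domain half_open_domain"
proof -
  define R where "R k = {z \<in> half_open_domain. fst z \<in> S (\<sigma> k)}" for k
  note b = bij_betw_piece [folded R_def]
  have "inj_on F half_open_domain"
  proof (rule inj_onI)
    fix z z' assume z: "z \<in> half_open_domain" "z' \<in> half_open_domain" "F z = F z'"
    obtain k where k: "k \<in> pieces" "z \<in> W k" using z(1) by (auto simp: half_open_domain_def)
    obtain k' where k': "k' \<in> pieces" "z' \<in> W k'" using z(2) by (auto simp: half_open_domain_def)
    have "F z \<in> R k" "F z' \<in> R k'" using b k k' bij_betwE by blast+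
    then have "fst (F z) \<in> S (\<sigma> k)" "fst (F z) \<in> S (\<sigma> k')" using z(3) by (simp_all add: R_def)
    then have "\<sigma> k = \<sigma> k'" using pieces_disjoint \<sigma>_pieces(1) k k' by blast
    then have "k = k'" using \<sigma>_pieces(2) k k' by metis
    then show "z = z'" using b [OF k(1)] k k' z(3) unfolding bij_betw_def inj_on_def by blast
  qed
  moreover have "F ` half_open_domain = half_open_domain"
  proof -
    have "F ` half_open_domain = (\<Union>k\<in>pieces. R k)"
      unfolding half_open_domain_def image_UN using b by (simp add: bij_betw_def)
    also have "\<dots> = half_open_domain"
    proof
      show "half_open_domain \<subseteq> (\<Union>k\<in>pieces. R k)"
      proof
        fix z assume z: "z \<in> half_open_domain"
        then have "fst z \<in> sphere 0 1" using W_subset unfolding half_open_domain_def by fastforce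
        then obtain k where k: "k \<in> pieces" "fst z \<in> S k" using pieces_cover by blast
        then have "z \<in> R (\<sigma> k)" using z \<sigma>_pieces by (simp add: R_def)
        then show "z \<in> (\<Union>k\<in>pieces. R k)" using \<sigma>_pieces(1) k by blast
      qed
    qed (auto simp: R_def)
    finally show ?thesis .
  qed
  ultimately show ?thesis by (simp add: bij_betw_def)
qed

text \<open>In a lower strip \<open>x\<close> exceeds \<open>y\<close> by more than
  \<open>ord k - 1 - apos k\<close>; in an upper strip \<open>x\<close> is at least
  \<open>ord k - 1\<close>, hence above \<open>y\<close>, or smaller than
  \<open>y - apos k\<close>.\<close>

lemma half_open_domain_off_diagonal: "half_open_domain \<subseteq> off_diagonal"
proof
  fix z assume "z \<in> half_open_domain"
  then obtain k where k: "k \<in> pieces" "z \<in> W k" by (auto simp: half_open_domain_def)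
  obtain u w where z: "z = (u, w)" by fastforce
  have s: "u \<in> sphere 0 1" "w \<in> S k" "w \<in> sphere 0 1" using W_subset [OF k(1)] k(2) S_subset z by blast+
  have "u \<noteq> w"
  proof (cases "ell k")
    case True
    show ?thesis
    proof
      assume "u = w"
      obtain x y where r: "(x, y) \<in> region k" "(u, w) = orb2 k (x, y)"
        using k(2) True z by (auto simp: W_def)
      note d = regionD [OF r(1), unfolded fst_conv snd_conv]
      have "u = orb k x" "w = orb k y" using r(2) by (simp_all add: orb2_def)
      then have "orb k x = orb k y" using \<open>u = w\<close> by simp
      then have "x = y" using orb_inj [OF True, of x y] d by simp
      then have yy: "(y, y) \<in> elliptic_region (ord k) (apos k)" using r(1) by (simp add: region_def)
      show False
      proof (cases "y < apos k")
        case True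
        have "real (ord k) - real_of_int \<lceil>apos k - y\<rceil> \<le> y" using yy True by (simp add: elliptic_region_def)
        moreover have "real_of_int \<lceil>apos k - y\<rceil> < apos k - y + 1" by linarith
        ultimately show False using apos(2) [OF \<open>ell k\<close>] by linarith
      next
        case False
        have "y < real_of_int \<lfloor>y - apos k\<rfloor>" using yy False by (auto simp: elliptic_region_def)
        moreover have "real_of_int \<lfloor>y - apos k\<rfloor> \<le> y - apos k" by linarith
        ultimately show False using apos(1) [OF \<open>ell k\<close>] by linarith
      qed
    qed
  next
    case False
    then show ?thesis using k(2) z by (auto simp: W_def)
  qed
  then show "z \<in> off_diagonal" using s by (simp add: z off_diagonal_def)
qed

end

section \<open>The closure of the half-open domain\<close>

lemma torus_null_subset: "torus_null Y \<Longrightarrow> X \<subseteq> Y \<Longrightarrow> torus_null X"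
  unfolding torus_null_def by (erule negligible_subset) auto

lemma torus_null_Un: "torus_null X \<Longrightarrow> torus_null Y \<Longrightarrow> torus_null (X \<union> Y)"
  unfolding torus_null_def Un_iff Collect_disj_eq by (rule negligible_Un)

lemma torus_null_UN:
  assumes "finite I" "\<And>i. i \<in> I \<Longrightarrow> torus_null (X i)"
  shows "torus_null (\<Union>i\<in>I. X i)"
  using assms
proof (induction I rule: finite_induct)
  case empty
  then show ?case by (simp add: torus_null_def)
next
  case (insert i I)
  then show ?case by (simp add: torus_null_Un)
qed

lemma countable_cis_eq: "countable {t. cis t = e}"
proof -
  have "{t. cis t = e} \<subseteq> range (\<lambda>n::int. Arg2pi e + 2 * pi * of_int n)"
  proof
    fix t assume "t \<in> {t. cis t = e}"
    then have e: "cis t = e" by simp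
    then have "cis (Arg2pi e) = cis t" using sphere_eq_cis [of e] by force
    then have "sin t = sin (Arg2pi e) \<and> cos t = cos (Arg2pi e)" by (simp add: complex_eq_iff)
    then obtain n :: int where "t = Arg2pi e + 2 * pi * of_int n"
      using sin_cos_eq_iff [of t "Arg2pi e"] by auto
    then show "t \<in> range (\<lambda>n::int. Arg2pi e + 2 * pi * of_int n)" by blast
  qed
  then show ?thesis by (rule countable_subset) simp
qed

text \<open>In the plane of angles such a line lifts to countably many parallel lines.\<close>

lemma torus_null_lines: "torus_null ({e} \<times> UNIV)" "torus_null (UNIV \<times> {e})"
proof -
  have 1: "negligible {p :: real \<times> real. fst p = t}" and 2: "negligible {p :: real \<times> real. snd p = t}" for t
  proof -
    have b: "((1, 0) :: real \<times> real) \<in> Basis" "((0, 1) :: real \<times> real) \<in> Basis" by (auto simp: Basis_prod_def)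
    show "negligible {p :: real \<times> real. fst p = t}" "negligible {p :: real \<times> real. snd p = t}"
      using negligible_standard_hyperplane [OF b(1), of t] negligible_standard_hyperplane [OF b(2), of t]
      by (simp_all add: inner_prod_def)
  qed
  have n: "negligible (\<Union>t\<in>{t. cis t = e}. {p :: real \<times> real. f p = t})"
    if "\<And>t. negligible {p :: real \<times> real. f p = t}" for f
    by (rule negligible_countable_Union) (use that countable_cis_eq in auto)
  have "{p :: real \<times> real. (cis (fst p), cis (snd p)) \<in> {e} \<times> UNIV} = (\<Union>t\<in>{t. cis t = e}. {p. fst p = t})"
    "{p :: real \<times> real. (cis (fst p), cis (snd p)) \<in> UNIV \<times> {e}} = (\<Union>t\<in>{t. cis t = e}. {p. snd p = t})"
    by auto
  then show "torus_null ({e} \<times> UNIV)" "torus_null (UNIV \<times> {e})"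
    unfolding torus_null_def using n [OF 1] n [OF 2] by simp_all
qed

text \<open>The two properties that the attractor needs, the right closure and a null difference,
  are bundled because both pass to products of arcs and to finite unions.\<close>

definition null_closure :: "(complex \<times> complex) set \<Rightarrow> (complex \<times> complex) set \<Rightarrow> bool" where
  "null_closure X Y \<longleftrightarrow> closure X = Y \<and> torus_null (Y - X)"

lemma null_closure_Times:
  assumes "closure X = X'" "closure Y = Y'" "X' \<subseteq> insert x X" "Y' \<subseteq> insert y Y"
  shows "null_closure (X \<times> Y) (X' \<times> Y')"
proof -
  have "torus_null ({x} \<times> UNIV \<union> UNIV \<times> {y})"
    by (intro torus_null_Un torus_null_lines)
  then have "torus_null (X' \<times> Y' - X \<times> Y)"
    by (rule torus_null_subset) (use assms in auto)
  then show ?thesis using assms by (simp add: null_closure_def closure_Times)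
qed

lemma null_closure_UN:
  assumes "finite I" "\<And>i. i \<in> I \<Longrightarrow> null_closure (X i) (Y i)"
  shows "null_closure (\<Union>i\<in>I. X i) (\<Union>i\<in>I. Y i)"
proof -
  have "closure (\<Union>i\<in>I. X i) = (\<Union>i\<in>I. closure (X i))"
    using assms(1) by (induction I rule: finite_induct) auto
  also have "\<dots> = (\<Union>i\<in>I. Y i)" using assms(2) by (simp add: null_closure_def)
  finally have "closure (\<Union>i\<in>I. X i) = (\<Union>i\<in>I. Y i)" .
  moreover have "torus_null (\<Union>i\<in>I. Y i - X i)"
    using assms by (intro torus_null_UN) (auto simp: null_closure_def)
  then have "torus_null ((\<Union>i\<in>I. Y i) - (\<Union>i\<in>I. X i))"
    by (rule torus_null_subset) auto
  ultimately show ?thesis by (simp add: null_closure_def)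
qed

lemma null_closure_Un:
  assumes "null_closure X Y" "null_closure X' Y'"
  shows "null_closure (X \<union> X') (Y \<union> Y')"
proof -
  have "torus_null ((Y - X) \<union> (Y' - X'))" using assms by (intro torus_null_Un) (auto simp: null_closure_def)
  then have "torus_null ((Y \<union> Y') - (X \<union> X'))" by (rule torus_null_subset) auto
  then show ?thesis using assms by (simp add: null_closure_def)
qed

context partitioned_polygon begin

text \<open>Together with \<open>lower_strips\<close> these are the numbers \<open>I + 1\<close> and
  \<open>J + 1\<close> of strips around an elliptic vertex of order at least 3, expressed by the
  position of the partition point.\<close>

definition upper_strips :: "nat \<Rightarrow> nat" where "upper_strips k = nat \<lceil>real (ord k) - 1 - apos k\<rceil>"
definition lower_strips :: "nat \<Rightarrow> nat" where "lower_strips k = nat \<lceil>apos k\<rceil>"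

lemma strips_bounds:
  assumes "ell k"
  shows "1 \<le> upper_strips k" "real (upper_strips k) < real (ord k) - apos k" "real (ord k) - 1 - apos k \<le> real (upper_strips k)"
    "1 \<le> lower_strips k" "real (lower_strips k) < apos k + 1" "apos k \<le> real (lower_strips k)"
  using apos(1,2) [OF assms] unfolding upper_strips_def lower_strips_def by linarith+

text \<open>\<open>min\<close> and \<open>max\<close> cut the last upper and the last lower strip
  off at the ends of the sector.\<close>

definition closed_W :: "nat \<Rightarrow> (complex \<times> complex) set" where
  "closed_W k = (if ell k then
      (\<Union>i\<in>{1..upper_strips k}. orb k ` {real (ord k) - 1..real (ord k) - 1 + real i} \<times>
          orb k ` {apos k + real i - 1..min (apos k + real i) (real (ord k) - 1)}) \<union>
      (\<Union>j\<in>{1..lower_strips k}. orb k ` {real (ord k) - real j..real (ord k)} \<times>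
          orb k ` {max 0 (apos k - real j)..apos k - real j + 1})
    else arc_cc (V k) (V (k - 1)) \<times> arc_cc (V (k - 1)) (V k))"

text \<open>The strips are the level sets of the ceiling and the floor in
  \<open>elliptic_region\<close>.\<close>

lemma W_strips:
  assumes "ell k"
  shows "W k = (\<Union>i\<in>{1..upper_strips k}. orb k ` {real (ord k) - 1..<real (ord k) - 1 + real i} \<times>
          orb k ` {apos k + real i - 1..<min (apos k + real i) (real (ord k) - 1)}) \<union>
      (\<Union>j\<in>{1..lower_strips k}. orb k ` {real (ord k) - real j..<real (ord k)} \<times>
          orb k ` {max 0 (apos k - real j)..<apos k - real j + 1})"
    (is "_ = ?U \<union> ?L")
proof
  note a = apos(1,2) [OF assms] note sb = strips_bounds [OF assms]
  have Wk: "W k = orb2 k ` region k" using assms by (simp add: W_def)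
  show "W k \<subseteq> ?U \<union> ?L"
    unfolding Wk
  proof (rule image_subsetI)
    fix z assume z: "z \<in> region k"
    obtain x y where xy: "z = (x, y)" by fastforce
    note r = regionD [OF z, unfolded xy fst_conv snd_conv]
    show "orb2 k z \<in> ?U \<union> ?L"
    proof (cases "y < apos k")
      case True
      have x: "real (ord k) - of_int \<lceil>apos k - y\<rceil> \<le> x" using z True by (simp add: xy region_def elliptic_region_def)
      define j where "j = nat \<lceil>apos k - y\<rceil>"
      have "1 \<le> \<lceil>apos k - y\<rceil>" using True by simp
      then have ji: "real j = of_int \<lceil>apos k - y\<rceil>" "1 \<le> j" unfolding j_def by linarith+
      have jb: "real j < apos k - y + 1" "apos k - y \<le> real j" unfolding ji(1) by linarith+
      have x': "real (ord k) - real j \<le> x" using x unfolding ji(1) .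
      have "x \<in> {real (ord k) - real j..<real (ord k)}" "y \<in> {max 0 (apos k - real j)..<apos k - real j + 1}"
        using x' jb r by auto
      then have "orb2 k z \<in> orb k ` {real (ord k) - real j..<real (ord k)} \<times>
          orb k ` {max 0 (apos k - real j)..<apos k - real j + 1}"
        unfolding xy orb2_def map_prod_simp by (intro SigmaI imageI)
      moreover have "j \<le> lower_strips k" unfolding j_def lower_strips_def
        by (intro nat_mono ceiling_mono) (use r in simp)
      then have j: "j \<in> {1..lower_strips k}" using ji(2) by simp
      ultimately show ?thesis by (intro UnI2 UN_I [OF j])
    next
      case False
      have x: "real (ord k) - 1 \<le> x \<or> x < of_int \<lfloor>y - apos k\<rfloor>" using z False by (auto simp: xy region_def elliptic_region_def)
      define i where "i = nat (\<lfloor>y - apos k\<rfloor> + 1)"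
      have "0 \<le> \<lfloor>y - apos k\<rfloor>" using False by simp
      then have ii: "real i = of_int \<lfloor>y - apos k\<rfloor> + 1" "1 \<le> i" unfolding i_def by linarith+
      have b: "real i - 1 \<le> y - apos k" "y - apos k < real i" unfolding ii(1) by linarith+
      have "real i - 1 < real (upper_strips k)" using b r sb(3) by linarith
      then have "i \<le> upper_strips k" by linarith
      then have i: "i \<in> {1..upper_strips k}" using ii(2) by simp
      \<comment> \<open>A full turn is added to the small positions, so that the two ranges of
        \<open>x\<close> join into one arc beginning at \<open>V (k + 1)\<close>.\<close>
      obtain x' where x': "orb k x' = orb k x" "x' \<in> {real (ord k) - 1..<real (ord k) - 1 + real i}"
      proof (cases "real (ord k) - 1 \<le> x")
        case True
        show ?thesis by (rule that [of x]) (use True r ii in auto)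
      next
        case False
        show ?thesis by (rule that [of "x + real (ord k)"]) (use orb_period [OF assms] False x r ii in auto)
      qed
      have "y \<in> {apos k + real i - 1..<min (apos k + real i) (real (ord k) - 1)}" using b r by auto
      then have "orb2 k z \<in> orb k ` {real (ord k) - 1..<real (ord k) - 1 + real i} \<times>
          orb k ` {apos k + real i - 1..<min (apos k + real i) (real (ord k) - 1)}"
        unfolding xy orb2_def map_prod_simp x'(1) [symmetric] by (intro SigmaI imageI x'(2))
      then show ?thesis by (intro UnI1 UN_I [OF i])
    qed
  qed
  have reg: "(orb k x, orb k y) \<in> W k" if "(x, y) \<in> region k" for x y
    using that unfolding Wk by (intro image_eqI [of _ _ "(x, y)"]) (simp_all add: orb2_def)
  have U: "(orb k x, orb k y) \<in> W k"
    if h: "i \<in> {1..upper_strips k}" "x \<in> {real (ord k) - 1..<real (ord k) - 1 + real i}"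
      "y \<in> {apos k + real i - 1..<min (apos k + real i) (real (ord k) - 1)}" for i x y
  proof -
    have y: "apos k + real i - 1 \<le> y" "y < apos k + real i" "y < real (ord k) - 1" and i1: "1 \<le> real i"
      using h by auto
    have "\<lfloor>y - apos k\<rfloor> = int i - 1" using y by linarith
    then have fl: "real_of_int \<lfloor>y - apos k\<rfloor> = real i - 1" by simp
    show ?thesis
    proof (cases "x < real (ord k)")
      case True
      then have "(x, y) \<in> region k"
        using h(2) y i1 a ell_orb(4) [OF assms] unfolding region_def elliptic_region_def by auto
      then show ?thesis by (rule reg)
    next
      case False
      have "0 \<le> x - real (ord k)" "x - real (ord k) < real i - 1" "0 \<le> y" "\<not> y < apos k" "x - real (ord k) < real (ord k)"
        using False h(2) y i1 a by auto
      then have "(x - real (ord k), y) \<in> region k"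
        using y unfolding region_def elliptic_region_def by (simp add: fl)
      then show ?thesis using reg orb_period [OF assms, of "x - real (ord k)"] by fastforce
    qed
  qed
  have L: "(orb k x, orb k y) \<in> W k"
    if h: "j \<in> {1..lower_strips k}" "x \<in> {real (ord k) - real j..<real (ord k)}"
      "y \<in> {max 0 (apos k - real j)..<apos k - real j + 1}" for j x y
  proof -
    have y: "0 \<le> y" "apos k - real j \<le> y" "y < apos k - real j + 1" and j: "1 \<le> real j" "real j \<le> real (lower_strips k)"
      using h by auto
    have "\<lceil>apos k - y\<rceil> = int j" using y by linarith
    then have fl: "real_of_int \<lceil>apos k - y\<rceil> = real j" by simp
    have hx: "real (ord k) - real j \<le> x" "x < real (ord k)" using h(2) by auto
    have "0 \<le> x" "y < real (ord k) - 1" "y < apos k"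
      using hx y j a sb(5) by linarith+
    then have "(x, y) \<in> region k" using y hx unfolding region_def elliptic_region_def by (simp add: fl)
    then show ?thesis by (rule reg)
  qed
  show "?U \<union> ?L \<subseteq> W k"
  proof (rule Un_least; rule UN_least; rule subsetI)
    fix i z
    assume i: "i \<in> {1..upper_strips k}" and "z \<in> orb k ` {real (ord k) - 1..<real (ord k) - 1 + real i} \<times>
          orb k ` {apos k + real i - 1..<min (apos k + real i) (real (ord k) - 1)}"
    then show "z \<in> W k" using U [OF i] by (elim SigmaE imageE) simp
  next
    fix j z
    assume j: "j \<in> {1..lower_strips k}" and "z \<in> orb k ` {real (ord k) - real j..<real (ord k)} \<times>
          orb k ` {max 0 (apos k - real j)..<apos k - real j + 1}"
    then show "z \<in> W k" using L [OF j] by (elim SigmaE imageE) simp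
  qed
qed

lemma closure_orb:
  assumes "ell k" "s < e" "e < s + real (ord k)"
  shows "closure (orb k ` {s..<e}) = orb k ` {s..e}" "orb k ` {s..e} \<subseteq> insert (orb k e) (orb k ` {s..<e})"
proof -
  have ne: "orb k s \<noteq> orb k e" using orb_eq_iff [OF assms(1), of s e] assms by auto
  show "closure (orb k ` {s..<e}) = orb k ` {s..e}"
    using closure_arc_co [OF orb_sphere [OF assms(1)] orb_sphere [OF assms(1)] ne]
      orb_arc_co [OF assms(1), of s e] orb_arc_cc [OF assms(1), of s e] assms by simp
  have "{s..e} = insert e {s..<e}" using assms by auto
  then show "orb k ` {s..e} \<subseteq> insert (orb k e) (orb k ` {s..<e})" by simp
qed

lemma null_closure_W:
  assumes k: "k \<in> pieces"
  shows "null_closure (W k) (closed_W k)"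
proof (cases "ell k")
  case False
  then have t: "top k = k" by (simp add: top_def)
  note e = S_ends(1-3) [OF k, unfolded t]
  have "W k = arc_co (V k) (V (k - 1)) \<times> arc_co (V (k - 1)) (V k)"
    using False sphere_minus_arc_co [OF e] by (simp add: W_def S_def t)
  moreover have "closed_W k = arc_cc (V k) (V (k - 1)) \<times> arc_cc (V (k - 1)) (V k)"
    using False by (simp add: closed_W_def)
  moreover have "null_closure (arc_co (V k) (V (k - 1)) \<times> arc_co (V (k - 1)) (V k)) (arc_cc (V k) (V (k - 1)) \<times> arc_cc (V (k - 1)) (V k))"
    using arc_cc_eq_insert [OF e(2,1)] arc_cc_eq_insert [OF e(1,2)]
    by (intro null_closure_Times closure_arc_co e e(3) [symmetric]) auto
  ultimately show ?thesis by simp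
next
  case True
  note a = apos(1,2) [OF True] note sb = strips_bounds [OF True]
  have c: "closed_W k = (\<Union>i\<in>{1..upper_strips k}. orb k ` {real (ord k) - 1..real (ord k) - 1 + real i} \<times>
          orb k ` {apos k + real i - 1..min (apos k + real i) (real (ord k) - 1)}) \<union>
      (\<Union>j\<in>{1..lower_strips k}. orb k ` {real (ord k) - real j..real (ord k)} \<times>
          orb k ` {max 0 (apos k - real j)..apos k - real j + 1})"
    using True by (simp add: closed_W_def)
  show ?thesis
    unfolding c W_strips [OF True]
  proof (intro null_closure_Un null_closure_UN finite_atLeastAtMost)
    fix i assume i: "i \<in> {1..upper_strips k}"
    then have b: "1 \<le> real i" "real i < real (ord k) - apos k" using sb(2) by auto
    show "null_closure (orb k ` {real (ord k) - 1..<real (ord k) - 1 + real i} \<times>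
          orb k ` {apos k + real i - 1..<min (apos k + real i) (real (ord k) - 1)})
       (orb k ` {real (ord k) - 1..real (ord k) - 1 + real i} \<times>
          orb k ` {apos k + real i - 1..min (apos k + real i) (real (ord k) - 1)})"
      by (rule null_closure_Times; rule closure_orb [OF True]) (use b a in auto)
  next
    fix j assume j: "j \<in> {1..lower_strips k}"
    then have b: "1 \<le> real j" "real j < apos k + 1" using sb(5) by auto
    show "null_closure (orb k ` {real (ord k) - real j..<real (ord k)} \<times>
          orb k ` {max 0 (apos k - real j)..<apos k - real j + 1})
       (orb k ` {real (ord k) - real j..real (ord k)} \<times>
          orb k ` {max 0 (apos k - real j)..apos k - real j + 1})"
      by (rule null_closure_Times; rule closure_orb [OF True]) (use b a in auto)
  qed
qed

lemma finite_pieces: "finite pieces"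
  by (simp add: pieces_def)

lemma null_closure_half_open_domain: "null_closure half_open_domain (\<Union>k\<in>pieces. closed_W k)"
  unfolding half_open_domain_def by (intro null_closure_UN finite_pieces null_closure_W)

end

section \<open>Identification of the closed domain with the set of strips\<close>

context partitioned_polygon begin

lemma v_pow_mult: "v_pow l x * v_pow l y = v_pow l (x + y)"
  by (simp add: v_pow_def cis_mult add_divide_distrib distrib_right)

lemma v_pow_sphere: "v_pow l x \<in> sphere 0 1"
  by (simp add: v_pow_def)

text \<open>\<open>v\<close> turns by half a sector while \<open>sector_arg\<close> counts whole
  ones, whence the factor 2.\<close>

lemma V_v_pow: "k \<le> N \<Longrightarrow> \<not> ell k \<Longrightarrow> 2 * sector_arg k = x \<Longrightarrow> v_pow l x = V k"
  unfolding v_pow_def V_ideal \<theta>_def by (intro arg_cong [where f = cis]) auto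

lemma rotate_Times:
  assumes "\<rho> \<in> sphere 0 1"
  shows "(\<lambda>(u, w). (\<rho> * u, \<rho> * w)) ` (arc_cc x y \<times> arc_cc z z') = arc_cc (\<rho> * x) (\<rho> * y) \<times> arc_cc (\<rho> * z) (\<rho> * z')"
  using map_prod_image_Times [of "(*) \<rho>" "(*) \<rho>" "arc_cc x y" "arc_cc z z'"] rotate_arc [OF assms]
  by (simp add: map_prod_def)

definition rotate :: "complex \<Rightarrow> complex \<times> complex \<Rightarrow> complex \<times> complex" where
  "rotate \<rho> = (\<lambda>(u, w). (\<rho> * u, \<rho> * w))"

lemma sector_square:
  assumes "n \<in> {1..g}"
  shows "rotate (v_pow l (2 * (real n - 1))) ` Omega_sector g ms t \<gamma> A n = (\<Union>k\<in>{4 * n - 3, 4 * n - 2, 4 * n - 1, 4 * n}. closed_W k)"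
proof -
  let ?r = "v_pow l (2 * (real n - 1))"
  define q where "q = n - 1"
  have n: "n = q + 1" "n \<le> g" using assms by (auto simp: q_def)
  have N: "4 * q + 4 \<le> N" "4 * q + 4 \<le> 4 * g" using n N_eq(1) by auto
  have ne: "\<not> ell j" if "j \<le> 4 * q + 4" for j using ellD(5) [of j] that N by auto
  have v: "?r * v_pow l (real i / 2) = V (4 * q + i)" if "i \<le> 4" for i
    unfolding v_pow_mult by (rule V_v_pow) (use that N ne n in \<open>auto simp: sector_arg_def field_simps\<close>)
  have vs: "?r * v_pow l (1 / 2) = V (4 * q + 1)" "?r * v_pow l 1 = V (4 * q + 2)" "?r * v_pow l (3 / 2) = V (4 * q + 3)"
    "?r * v_pow l 2 = V (4 * q + 4)" "?r * 1 = V (4 * q)"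
    using v [of 1] v [of 2] v [of 3] v [of 4] v [of 0] by (simp_all add: v_pow_def)
  have s: "{4 * n - 3, 4 * n - 2, 4 * n - 1, 4 * n} = {4 * q + 1, 4 * q + 2, 4 * q + 3, 4 * q + 4}" using n by auto
  have W: "closed_W (4 * q + 1) = arc_cc (V (4 * q + 1)) (V (4 * q)) \<times> arc_cc (V (4 * q)) (V (4 * q + 1))"
    "closed_W (4 * q + 2) = arc_cc (V (4 * q + 2)) (V (4 * q + 1)) \<times> arc_cc (V (4 * q + 1)) (V (4 * q + 2))"
    "closed_W (4 * q + 3) = arc_cc (V (4 * q + 3)) (V (4 * q + 2)) \<times> arc_cc (V (4 * q + 2)) (V (4 * q + 3))"
    "closed_W (4 * q + 4) = arc_cc (V (4 * q + 4)) (V (4 * q + 3)) \<times> arc_cc (V (4 * q + 3)) (V (4 * q + 4))"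
    using ne unfolding closed_W_def by (simp_all add: eval_nat_numeral)
  have "Omega_sector g ms t \<gamma> A n = Omega_square l" using n by (simp add: Omega_sector_def Let_def)
  then show ?thesis
    unfolding s rotate_def Omega_square_def Let_def
    by (simp only: image_Un rotate_Times [OF v_pow_sphere] vs W UN_insert UN_empty Un_empty_right Un_assoc)
qed

lemma sector_cusp:
  assumes "n \<in> {g + length ms + 1..l}"
  shows "rotate (v_pow l (2 * (real n - 1))) ` Omega_sector g ms t \<gamma> A n =
    (\<Union>k\<in>{4 * g + 2 * (n - g) - 1, 4 * g + 2 * (n - g)}. closed_W k)"
proof -
  let ?r = "v_pow l (2 * (real n - 1))"
  define c where "c = 4 * g + 2 * (n - g - 1)"
  have n: "g + length ms + 1 \<le> n" "n \<le> l" using assms by auto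
  have c: "4 * g + 2 * (n - g) - 1 = c + 1" "4 * g + 2 * (n - g) = c + 2" using n by (auto simp: c_def)
  have N: "c + 2 \<le> N" using N_eq(1) n by (auto simp: c_def)
  have ne: "\<not> ell c" "\<not> ell (c + 1)" "\<not> ell (c + 2)"
    using n unfolding ell_iff by (auto simp: c_def)
  have sa: "2 * sector_arg c = 2 * (real n - 1)" "2 * sector_arg (c + 1) = 2 * (real n - 1) + 1" "2 * sector_arg (c + 2) = 2 * (real n - 1) + 2"
    using n by (auto simp: sector_arg_def c_def of_nat_diff field_simps)
  have v: "?r * 1 = V c" "?r * v_pow l 1 = V (c + 1)" "?r * v_pow l 2 = V (c + 2)"
    unfolding v_pow_mult mult_1_right using N ne sa by (auto intro!: V_v_pow)
  have W: "closed_W (c + 1) = arc_cc (V (c + 1)) (V c) \<times> arc_cc (V c) (V (c + 1))"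
    "closed_W (c + 2) = arc_cc (V (c + 2)) (V (c + 1)) \<times> arc_cc (V (c + 1)) (V (c + 2))"
    using ne unfolding closed_W_def by (simp_all add: eval_nat_numeral)
  have "Omega_sector g ms t \<gamma> A n = Omega_cusp l" using n by (simp add: Omega_sector_def Let_def)
  moreover have "c + 2 - 1 = c + 1" by simp
  ultimately show ?thesis
    unfolding c rotate_def Omega_cusp_def
    by (simp only: image_Un rotate_Times [OF v_pow_sphere] v W UN_insert UN_empty Un_empty_right)
qed

lemma orb_period_int: "ell k \<Longrightarrow> orb k (x + real (ord k) * of_int j) = orb k x"
proof -
  assume k: "ell k"
  then have "real (ord k) \<noteq> 0" using ell_orb(4) [OF k] by auto
  then have "2 * pi * (x + real (ord k) * of_int j) / real (ord k) = 2 * pi * x / real (ord k) + 2 * pi * of_int j"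
    by (simp add: field_simps)
  then have "cis (2 * pi * (x + real (ord k) * of_int j) / real (ord k)) = cis (2 * pi * x / real (ord k)) * cis (2 * pi * of_int j)"
    by (simp only: cis_mult)
  also have "cis (2 * pi * of_int j) = 1" by (rule cis_multiple_2pi) simp
  finally show ?thesis by (simp add: orb_def rotation_orbit_def)
qed

text \<open>In positions around the vertex \<open>c\<close> is the shift by -1 and all its integer
  iterates are translations. The strips of \<Omega> thereby become arithmetic, and the only real
  task is to recognize \<open>I\<close> and \<open>J\<close>.\<close>

lemma sector_elliptic:
  assumes "n \<in> {g + 1..g + length ms}" and k: "k = 4 * g + 2 * (n - g) - 1"
  shows "rotate (v_pow l (2 * (real n - 1))) ` Omega_sector g ms t \<gamma> A n = closed_W k"
proof -
  define \<rho> where "\<rho> = v_pow l (2 * (real n - 1))"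
  define m where "m = ord k"
  define a where "a = apos k"
  define I J where "I = upper_strips k" and "J = lower_strips k"
  have n: "g + 1 \<le> n" "n \<le> g + length ms" using assms by auto
  have kk: "k = 4 * g + 2 * (n - g - 1) + 1" "n - g - 1 < length ms" using n k by auto
  then have ell: "ell k" unfolding ell_iff by blast
  have mm: "ms ! (n - g - 1) = m" unfolding m_def ord_def kk(1) by simp
  note e = ell_orb [OF ell, folded m_def] note ap = apos [OF ell, folded m_def a_def]
  note sb = strips_bounds [OF ell, folded m_def a_def I_def J_def]
  have r: "\<rho> \<in> sphere 0 1" unfolding \<rho>_def by (rule v_pow_sphere)
  then have r0: "\<rho> \<noteq> 0" by auto
  have sa: "2 * sector_arg (k - 1) = 2 * (real n - 1)" "2 * sector_arg (k + 1) = 2 * (real n - 1) + 2"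
    using n unfolding kk(1) by (auto simp: sector_arg_def of_nat_diff field_simps)
  have r1: "\<rho> * 1 = orb k 0"
    unfolding orb_0 [OF ell] \<rho>_def mult_1_right by (rule V_v_pow) (use ellD [OF ell] sa in auto)
  have r2: "\<rho> * v_pow l 2 = orb k (real m - 1)"
    unfolding m_def orb_top [OF ell] \<rho>_def v_pow_mult by (rule V_v_pow) (use ellD [OF ell] sa in auto)
  define c where "c z = \<gamma> k (\<rho> * z) / \<rho>" for z
  define b where "b = A k / \<rho>"
  have ra: "\<rho> * b = orb k a" using r0 ap(3) by (simp add: b_def)
  have pt: "z = orb k x / \<rho>" if "\<rho> * z = orb k x" for z x using that r0 by (simp add: field_simps)
  have S: "orb k x / \<rho> \<in> sphere 0 1" for x using orb_sphere [OF ell, of x] r by (simp add: norm_divide)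
  have c: "c (orb k x / \<rho>) = orb k (x - 1) / \<rho>" for x
    using r0 \<gamma>_orb(1) [OF ell] by (simp add: c_def)
  have cinj: "inj_on c (sphere 0 1)"
  proof (rule inj_onI)
    fix z w assume zw: "z \<in> sphere 0 1" "w \<in> sphere 0 1" "c z = c w"
    then have "\<gamma> k (\<rho> * z) = \<gamma> k (\<rho> * w)" using r0 by (simp add: c_def)
    moreover have "\<rho> * z \<in> sphere 0 1" "\<rho> * w \<in> sphere 0 1" using zw r by (simp_all add: norm_mult)
    ultimately show "z = w" using disk_isometry_eq_iff [OF isometry [OF ellD(3) [OF ell]]] r0 by simp
  qed
  have ci: "inv_into (sphere 0 1) c (orb k x / \<rho>) = orb k (x + 1) / \<rho>" for x
    by (rule inv_into_f_eq [OF cinj S]) (simp add: c)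
  have cn: "(c ^^ i) (orb k x / \<rho>) = orb k (x - real i) / \<rho>" for i x
    by (induction i) (simp_all add: c algebra_simps)
  have cni: "(inv_into (sphere 0 1) c ^^ i) (orb k x / \<rho>) = orb k (x + real i) / \<rho>" for i x
    by (induction i) (simp_all add: ci algebra_simps)
  have it0: "int_iterate c j (orb k x / \<rho>) = orb k (x - of_int j) / \<rho>" for j x
    unfolding int_iterate_def by (auto simp: cn cni)
  have it: "\<rho> * int_iterate c j z = orb k (x - of_int j)" if "\<rho> * z = orb k x" for j z x
    using it0 [of j x] pt [OF that] r0 by simp
  have om: "Omega_sector g ms t \<gamma> A n = (if m = 2 then Omega_two l else Omega_elliptic l m c b)"
    unfolding Omega_sector_def Let_def
    using n mm k by (simp add: \<rho>_def c_def [abs_def] b_def)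
  have arc: "arc_cc (orb k x) (orb k y) = orb k ` {x..y}" if "x \<le> y" "y < x + real m" for x y
    using orb_arc_cc [OF ell, of x y] that by (simp add: m_def)
  have cl: "closed_W k = (\<Union>i\<in>{1..I}. orb k ` {real m - 1..real m - 1 + real i} \<times>
          orb k ` {a + real i - 1..min (a + real i) (real m - 1)}) \<union>
      (\<Union>j\<in>{1..J}. orb k ` {real m - real j..real m} \<times> orb k ` {max 0 (a - real j)..a - real j + 1})"
    using ell by (simp add: closed_W_def m_def a_def I_def J_def)
  show ?thesis
  proof (cases "m = 2")
    case True
    have "real I < 2" "real J < 2" using sb ap True by linarith+
    \<comment> \<open>One strip on each side, both with the same first factor; they join at the
      partition point to a single product.\<close>
    then have IJ: "I = 1" "J = 1" using sb(1,4) by linarith+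
    have "closed_W k = orb k ` {1..2} \<times> (orb k ` {a..1} \<union> orb k ` {0..a})"
      using ap True unfolding cl IJ by (auto simp: min_def max_def)
    also have "orb k ` {a..1} \<union> orb k ` {0..a} = orb k ` {0..1}"
      unfolding image_Un [symmetric] using ap True by (intro arg_cong [where f = "image (orb k)"]) auto
    also have "orb k ` {1..2} = arc_cc (orb k 1) (orb k (0 + real m))"
      using arc [of 1 2] True by simp
    also have "orb k ` {0..1} = arc_cc (orb k 0) (orb k 1)"
      using arc [of 0 1] True by simp
    finally have "closed_W k = arc_cc (orb k (real m - 1)) (orb k 0) \<times> arc_cc (orb k 0) (orb k (real m - 1))"
      using orb_period [OF ell, of 0, folded m_def] True by simp
    moreover have "Omega_sector g ms t \<gamma> A n = Omega_two l" using om True by simp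
    ultimately show ?thesis
      unfolding \<rho>_def [symmetric] by (simp only: rotate_def Omega_two_def rotate_Times [OF r] r1 r2)
  next
    case False
    have b: "b = orb k a / \<rho>" by (rule pt [OF ra])
    have one_iff: "orb k x / \<rho> = 1 \<longleftrightarrow> x = 0" if "0 \<le> x" "x < real m" for x
    proof -
      have "orb k x / \<rho> = 1 \<longleftrightarrow> orb k x = orb k 0" using r1 r0 by (simp add: divide_eq_eq)
      then show ?thesis using orb_inj [OF ell, of x 0] that e(4) by (auto simp: m_def)
    qed
    have arc_oo: "orb k x / \<rho> \<in> arc_oo 1 (v_pow l 2) \<longleftrightarrow> 0 < x \<and> x < real m - 1" if x: "0 \<le> x" "x < real m" for x
    proof -
      have "S k = arc_co \<rho> (\<rho> * v_pow l 2)"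
        using ell r1 r2 orb_0 [OF ell] orb_top [OF ell] by (simp add: S_def top_def m_def)
      then have "orb k x \<in> S k \<longleftrightarrow> Arg2pi (orb k x / \<rho>) < Arg2pi (v_pow l 2)"
        using orb_sphere [OF ell, of x] r0 by (simp add: arc_co_def)
      then have 1: "Arg2pi (orb k x / \<rho>) < Arg2pi (v_pow l 2) \<longleftrightarrow> x < real m - 1"
        using orb_mem_S [OF ell, of x] x by (simp add: m_def)
      have "orb k x / \<rho> = 1" if "Arg2pi (orb k x / \<rho>) = 0"
        using sphere_eq_cis [OF S [of x]] unfolding that by simp
      moreover have "Arg2pi 1 = 0" by (simp add: Arg2pi_eq_0)
      ultimately have "Arg2pi (orb k x / \<rho>) = 0 \<longleftrightarrow> x = 0" using one_iff [OF x] by auto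
      then have "0 < Arg2pi (orb k x / \<rho>) \<longleftrightarrow> 0 < x"
        using Arg2pi_ge_0 [of "orb k x / \<rho>"] x(1) by (auto simp: less_le)
      then show ?thesis using 1 S [of x] unfolding arc_oo_def by simp
    qed
    have cb: "(c ^^ (i + 1)) b = orb k (a - (real i + 1)) / \<rho>" for i
      unfolding b cn by (simp add: add.commute)
    have J1: "1 \<le> J" "1 \<le> I" using sb by auto
    have IJ: "elliptic_IJ l m c b = (I - 1, J - 1)"
    proof (cases "\<exists>j. int_iterate c j b = 1")
      case True
      then obtain j where "int_iterate c j b = 1" by blast
      then have j: "orb k (a - of_int j) / \<rho> = 1" unfolding b it0 .
      \<comment> \<open>Full turns are removed to bring the position into one period, where only 0
        represents the point 1. Hence the special case means that \<open>a\<close> is an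
        integer.\<close>
      define h where "h = \<lfloor>(a - of_int j) / real m\<rfloor>"
      define y where "y = a - of_int j - real m * of_int h"
      have m0: "0 < real m" using e(4) by simp
      have "of_int h \<le> (a - of_int j) / real m" "(a - of_int j) / real m < of_int h + 1" unfolding h_def by linarith+
      then have y: "0 \<le> y" "y < real m" using m0 by (simp_all add: y_def field_simps)
      have "orb k (y + real m * of_int h) / \<rho> = 1" using j by (simp add: y_def)
      then have "orb k y / \<rho> = 1" unfolding m_def orb_period_int [OF ell] .
      then have "y = 0" using one_iff [OF y] by blast
      then have "a = of_int (j + int m * h)" by (simp add: y_def)
      then obtain z :: int where z: "a = of_int z" by blast
      have "real_of_int (int J) < real_of_int (z + 1)" "real_of_int z \<le> real_of_int (int J)"
        using sb(5,6) unfolding z by simp_all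
      then have "z = int J" unfolding of_int_less_iff of_int_le_iff by simp
      then have aJ: "a = real J" using z by simp
      have least: "(LEAST j. (c ^^ (j + 1)) b = 1) = J - 1"
      proof (rule Least_equality)
        show "(c ^^ (J - 1 + 1)) b = 1" unfolding cb using one_iff [of 0] e(4) aJ J1 by (simp add: of_nat_diff)
        fix y assume y: "(c ^^ (y + 1)) b = 1"
        show "J - 1 \<le> y"
        proof (rule ccontr)
          assume "\<not> J - 1 \<le> y"
          then have "0 < a - (real y + 1)" "a - (real y + 1) < real m" using aJ ap by linarith+
          then show False using y one_iff [of "a - (real y + 1)"] unfolding cb by simp
        qed
      qed
      \<comment> \<open>For integral \<open>a\<close> the strip counts satisfy
        \<open>m = I + J + 1\<close>, otherwise \<open>m = I + J\<close>. This is why the special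
        case of \<open>elliptic_IJ\<close> subtracts one more.\<close>
      have "real (I + J) < real m" "real m \<le> real (I + J + 1)" using sb(2,3) aJ by simp_all
      then have "I + J < m" "m \<le> I + J + 1" by (simp_all only: of_nat_less_iff of_nat_le_iff)
      then have "m = I + J + 1" by simp
      then show ?thesis
        unfolding elliptic_IJ_def Let_def least using True J1 by simp
    next
      case F: False
      have "a \<noteq> real J"
      proof
        assume "a = real J"
        then have "int_iterate c (int J) b = 1" unfolding b it0 using one_iff [of 0] e(4) by simp
        then show False using F by blast
      qed
      then have aJ: "a < real J" using sb(6) by simp
      have least: "(LEAST j. (c ^^ (j + 1)) b \<notin> arc_oo 1 (v_pow l 2)) = J - 1"
      proof (rule Least_equality)
        have "orb k (a - (real (J - 1) + 1)) = orb k (a - real J + real m)"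
          using orb_period [OF ell, of "a - real J", folded m_def] J1 by (simp add: of_nat_diff)
        then show "(c ^^ (J - 1 + 1)) b \<notin> arc_oo 1 (v_pow l 2)"
          unfolding cb using arc_oo [of "a - real J + real m"] aJ sb(5) e(4) by simp
        fix y assume y: "(c ^^ (y + 1)) b \<notin> arc_oo 1 (v_pow l 2)"
        show "J - 1 \<le> y"
        proof (rule ccontr)
          assume "\<not> J - 1 \<le> y"
          then have "real y + 2 \<le> real J" by linarith
          then have "0 < a - (real y + 1)" "a - (real y + 1) < real m - 1" using sb(5) ap by linarith+
          then show False using y arc_oo [of "a - (real y + 1)"] unfolding cb by simp
        qed
      qed
      have "real (I + J) < real (m + 1)" "real m < real (I + J + 1)" using sb(2,3,5) aJ by simp_all
      then have "I + J < m + 1" "m < I + J + 1" by (simp_all only: of_nat_less_iff)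
      then have "m = I + J" by simp
      then show ?thesis
        unfolding elliptic_IJ_def Let_def least using F J1 by simp
    qed
    have U: "rotate \<rho> ` U_strip l c b (I - 1) i = orb k ` {real m - 1..real m - 1 + real i} \<times>
          orb k ` {a + real i - 1..min (a + real i) (real m - 1)}" if i: "i \<in> {1..I}" for i
    proof -
      have i1: "1 \<le> real i" "real i < real m - a" using i sb(2) by auto
      have 1: "\<rho> * int_iterate c (1 - int i) 1 = orb k (real m - 1 + real i)"
        using it [OF r1, of "1 - int i"] orb_period [OF ell, of "real i - 1", folded m_def] by (simp add: algebra_simps)
      have 2: "\<rho> * int_iterate c (1 - int i) b = orb k (a + real i - 1)"
        using it [OF ra, of "1 - int i"] by (simp add: algebra_simps)
      have 3: "\<rho> * (if i \<le> I - 1 then int_iterate c (- int i) b else v_pow l 2) = orb k (min (a + real i) (real m - 1))"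
      proof (cases "i \<le> I - 1")
        case True
        then have "real i + 1 \<le> real I" using i by auto
        moreover have "real I < real m - a" using sb(2) .
        ultimately show ?thesis using it [OF ra, of "- int i"] True by simp
      next
        case F: False
        then have "i = I" using i by auto
        then have "real m - 1 \<le> a + real i" using sb(3) by simp
        then show ?thesis using F r2 by (simp only: min_absorb2 if_False)
      qed
      have "rotate \<rho> ` U_strip l c b (I - 1) i =
         arc_cc (orb k (real m - 1)) (orb k (real m - 1 + real i)) \<times> arc_cc (orb k (a + real i - 1)) (orb k (min (a + real i) (real m - 1)))"
        unfolding rotate_def U_strip_def rotate_Times [OF r] 1 2 3 r2 ..
      also have "\<dots> = orb k ` {real m - 1..real m - 1 + real i} \<times> orb k ` {a + real i - 1..min (a + real i) (real m - 1)}"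
        using i1 ap e(4) by (subst (1 2) arc) (auto simp: min_def)
      finally show ?thesis .
    qed
    have L: "rotate \<rho> ` L_strip l c b (J - 1) j = orb k ` {real m - real j..real m} \<times> orb k ` {max 0 (a - real j)..a - real j + 1}"
      if j: "j \<in> {1..J}" for j
    proof -
      have j1: "1 \<le> real j" "real j < a + 1" using j sb(5) by auto
      have 1: "\<rho> * int_iterate c (int j - 1) (v_pow l 2) = orb k (real m - real j)"
        using it [OF r2, of "int j - 1"] by (simp add: algebra_simps)
      have 2: "\<rho> * int_iterate c (int j - 1) b = orb k (a - real j + 1)"
        using it [OF ra, of "int j - 1"] by (simp add: algebra_simps)
      have 3: "\<rho> * (if j \<le> J - 1 then int_iterate c (int j) b else 1) = orb k (max 0 (a - real j))"
      proof (cases "j \<le> J - 1")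
        case True
        then have "real j + 1 \<le> real J" using j by auto
        moreover have "real J < a + 1" using sb(5) .
        ultimately show ?thesis using it [OF ra, of "int j"] True by simp
      next
        case F: False
        then have "j = J" using j by auto
        then have "a - real j \<le> 0" using sb(6) by simp
        then show ?thesis using F r1 by (simp only: max_absorb1 if_False)
      qed
      have 4: "\<rho> * 1 = orb k (real m)" using r1 orb_period [OF ell, of 0, folded m_def] by simp
      have "rotate \<rho> ` L_strip l c b (J - 1) j =
         arc_cc (orb k (real m - real j)) (orb k (real m)) \<times> arc_cc (orb k (max 0 (a - real j))) (orb k (a - real j + 1))"
        unfolding rotate_def L_strip_def rotate_Times [OF r] 1 2 3 4 ..
      also have "\<dots> = orb k ` {real m - real j..real m} \<times> orb k ` {max 0 (a - real j)..a - real j + 1}"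
        using j1 ap e(4) by (subst (1 2) arc) (auto simp: max_def)
      finally show ?thesis .
    qed
    have "I - 1 + 1 = I" "J - 1 + 1 = J" using sb(1,4) by auto
    then have "rotate \<rho> ` Omega_elliptic l m c b = closed_W k"
      unfolding Omega_elliptic_def IJ prod.case image_Un image_UN cl using U L by simp
    then show ?thesis unfolding om \<rho>_def using False by simp
  qed
qed

text \<open>A quadruple contributes four pieces, a cusp pair two, and an elliptic pair a single one,
  as its second side is not a piece.\<close>

lemma Omega_eq: "Omega g ms t \<gamma> A = (\<Union>k\<in>pieces. closed_W k)"
proof -
  have "Omega g ms t \<gamma> A = (\<Union>n\<in>{1..l}. rotate (v_pow l (2 * (real n - 1))) ` Omega_sector g ms t \<gamma> A n)"
    by (simp add: Omega_def rotate_def)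
  also have "\<dots> = (\<Union>n\<in>{1..l}. \<Union>k\<in>{k \<in> pieces. if n \<le> g then 4 * n - 3 \<le> k \<and> k \<le> 4 * n
      else 4 * g + 2 * (n - g) - 1 \<le> k \<and> k \<le> 4 * g + 2 * (n - g)}. closed_W k)"
  proof (rule SUP_cong [OF refl])
    fix n assume n: "n \<in> {1..l}"
    let ?K = "{k \<in> pieces. if n \<le> g then 4 * n - 3 \<le> k \<and> k \<le> 4 * n
      else 4 * g + 2 * (n - g) - 1 \<le> k \<and> k \<le> 4 * g + 2 * (n - g)}"
    consider "n \<in> {1..g}" | "n \<in> {g + 1..g + length ms}" | "n \<in> {g + length ms + 1..l}" using n by force
    then show "rotate (v_pow l (2 * (real n - 1))) ` Omega_sector g ms t \<gamma> A n = (\<Union>k\<in>?K. closed_W k)"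
    proof cases
      case 1
      have "k \<in> pieces" if "4 * n - 3 \<le> k" "k \<le> 4 * n" for k
        using that 1 N_eq(1) ellD(5) [of "k - 1"] by (auto simp: pieces_def)
      then have "?K = {4 * n - 3, 4 * n - 2, 4 * n - 1, 4 * n}" using 1 by auto
      then show ?thesis using sector_square [OF 1] by simp
    next
      case 2
      define k where "k = 4 * g + 2 * (n - g) - 1"
      have "k = 4 * g + 2 * (n - g - 1) + 1" "n - g - 1 < length ms" using 2 by (auto simp: k_def)
      then have k: "ell k" unfolding ell_iff by blast
      have "4 * g + 2 * (n - g) = k + 1" using 2 by (auto simp: k_def)
      moreover have "k + 1 \<notin> pieces" using k by (simp add: pieces_def)
      moreover have "\<not> n \<le> g" using 2 by simp
      ultimately have "?K = {k}" using ell_piece [OF k] unfolding k_def [symmetric] by (auto simp: le_Suc_eq)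
      then show ?thesis using sector_elliptic [OF 2 k_def] by simp
    next
      case 3
      define c where "c = 4 * g + 2 * (n - g) - 1"
      have c: "4 * g + 2 * (n - g) = c + 1" "c + 1 \<le> N" "4 * g + 2 * length ms + 1 \<le> c" "odd c"
        using 3 N_eq(1) by (auto simp: c_def)
      have "\<not> ell (c - 1)" "\<not> ell c" using c(3) unfolding ell_iff by auto
      then have "c \<in> pieces" "c + 1 \<in> pieces" using c by (auto simp: pieces_def)
      moreover have "\<not> n \<le> g" using 3 by simp
      ultimately have "?K = {c, c + 1}" using c(1) unfolding c_def [symmetric] by (auto simp: le_Suc_eq)
      then show ?thesis using sector_cusp [OF 3] c(1) by (simp add: c_def [symmetric])
    qed
  qed
  also have "\<dots> = (\<Union>k\<in>pieces. closed_W k)"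
  proof
    show "(\<Union>k\<in>pieces. closed_W k) \<subseteq> (\<Union>n\<in>{1..l}. \<Union>k\<in>{k \<in> pieces. if n \<le> g then 4 * n - 3 \<le> k \<and> k \<le> 4 * n
      else 4 * g + 2 * (n - g) - 1 \<le> k \<and> k \<le> 4 * g + 2 * (n - g)}. closed_W k)"
    proof (rule UN_least)
      fix k assume k: "k \<in> pieces"
      note p = piece(2,3) [OF k]
      define n where "n = (if k \<le> 4 * g then (k + 3) div 4 else g + (k + 1 - 4 * g) div 2)"
      have "n \<in> {1..l} \<and> (if n \<le> g then 4 * n - 3 \<le> k \<and> k \<le> 4 * n
        else 4 * g + 2 * (n - g) - 1 \<le> k \<and> k \<le> 4 * g + 2 * (n - g))"
      proof (cases "k \<le> 4 * g")
        case True
        then have "n = (k + 3) div 4" by (simp add: n_def)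
        then have "n \<le> g" "1 \<le> n" "4 * n - 3 \<le> k" "k \<le> 4 * n" using True p by linarith+
        then show ?thesis using N_eq(2) by simp
      next
        case False
        then obtain d where d: "k = 4 * g + 1 + d" by (metis Suc_eq_plus1 add.assoc add.commute le_Suc_ex not_less_eq_eq)
        then have nn: "n = g + (d + 2) div 2" by (simp add: n_def)
        have "4 * g + 1 + d \<le> 4 * g + 2 * (l - g)" using p d N_eq(1) by simp
        then have "n \<le> l" "g < n" "4 * g + 2 * (n - g) - 1 \<le> k" "k \<le> 4 * g + 2 * (n - g)" unfolding nn d by linarith+
        then show ?thesis by simp
      qed
      then show "closed_W k \<subseteq> (\<Union>n\<in>{1..l}. \<Union>k\<in>{k \<in> pieces. if n \<le> g then 4 * n - 3 \<le> k \<and> k \<le> 4 * n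
        else 4 * g + 2 * (n - g) - 1 \<le> k \<and> k \<le> 4 * g + 2 * (n - g)}. closed_W k)"
        using k by blast
    qed
  qed blast
  finally show ?thesis .
qed

end

section \<open>The closed domain is forward invariant\<close>

lemma closure_finite_UN: "finite I \<Longrightarrow> closure (\<Union>i\<in>I. X i) = (\<Union>i\<in>I. closure (X i))"
  by (induction I rule: finite_induct) auto

lemma closed_arc_cc:
  assumes "x \<in> sphere 0 1" "y \<in> sphere 0 1"
  shows "closed (arc_cc x y)"
proof (cases "x = y")
  case True
  then show ?thesis using arc_cc_eq_insert [OF assms] by simp
next
  case False
  then show ?thesis using closure_arc_co [OF assms False] closed_closure by metis
qed

context partitioned_polygon begin

lemma half_open_domain_subset: "half_open_domain \<subseteq> sphere 0 1 \<times> sphere 0 1"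
  using W_subset S_subset unfolding half_open_domain_def by blast

text \<open>An ideal vertex ends one arc and belongs to another, and \<open>u\<close> is outside at
  least one of the two. Either the point is in the domain itself, or it is a limit of domain points
  with second coordinate in the arc that ends at the vertex.\<close>

lemma vertex_line:
  assumes i: "i \<le> N" "\<not> ell i" and u: "u \<in> sphere 0 1"
  shows "(u, V i) \<in> closure half_open_domain"
proof -
  have *: "(u, V i) \<in> closure half_open_domain" if i: "1 \<le> i" "i \<le> N" "\<not> ell i" for i
  proof -
    define k where "k = (if ell (i - 1) then i - 1 else i)"
    have k: "k \<in> pieces" "top k = i"
      using i ell_piece [of "i - 1"] by (auto simp: k_def top_def pieces_def)
    have Vi: "V i \<in> sphere 0 1" by (rule ideal_vertex [OF i(2,3)])
    obtain k' where k': "k' \<in> pieces" "V i \<in> S k'" using pieces_cover [OF Vi] by blast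
    have "V i \<notin> S k" using arc_co_self unfolding S_def k(2) arc_co_def by simp
    then have kk': "k' \<noteq> k" using k'(2) by blast
    show ?thesis
    proof (cases "u \<in> S k")
      case True
      then have "u \<notin> S k'" using pieces_disjoint [OF k(1) k'(1)] kk' by blast
      then show ?thesis using different_pieces [OF k' u] closure_subset by blast
    next
      case False
      have "{u} \<times> S k \<subseteq> half_open_domain" using different_pieces [OF k(1) _ u False] by blast
      then have "closure ({u} \<times> S k) \<subseteq> closure half_open_domain" by (rule closure_mono)
      moreover have "V i \<in> closure (S k)"
        using closure_arc_co [OF S_ends(1-3) [OF k(1)]] arc_cc_eq_insert [OF S_ends(1,2) [OF k(1)]]
        unfolding S_def k(2) by simp
      ultimately show ?thesis by (auto simp: closure_Times)
    qed
  qed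
  show ?thesis
  proof (cases "i = 0")
    case True
    then show ?thesis using * [of N] N_ge_2 closed_up(2) by simp
  qed (use * [of i] i in simp)
qed

lemma cell_start:
  assumes "j < N"
  shows "A j \<in> arc_co (A (j + 1 - 1)) (A (j + 1))"
proof -
  have "\<alpha> j < \<alpha> (j + 1)" by (rule \<alpha>_step [OF assms])
  moreover have "0 \<le> \<alpha> j" "\<alpha> (j + 1) \<le> 2 * pi" using \<alpha>_mono [of 0 j] \<alpha>_mono [of "j + 1" N] assms by (simp_all add: \<alpha>_0 \<alpha>_N)
  moreover have A: "A j = cis (\<alpha> j)" using A_cis assms by simp
  ultimately have "Arg2pi (A j) = \<alpha> j" using Arg2pi_cis by simp
  moreover have "A j \<in> sphere 0 1" using A by simp
  ultimately show ?thesis using cell_iff [of "j + 1" "A j"] \<open>\<alpha> j < \<alpha> (j + 1)\<close> assms by simp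
qed

definition cell_domain :: "nat \<Rightarrow> (complex \<times> complex) set" where
  "cell_domain j = half_open_domain \<inter> (UNIV \<times> arc_co (A (j - 1)) (A j))"

text \<open>\<open>F\<close> is continuous on each cell only, so invariance passes to the closure
  cell by cell.\<close>

lemma closure_cell_domain_image:
  assumes j: "j \<in> {1..N}" and z: "(u, w) \<in> closure (cell_domain j)"
  shows "(\<gamma> j u, \<gamma> j w) \<in> closure half_open_domain"
proof -
  have "map_prod (\<gamma> j) (\<gamma> j) ` closure (cell_domain j) \<subseteq> closure half_open_domain"
  proof (rule image_closure_subset)
    have c: "continuous_on (cball 0 1) (\<gamma> j)" by (rule disk_isometry_continuous_on [OF isometry [OF j]])
    have "continuous_on (cball 0 1 \<times> cball 0 1) (\<lambda>z. (\<gamma> j (fst z), \<gamma> j (snd z)))"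
      by (intro continuous_on_Pair continuous_on_compose2 [OF c] continuous_on_fst continuous_on_snd continuous_on_id) auto
    then have "continuous_on (cball 0 1 \<times> cball 0 1) (map_prod (\<gamma> j) (\<gamma> j))"
      by (simp add: map_prod_def case_prod_beta)
    moreover have "closure (cell_domain j) \<subseteq> cball 0 1 \<times> cball 0 1"
    proof -
      have "cell_domain j \<subseteq> cball 0 1 \<times> cball 0 1"
        using half_open_domain_subset unfolding cell_domain_def by force
      then show ?thesis by (intro closure_minimal closed_Times closed_cball)
    qed
    ultimately show "continuous_on (closure (cell_domain j)) (map_prod (\<gamma> j) (\<gamma> j))"
      by (rule continuous_on_subset)
    show "map_prod (\<gamma> j) (\<gamma> j) ` cell_domain j \<subseteq> closure half_open_domain"
    proof (rule image_subsetI)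
      fix z assume z: "z \<in> cell_domain j"
      then have "F z = map_prod (\<gamma> j) (\<gamma> j) z" using F_eq [OF j, of "snd z" "fst z"] by (cases z) (simp add: cell_domain_def)
      moreover have "F z \<in> half_open_domain"
        using bij_betw_half_open_domain z unfolding cell_domain_def by (auto simp: bij_betw_def)
      ultimately show "map_prod (\<gamma> j) (\<gamma> j) z \<in> closure half_open_domain" using closure_subset by fastforce
    qed
  qed simp
  then show ?thesis using z by fastforce
qed

lemma closure_cell_domain_cover:
  assumes "z \<in> closure half_open_domain"
  obtains j where "j \<in> {1..N}" "z \<in> closure (cell_domain j)"
proof -
  have "half_open_domain \<subseteq> (\<Union>j\<in>{1..N}. cell_domain j)"
  proof
    fix z assume z: "z \<in> half_open_domain"
    then have "snd z \<in> sphere 0 1" using half_open_domain_subset by fastforce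
    then obtain j where "j \<in> {1..N}" "snd z \<in> arc_co (A (j - 1)) (A j)" using cells_cover by blast
    then show "z \<in> (\<Union>j\<in>{1..N}. cell_domain j)"
      using z by (intro UN_I [of j]) (auto simp: cell_domain_def mem_Times_iff)
  qed
  then have "closure half_open_domain \<subseteq> closure (\<Union>j\<in>{1..N}. cell_domain j)" by (rule closure_mono)
  also have "\<dots> = (\<Union>j\<in>{1..N}. closure (cell_domain j))" by (rule closure_finite_UN) simp
  finally show ?thesis using that assms by blast
qed

text \<open>The jump of \<open>F\<close> at an elliptic partition point is harmless: close to the
  point from the left only the first lower strip is present, its first coordinates lie outside the
  sector, and with such a first coordinate the partition point itself already belongs to the next
  cell's part of the domain.\<close>

lemma closure_at_elliptic_point:
  assumes j: "ell j" and z: "(u, A j) \<in> closure (cell_domain j)"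
  shows "(u, A j) \<in> closure (cell_domain (j + 1))"
proof -
  note a = apos [OF j] note e = ell_orb [OF j]
  \<comment> \<open>Within one unit below \<open>apos j\<close> the ceiling of
    \<open>apos j - y\<close> is 1, which singles out the first lower strip.\<close>
  define b where "b = max 0 (apos j - 1)"
  have b: "0 \<le> b" "b < apos j" "apos j - 1 \<le> b" using a by (auto simp: b_def)
  have C: "arc_co (A (j - 1)) (A j) = orb j ` {0..<apos j}"
  proof -
    have "A (j - 1) = orb j 0" unfolding orb_0 [OF j] by (rule A_ideal) (use ellD [OF j] in auto)
    then show ?thesis unfolding a(3) using orb_arc_co [OF j, of 0 "apos j"] a by simp
  qed
  define D where "D = half_open_domain \<inter> (UNIV \<times> orb j ` {b..<apos j})"
  have "orb j ` {0..<apos j} \<subseteq> orb j ` {b..<apos j} \<union> orb j ` {0..b}"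
    unfolding image_Un [symmetric] by (rule image_mono) auto
  then have "cell_domain j \<subseteq> D \<union> UNIV \<times> orb j ` {0..b}"
    unfolding cell_domain_def D_def C by blast
  moreover have "closed (orb j ` {0..b})"
  proof -
    have "orb j ` {0..b} = arc_cc (orb j 0) (orb j b)" using orb_arc_cc [OF j, of 0 b] b a by simp
    then show ?thesis using closed_arc_cc [OF orb_sphere [OF j] orb_sphere [OF j]] by simp
  qed
  then have "closed (UNIV \<times> orb j ` {0..b} :: (complex \<times> complex) set)" by (intro closed_Times closed_UNIV)
  ultimately have "closure (cell_domain j) \<subseteq> closure D \<union> UNIV \<times> orb j ` {0..b}"
    by (metis closure_Un closure_closed closure_mono)
  moreover have "A j \<notin> orb j ` {0..b}"
  proof
    assume "A j \<in> orb j ` {0..b}"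
    then obtain x where "0 \<le> x" "x \<le> b" "orb j (apos j) = orb j x" unfolding a(3) by auto
    then show False using orb_inj [OF j, of "apos j" x] a b by simp
  qed
  ultimately have zD: "(u, A j) \<in> closure D" using z by blast
  have "(\<lambda>z. (fst z, A j)) ` closure D \<subseteq> closure (cell_domain (j + 1))"
  proof (rule image_closure_subset)
    show "continuous_on (closure D) (\<lambda>z. (fst z, A j))"
      by (intro continuous_intros)
    show "(\<lambda>z. (fst z, A j)) ` D \<subseteq> closure (cell_domain (j + 1))"
    proof (rule image_subsetI)
      fix z assume zD: "z \<in> D"
      obtain u w where zz: "z = (u, w)" by fastforce
      obtain y where y: "b \<le> y" "y < apos j" "w = orb j y" using zD unfolding D_def zz by auto
      have us: "u \<in> sphere 0 1" using zD half_open_domain_subset unfolding D_def zz by blast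
      obtain x where x: "0 \<le> x" "x < 0 + real (ord j)" "u = orb j x" using orb_cover [OF j us] by blast
      have "orb j y \<in> S j" using orb_mem_S [OF j, of y] y a b by simp
      then have "w \<in> S j" using y(3) by simp
      moreover have "(u, w) \<in> half_open_domain" using zD unfolding D_def zz by simp
      ultimately have "(u, w) \<in> W j" using half_open_domain_iff [OF ell_piece [OF j]] by simp
      then have "(x, y) \<in> region j" using elliptic_W_iff [OF j, of x y] x y a b by simp
      then have "real (ord j) - of_int \<lceil>apos j - y\<rceil> \<le> x" using y by (simp add: region_def elliptic_region_def)
      moreover have "real_of_int \<lceil>apos j - y\<rceil> \<le> 1"
      proof -
        have "\<lceil>apos j - y\<rceil> \<le> 1" using y b by (simp add: ceiling_le_iff)
        then show ?thesis by linarith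
      qed
      ultimately have "real (ord j) - 1 \<le> x" by linarith
      then have "(x, apos j) \<in> region j" using x a unfolding region_def elliptic_region_def by simp
      then have "(u, A j) \<in> W j" using elliptic_W_iff [OF j, of x "apos j"] x a by simp
      then have "(u, A j) \<in> half_open_domain" using ell_piece [OF j] by (auto simp: half_open_domain_def)
      moreover have "A j \<in> arc_co (A (j + 1 - 1)) (A (j + 1))" by (rule cell_start) (use ellD(2) [OF j] in simp)
      ultimately have "(u, A j) \<in> cell_domain (j + 1)" by (simp add: cell_domain_def)
      then show "(fst z, A j) \<in> closure (cell_domain (j + 1))" using closure_subset zz by auto
    qed
  qed simp
  then show ?thesis using zD by force
qed

text \<open>If the second coordinate is an ideal partition point, its image is again an ideal vertex
  and \<open>vertex_line\<close> applies. Otherwise the point is in the closure of the part of the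
  domain over its own cell: the only other possibility is a limit from the preceding cell at an
  elliptic partition point.\<close>

lemma F_closed_domain:
  assumes z: "z \<in> closure half_open_domain" "z \<in> off_diagonal"
  shows "F z \<in> closure half_open_domain"
proof -
  obtain u w where uw: "z = (u, w)" by fastforce
  have s: "u \<in> sphere 0 1" "w \<in> sphere 0 1" using z(2) by (auto simp: uw off_diagonal_def)
  obtain k where k: "k \<in> {1..N}" "w \<in> arc_co (A (k - 1)) (A k)" using cells_cover [OF s(2)] by blast
  have Fz: "F z = (\<gamma> k u, \<gamma> k w)" unfolding uw by (rule F_eq [OF k])
  show ?thesis
  proof (cases "w = A (k - 1) \<and> \<not> ell (k - 1)")
    case True
    then have w: "w = V (k - 1)" "\<not> ell (k - 1)" using A_ideal [of "k - 1"] k by auto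
    have kp: "k \<in> pieces" using w(2) k(1) by (simp add: pieces_def)
    obtain i where "i \<le> N" "\<not> ell i" "\<gamma> k w = V i"
    proof (cases "ell k")
      case True
      show ?thesis
        by (rule that [of "k + 1"]) (use ellD [OF True] glue_elliptic [OF True] w in auto)
    next
      case False
      show ?thesis
        by (rule that [of "paired k"]) (use glue_ideal [OF kp False] piece(3) [of "paired k"] w in auto)
    qed
    then show ?thesis
      unfolding Fz using vertex_line disk_isometry_sphere [OF isometry [OF k(1)] s(1)] by metis
  next
    case False
    obtain j where j: "j \<in> {1..N}" "z \<in> closure (cell_domain j)" using closure_cell_domain_cover [OF z(1)] by blast
    have "(u, w) \<in> closure (cell_domain k)"
    proof (cases "j = k")
      case True
      then show ?thesis using j uw by simp
    next
      case jk: False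
      have Aj: "A (j - 1) \<in> sphere 0 1" "A j \<in> sphere 0 1" using A_cis [of j] A_cis [of "j - 1"] j by auto
      have "closed (UNIV \<times> arc_cc (A (j - 1)) (A j) :: (complex \<times> complex) set)" by (intro closed_Times closed_UNIV closed_arc_cc Aj)
      moreover have "cell_domain j \<subseteq> UNIV \<times> arc_cc (A (j - 1)) (A j)"
        unfolding cell_domain_def arc_cc_eq_insert [OF Aj] by blast
      ultimately have "closure (cell_domain j) \<subseteq> UNIV \<times> arc_cc (A (j - 1)) (A j)" by (intro closure_minimal)
      then have "w \<in> arc_cc (A (j - 1)) (A j)" using j(2) uw by blast
      moreover have "w \<notin> arc_co (A (j - 1)) (A j)" using cell_unique [OF j(1) k(1) _ k(2)] jk by blast
      ultimately have w: "w = A j" using arc_cc_eq_insert [OF Aj] by blast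
      have "j \<noteq> N"
      proof
        assume "j = N"
        then have "w = A 0" using w partition by (simp add: boundary_partition_def)
        then have "w \<in> arc_co (A (1 - 1)) (A 1)" using cell_start [of 0] N_ge_2 by simp
        then have "k = 1" using cell_unique [OF k(1) _ k(2), of 1] N_ge_2 by simp
        then show False using False \<open>w = A 0\<close> by simp
      qed
      then have "j < N" using j by auto
      then have kj: "k = j + 1" using cell_unique [OF k(1) _ k(2), of "j + 1"] cell_start [of j] w by simp
      then have "ell j" using False w by simp
      then show ?thesis using closure_at_elliptic_point [of j u] j(2) unfolding uw w kj by blast
    qed
    then show ?thesis unfolding Fz by (rule closure_cell_domain_image [OF k(1)])
  qed
qed

end

section \<open>Side pairings expand chords\<close>

text \<open>\<open>y\<close> is the old chord and \<open>x\<close> the new one; \<open>a\<close>,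
  \<open>b\<close> are the distances before and \<open>a'\<close>, \<open>b'\<close> those after the
  map, which moves both points from within radius \<open>r\<close> to outside of it.\<close>

lemma chord_ratio:
  fixes a b a' b' r x y :: real
  assumes "0 < a" "a \<le> r" "0 < b" "b \<le> r" "r \<le> a'" "r \<le> b'" "x * (a * b) = y * (a' * b')" "0 \<le> y"
  shows "y \<le> x" and "x = y \<Longrightarrow> 0 < y \<Longrightarrow> a = r \<and> b = r \<and> a' = r \<and> b' = r"
proof -
  have r: "0 < r" using assms by linarith
  have 1: "a * b \<le> r * r" "r * r \<le> a' * b'" using assms r by (auto intro!: mult_mono)
  show "y \<le> x"
  proof (rule ccontr)
    assume "\<not> y \<le> x"
    then have "x * (a * b) < y * (a * b)" using assms by (intro mult_strict_right_mono) auto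
    also have "\<dots> \<le> y * (a' * b')" using assms 1 by (intro mult_left_mono) auto
    finally show False using assms by simp
  qed
  assume "x = y" "0 < y"
  then have eq: "a * b = a' * b'" using assms by simp
  have "a = r"
  proof (rule ccontr)
    assume "a \<noteq> r"
    then have "a * b < r * b" using assms by (intro mult_strict_right_mono) auto
    also have "\<dots> \<le> r * r" using assms r by (intro mult_left_mono) auto
    finally show False using 1 eq by simp
  qed
  moreover have "b = r"
  proof (rule ccontr)
    assume "b \<noteq> r"
    then have "a * b < a * r" using assms by (intro mult_strict_left_mono) auto
    also have "\<dots> \<le> r * r" using assms r by (intro mult_right_mono) auto
    finally show False using 1 eq by simp
  qed
  moreover have "a' = r"
  proof (rule ccontr)
    assume "a' \<noteq> r"
    then have "r * r < a' * r" using assms r by (intro mult_strict_right_mono) auto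
    also have "\<dots> \<le> a' * b'" using assms r by (intro mult_left_mono) auto
    finally show False using 1 eq by simp
  qed
  moreover have "b' = r"
  proof (rule ccontr)
    assume "b' \<noteq> r"
    then have "r * r < r * b'" using assms r by (intro mult_strict_left_mono) auto
    also have "\<dots> \<le> a' * b'" using assms r by (intro mult_right_mono) auto
    finally show False using 1 eq by simp
  qed
  ultimately show "a = r \<and> b = r \<and> a' = r \<and> b' = r" by blast
qed

text \<open>Points of a short arc with end points on the isometric circle lie inside it, being combinations of
  the end points with nonnegative coefficients whose sum is at least 1.\<close>

lemma arc_inside_isometric_circle:
  assumes c: "c \<noteq> 0" and ab: "a < b" "b - a \<le> pi / 2"
    and iso: "cmod (1 - cnj c * cis a) ^ 2 = 1 - cmod c ^ 2" "cmod (1 - cnj c * cis b) ^ 2 = 1 - cmod c ^ 2"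
    and x: "a \<le> x" "x \<le> b"
  shows "cmod (1 - cnj c * cis x) ^ 2 \<le> 1 - cmod c ^ 2"
    and "cmod (1 - cnj c * cis x) ^ 2 = 1 - cmod c ^ 2 \<Longrightarrow> x = a \<or> x = b"
proof -
  \<comment> \<open>By the formula for the denominator, a point of the circle is inside the
    isometric circle exactly when \<open>f\<close> is at least \<open>cmod c ^ 2\<close>
    there.\<close>
  define f where "f t = Re (cnj c * cis t)" for t
  have D: "cmod (1 - cnj c * cis t) ^ 2 = 1 + cmod c ^ 2 - 2 * f t" for t
    unfolding f_def by (rule Moebius_denominator_sphere(3)) simp
  define k where "k = cmod c ^ 2"
  have k: "0 < k" using c by (simp add: k_def)
  have fa: "f a = k" "f b = k" using iso unfolding D k_def by simp_all
  define p q where "p = b - x" and "q = x - a"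
  have pq: "0 \<le> p" "0 \<le> q" "p \<le> pi / 2" "q \<le> pi / 2" "p + q = b - a" using x ab by (auto simp: p_def q_def)
  \<comment> \<open>\<open>f\<close> is a sinusoid of period \<open>2 * pi\<close>, so its value at
    \<open>x\<close> is the combination of its values at \<open>a\<close> and \<open>b\<close> with
    weights \<open>sin p / sin (p + q)\<close> and \<open>sin q / sin (p + q)\<close>.\<close>
  have comb: "sin (p + q) * f x = sin p * f a + sin q * f b"
  proof -
    have "sin (p + q) * cos x = sin p * cos (x - q) + sin q * cos (x + p)"
      "sin (p + q) * sin x = sin p * sin (x - q) + sin q * sin (x + p)"
      by (simp_all add: sin_add cos_add sin_diff cos_diff algebra_simps)
    moreover have "x - q = a" "x + p = b" by (simp_all add: p_def q_def)
    ultimately have c: "sin (p + q) * cos x = sin p * cos a + sin q * cos b"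
      and s: "sin (p + q) * sin x = sin p * sin a + sin q * sin b" by simp_all
    have "sin (p + q) * f x = Re c * (sin (p + q) * cos x) + Im c * (sin (p + q) * sin x)"
      by (simp add: f_def algebra_simps)
    also have "\<dots> = sin p * f a + sin q * f b" unfolding c s by (simp add: f_def algebra_simps)
    finally show ?thesis .
  qed
  have sp: "0 < sin (p + q)" using ab pq pi_gt_zero by (intro sin_gt_zero) linarith+
  have s0: "0 \<le> sin p" "0 \<le> sin q" using pq pi_gt_zero by (auto intro!: sin_ge_zero)
  have diff: "sin p + sin q - sin (p + q) = sin p * (1 - cos q) + sin q * (1 - cos p)"
    by (simp add: sin_add algebra_simps)
  have nn: "0 \<le> sin p * (1 - cos q)" "0 \<le> sin q * (1 - cos p)" using s0 by (auto intro!: mult_nonneg_nonneg)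
  have "sin (p + q) * (f x - k) = sin (p + q) * f x - sin (p + q) * k"
    by (rule right_diff_distrib)
  also have "\<dots> = k * (sin p + sin q - sin (p + q))"
    unfolding comb fa by (simp add: algebra_simps del: sin_add)
  finally have eq: "sin (p + q) * (f x - k) = k * (sin p * (1 - cos q) + sin q * (1 - cos p))"
    unfolding diff .
  have "0 \<le> sin (p + q) * (f x - k)" unfolding eq using k nn by simp
  then have "k \<le> f x" using sp by (simp add: zero_le_mult_iff)
  then show "cmod (1 - cnj c * cis x) ^ 2 \<le> 1 - cmod c ^ 2" unfolding D k_def by simp
  assume "cmod (1 - cnj c * cis x) ^ 2 = 1 - cmod c ^ 2"
  then have "f x = k" unfolding D k_def by simp
  then have "k * (sin p * (1 - cos q) + sin q * (1 - cos p)) = 0" using eq by simp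
  then have "sin p * (1 - cos q) = 0" using k nn by (simp add: add_nonneg_eq_0_iff)
  then have "p = 0 \<or> q = 0"
  proof (rule disjE [OF iffD1 [OF mult_eq_0_iff]])
    assume "sin p = 0"
    moreover have "0 < sin p" if "0 < p"
      by (rule sin_gt_zero [OF that]) (use pq pi_gt_zero in linarith)
    ultimately have "\<not> 0 < p" by auto
    then show ?thesis using pq(1) by linarith
  next
    assume "1 - cos q = 0"
    moreover have "cos q < cos 0" if "0 < q"
      by (rule cos_monotone_0_pi [OF order_refl that]) (use pq pi_gt_zero in linarith)
    ultimately have "\<not> 0 < q" by auto
    then show ?thesis using pq(2) by linarith
  qed
  then show "x = a \<or> x = b" by (auto simp: p_def q_def)
qed

lemma dist_bisector_point:
  "cmod (cis (a + \<phi>) - of_real s * cis a) ^ 2 = 1 + s ^ 2 - 2 * s * cos \<phi>"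
proof -
  have "cis (a + \<phi>) - of_real s * cis a = cis a * (cis \<phi> - of_real s)"
    unfolding right_diff_distrib cis_mult by (simp only: mult.commute)
  then have "cmod (cis (a + \<phi>) - of_real s * cis a) = cmod (cis a * (cis \<phi> - of_real s))"
    by (rule arg_cong)
  also have "\<dots> = cmod (cis \<phi> - of_real s)" by (simp add: norm_mult)
  finally have "cmod (cis (a + \<phi>) - of_real s * cis a) ^ 2 = (cos \<phi> - s) ^ 2 + sin \<phi> ^ 2"
    by (simp add: cmod_power2)
  also have "\<dots> = (sin \<phi> ^ 2 + cos \<phi> ^ 2) + s ^ 2 - 2 * s * cos \<phi>" by (simp add: power2_eq_square algebra_simps)
  finally show ?thesis by simp
qed

lemma cis_eq_period:
  assumes "cis s = cis t" "0 \<le> s" "s \<le> 2 * pi" "0 \<le> t" "t \<le> 2 * pi"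
  shows "s = t \<or> s = 0 \<and> t = 2 * pi \<or> s = 2 * pi \<and> t = 0"
proof -
  have "s = t" if "s < 2 * pi" "t < 2 * pi"
    by (rule inj_onD [OF cis_inj_on_period [of 0] assms(1)]) (use assms that in auto)
  moreover have "t = 0" if "s = 2 * pi" "t < 2 * pi"
  proof -
    have "cis 0 = cis t" using assms(1) that by simp
    then have "0 = t" by (rule inj_onD [OF cis_inj_on_period [of 0]]) (use assms that in auto)
    then show ?thesis by simp
  qed
  moreover have "s = 0" if "t = 2 * pi" "s < 2 * pi"
  proof -
    have "cis s = cis 0" using assms(1) that by simp
    then show "s = 0" by (rule inj_onD [OF cis_inj_on_period [of 0]]) (use assms that in auto)
  qed
  ultimately show ?thesis using assms by linarith
qed

text \<open>An arc outside the given one that contains both ends must cover the whole complement,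
  which is longer than a half turn. The cases come from 0 and \<open>2 * pi\<close> being the same
  point.\<close>

lemma ends_not_in_disjoint_arc:
  assumes a: "0 \<le> a" "a < b" "b \<le> 2 * pi" "b - a < pi" and a': "0 \<le> a'" "a' < b'" "b' \<le> 2 * pi" "b' - a' \<le> pi"
    and "b' \<le> a \<or> b \<le> a'" and "cis a \<in> cis ` {a'..b'}" "cis b \<in> cis ` {a'..b'}"
  shows False
proof -
  obtain s t where s: "cis a = cis s" "a' \<le> s" "s \<le> b'" and t: "cis b = cis t" "a' \<le> t" "t \<le> b'"
    using assms(10,11) by auto
  have 1: "a = s \<or> a = 0 \<and> s = 2 * pi \<or> a = 2 * pi \<and> s = 0" by (rule cis_eq_period [OF s(1)]) (use a a' s in auto)
  have 2: "b = t \<or> b = 0 \<and> t = 2 * pi \<or> b = 2 * pi \<and> t = 0" by (rule cis_eq_period [OF t(1)]) (use a a' t in auto)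
  show False using 1 2 assms(9) a a' s t by linarith
qed

section \<open>Expansion on ideal and elliptic pieces\<close>

context partitioned_polygon begin

lemma ideal_expansion:
  assumes k: "k \<in> pieces" "\<not> ell k" and u: "u \<in> closure (S k)" and w: "w \<in> closure (S k)"
  shows "dist u w \<le> dist (\<gamma> k u) (\<gamma> k w)"
    and "dist (\<gamma> k u) (\<gamma> k w) = dist u w \<Longrightarrow> u \<noteq> w \<Longrightarrow> {u, w} = {V (k - 1), V (top k)}"
proof -
  note p = piece [OF k(1)]
  have t: "top k = k" using k(2) by (simp add: top_def)
  have nd: "\<not> diametral k" "\<not> diametral (k - 1)" using k(2) p(4) by (simp_all add: diametral_def)
  obtain \<tau> c where c: "\<gamma> k = Moebius_function \<tau> c" "cmod c < 1" "c \<noteq> 0"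
    "cmod (1 - cnj c * V (k - 1)) ^ 2 = 1 - cmod c ^ 2" "cmod (1 - cnj c * V k) ^ 2 = 1 - cmod c ^ 2"
    by (rule side_isometric_circle [OF p(1) nd])
  have V: "V (k - 1) = cis (\<theta> (k - 1))" "V k = cis (\<theta> k)" using p(9,10) by (simp_all add: t)
  have w2: "\<theta> k - \<theta> (k - 1) \<le> pi / 2" "\<theta> (k - 1) < \<theta> k" using piece_width(3) [OF k] p(12) by (simp_all add: t)
  note arc = arc_inside_isometric_circle [OF c(3) w2(2,1) c(4) [unfolded V] c(5) [unfolded V]]
  have cl: "closure (S k) = cis ` {\<theta> (k - 1)..\<theta> k}" using closure_S [OF k(1)] by (simp add: t)
  have in1: "cmod (1 - cnj c * v) ^ 2 \<le> 1 - cmod c ^ 2" if v: "v \<in> closure (S k)" for v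
  proof -
    obtain x where x: "\<theta> (k - 1) \<le> x" "x \<le> \<theta> k" "v = cis x" using v unfolding cl by auto
    show ?thesis unfolding x(3) by (rule arc(1) [OF x(1,2)])
  qed
  have in2: "v \<in> {V (k - 1), V (top k)}" if v: "v \<in> closure (S k)" and vr: "cmod (1 - cnj c * v) ^ 2 = 1 - cmod c ^ 2" for v
  proof -
    obtain x where x: "\<theta> (k - 1) \<le> x" "x \<le> \<theta> k" "v = cis x" using v unfolding cl by auto
    have "x = \<theta> (k - 1) \<or> x = \<theta> k" by (rule arc(2) [OF x(1,2) vr [unfolded x(3)]])
    then show ?thesis unfolding x(3) t V by (elim disjE) (simp_all only: insert_iff simp_thms)
  qed
  have "cmod c ^ 2 < 1" using c by (simp add: abs_square_less_1)
  \<comment> \<open>The common value of the denominator's modulus on the isometric circle. It also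
    serves as the outer pair in \<open>chord_ratio\<close>, since the chord formula contains only
    the old points.\<close>
  define r where "r = sqrt (1 - cmod c ^ 2)"
  have r: "0 < r" "r * r = 1 - cmod c ^ 2" using \<open>cmod c ^ 2 < 1\<close> by (simp_all add: r_def)
  have ball: "v \<in> cball 0 1" if "v \<in> closure (S k)" for v using that unfolding cl by auto
  have a: "0 < cmod (1 - cnj c * v)" "cmod (1 - cnj c * v) \<le> r" if "v \<in> closure (S k)" for v
    subgoal using Moebius_denominator_nz [OF c(2) ball [OF that]] by simp
    subgoal unfolding r_def by (rule real_le_rsqrt [OF in1 [OF that]])
    done
  have ch: "dist (\<gamma> k u) (\<gamma> k w) * (cmod (1 - cnj c * u) * cmod (1 - cnj c * w)) = dist u w * (r * r)"
    using Moebius_function_chord [OF c(2) ball [OF u] ball [OF w], of \<tau>] a(1) [OF u] a(1) [OF w]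
    by (simp add: dist_norm c(1) r(2))
  note R = chord_ratio [OF a [OF u] a [OF w] order_refl order_refl ch zero_le_dist]
  show "dist u w \<le> dist (\<gamma> k u) (\<gamma> k w)" by (rule R(1))
  assume "dist (\<gamma> k u) (\<gamma> k w) = dist u w" "u \<noteq> w"
  then have "cmod (1 - cnj c * u) = r \<and> cmod (1 - cnj c * w) = r" using R(2) by simp
  then have "u \<in> {V (k - 1), V (top k)}" "w \<in> {V (k - 1), V (top k)}"
    using in2 [OF u] in2 [OF w] r(2) by (simp_all add: power2_eq_square)
  then show "{u, w} = {V (k - 1), V (top k)}" using \<open>u \<noteq> w\<close> by auto
qed

text \<open>The sector ends have equal distance to \<open>V k\<close>. As the vertex is on the
  bisector and not beyond the centre, points of the sector are at most that far away and points
  outside at least; the rotation by \<open>e\<close> moves one unit of the sector onto the outside.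
  In the diametral case all distances are 1 and chords are merely preserved.\<close>

lemma elliptic_expansion:
  assumes k: "ell k" and q: "q < ord k - 1" and x: "x \<in> {real q..real q + 1}" and y: "y \<in> {real q..real q + 1}"
  defines "e \<equiv> real (ord k - 1 - q)"
  shows "dist (orb k x) (orb k y) \<le> dist (orb k (x + e)) (orb k (y + e))"
    and "dist (orb k (x + e)) (orb k (y + e)) = dist (orb k x) (orb k y) \<Longrightarrow> orb k x \<noteq> orb k y \<Longrightarrow> \<not> diametral k \<Longrightarrow>
      ord k = 2 \<and> {orb k (x + e), orb k (y + e)} = {V (k - 1), V (top k)}"
proof -
  define m where "m = real (ord k)"
  have m: "2 \<le> m" using ell_orb(4) [OF k] by (simp add: m_def)
  have e: "e = m - 1 - real q" and qm: "real q + 1 \<le> m - 1" using q by (auto simp: e_def m_def of_nat_diff)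
  note p = piece [OF ell_piece [OF k]] note d = odd_neighbours [OF ellD(5) [OF k] p(3) ellD(6) [OF k]]
  have t: "top k = k + 1" using k by (simp add: top_def)
  obtain s where s: "V k = of_real s * cis (\<theta> k)" "0 \<le> s" "s < 1" "\<not> diametral k \<Longrightarrow> 0 < s"
    using V_elliptic [OF k] by blast
  define d' where "d' = pi / real l"
  note d = d [folded d'_def]
  \<comment> \<open>The squared distance from \<open>V k\<close> to the two ends of its
    sector.\<close>
  define R where "R = 1 + s ^ 2 - 2 * s * cos d'"
  have e0: "orb k 0 = V (k - 1)" "orb k (m - 1) = V (k + 1)" "orb k m = V (k - 1)"
    using orb_0 [OF k] orb_top [OF k] orb_period [OF k, of 0] by (simp_all add: m_def)
  have D: "cmod (cis (\<theta> k + \<phi>) - V k) ^ 2 = 1 + s ^ 2 - 2 * s * cos \<phi>" for \<phi>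
    unfolding s(1) by (rule dist_bisector_point)
  have inner: "cmod (orb k z - V k) ^ 2 \<le> R \<and> (0 < s \<longrightarrow> cmod (orb k z - V k) ^ 2 = R \<longrightarrow> orb k z \<in> {V (k - 1), V (k + 1)})"
    if z: "0 \<le> z" "z \<le> m - 1" for z
  proof -
    have "orb k z \<in> orb k ` {0..m - 1}" using z by simp
    also have "orb k ` {0..m - 1} = arc_cc (V (k - 1)) (V (k + 1))"
      using orb_arc_cc [OF k, of 0 "m - 1"] m e0 by (simp add: m_def)
    also have "\<dots> = cis ` {\<theta> k - d'..\<theta> k + d'}"
      unfolding d(3,4) by (rule arc_cc_cis) (use d(7,8) pi_gt_zero in linarith)+
    finally obtain \<psi> where \<psi>: "orb k z = cis \<psi>" "\<theta> k - d' \<le> \<psi>" "\<psi> \<le> \<theta> k + d'" by auto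
    define \<phi> where "\<phi> = \<psi> - \<theta> k"
    have \<phi>: "orb k z = cis (\<theta> k + \<phi>)" "\<bar>\<phi>\<bar> \<le> d'" using \<psi> by (auto simp: \<phi>_def)
    have c: "cos d' \<le> cos \<bar>\<phi>\<bar>" using \<phi>(2) d(7,8) pi_gt_zero by (intro cos_monotone_0_pi_le) auto
    have "2 * s * cos d' \<le> 2 * s * cos \<phi>" using c s(2) by (intro mult_left_mono) auto
    then have 1: "cmod (orb k z - V k) ^ 2 \<le> R" unfolding \<phi>(1) D R_def by simp
    moreover have "orb k z \<in> {V (k - 1), V (k + 1)}" if "0 < s" "cmod (orb k z - V k) ^ 2 = R"
    proof -
      have "cos d' = cos \<bar>\<phi>\<bar>" using that unfolding \<phi>(1) D R_def by simp
      then have "d' = \<bar>\<phi>\<bar>" by (rule cos_inj_pi [rotated 4]) (use \<phi>(2) d(7,8) pi_gt_zero in auto)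
      then have "\<phi> = d' \<or> \<phi> = - d'" by linarith
      then show ?thesis unfolding \<phi>(1) d(3,4) by auto
    qed
    ultimately show ?thesis by blast
  qed
  have outer: "R \<le> cmod (orb k z - V k) ^ 2 \<and> (0 < s \<longrightarrow> cmod (orb k z - V k) ^ 2 = R \<longrightarrow> orb k z \<in> {V (k - 1), V (k + 1)})"
    if z: "m - 1 \<le> z" "z \<le> m" for z
  proof -
    have V2: "V (k - 1) = cis ((\<theta> k - d') + 2 * pi)" unfolding cis_add_2pi by (rule d(3))
    have "orb k z \<in> orb k ` {m - 1..m}" using z by simp
    also have "orb k ` {m - 1..m} = arc_cc (V (k + 1)) (V (k - 1))"
      using orb_arc_cc [OF k, of "m - 1" m] m e0 by (simp add: m_def)
    also have "\<dots> = cis ` {\<theta> k + d'..(\<theta> k - d') + 2 * pi}"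
      unfolding d(4) V2 by (rule arc_cc_cis) (use d(7,8) pi_gt_zero in linarith)+
    finally obtain \<psi> where \<psi>: "orb k z = cis \<psi>" "\<theta> k + d' \<le> \<psi>" "\<psi> \<le> (\<theta> k - d') + 2 * pi" by auto
    define \<phi> where "\<phi> = \<psi> - \<theta> k - pi"
    have \<phi>: "orb k z = cis (\<theta> k + (pi + \<phi>))" "\<bar>\<phi>\<bar> \<le> pi - d'" using \<psi> by (auto simp: \<phi>_def)
    have "cos (pi - d') \<le> cos \<bar>\<phi>\<bar>" using \<phi>(2) d(7,8) pi_gt_zero by (intro cos_monotone_0_pi_le) auto
    then have c: "cos (pi + \<phi>) \<le> cos d'" by simp
    have "2 * s * cos (pi + \<phi>) \<le> 2 * s * cos d'" using c s(2) by (intro mult_left_mono) auto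
    then have 1: "R \<le> cmod (orb k z - V k) ^ 2" unfolding \<phi>(1) D R_def by simp
    moreover have "orb k z \<in> {V (k - 1), V (k + 1)}" if "0 < s" "cmod (orb k z - V k) ^ 2 = R"
    proof -
      have canc: "b = b'" if "a * b = a * b'" "0 < a" for a b b' :: real using that by simp
      have "2 * s * cos d' = 2 * s * cos (pi + \<phi>)" using that(2) unfolding \<phi>(1) D R_def by linarith
      then have "cos d' = cos (pi + \<phi>)" by (rule canc) (use that(1) in simp)
      then have "cos (pi - d') = cos \<bar>\<phi>\<bar>" by simp
      then have "pi - d' = \<bar>\<phi>\<bar>" by (rule cos_inj_pi [rotated 4]) (use \<phi>(2) d(7,8) pi_gt_zero in auto)
      then have "\<theta> k + (pi + \<phi>) = (\<theta> k - d') + 2 * pi \<or> \<theta> k + (pi + \<phi>) = \<theta> k + d'" by linarith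
      then show ?thesis unfolding \<phi>(1) V2 d(4) by (elim disjE) (simp_all only: insert_iff simp_thms)
    qed
    ultimately show ?thesis by blast
  qed
  define r where "r = sqrt R"
  have xy: "0 \<le> x" "x \<le> m - 1" "0 \<le> y" "y \<le> m - 1" "m - 1 \<le> x + e" "x + e \<le> m" "m - 1 \<le> y + e" "y + e \<le> m"
    using x y qm unfolding e by auto
  have pos: "0 < cmod (orb k z - V k)" for z
    using orb_sphere [OF k, of z] elliptic_vertex [OF k] by auto
  have "0 \<le> R" using inner [OF xy(1,2)] zero_le_power2 [of "cmod (orb k x - V k)"] by linarith
  then have rr: "r ^ 2 = R" "0 \<le> r" by (simp_all add: r_def)
  have i: "cmod (orb k z - V k) \<le> r" if "0 \<le> z" "z \<le> m - 1" for z
    unfolding r_def using inner [OF that] by (intro real_le_rsqrt) blast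
  have oo: "r \<le> cmod (orb k z - V k)" if "m - 1 \<le> z" "z \<le> m" for z
    by (rule power2_le_imp_le) (use outer [OF that] rr in auto)
  have ch: "dist (orb k (x + e)) (orb k (y + e)) * (cmod (orb k x - V k) * cmod (orb k y - V k)) =
      dist (orb k x) (orb k y) * (cmod (orb k (x + e) - V k) * cmod (orb k (y + e) - V k))"
    unfolding dist_norm by (rule orb_chord [OF k])
  note CR = chord_ratio [OF pos i [OF xy(1,2)] pos i [OF xy(3,4)] oo [OF xy(5,6)] oo [OF xy(7,8)] ch zero_le_dist]
  show "dist (orb k x) (orb k y) \<le> dist (orb k (x + e)) (orb k (y + e))" by (rule CR(1))
  assume eq: "dist (orb k (x + e)) (orb k (y + e)) = dist (orb k x) (orb k y)" and ne: "orb k x \<noteq> orb k y"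
    and nd: "\<not> diametral k"
  have s0: "0 < s" by (rule s(4) [OF nd])
  have E: "cmod (orb k x - V k) ^ 2 = R" "cmod (orb k y - V k) ^ 2 = R"
    "cmod (orb k (x + e) - V k) ^ 2 = R" "cmod (orb k (y + e) - V k) ^ 2 = R"
    using CR(2) [OF eq] ne rr by simp_all
  have in1: "orb k x \<in> {V (k - 1), V (k + 1)}" "orb k y \<in> {V (k - 1), V (k + 1)}"
    using inner [OF xy(1,2)] inner [OF xy(3,4)] s0 E by blast+
  have out1: "orb k (x + e) \<in> {V (k - 1), V (k + 1)}" "orb k (y + e) \<in> {V (k - 1), V (k + 1)}"
    using outer [OF xy(5,6)] outer [OF xy(7,8)] s0 E by blast+
  have ends: "z = 0 \<or> z = m - 1" if "0 \<le> z" "z \<le> m - 1" "orb k z \<in> {V (k - 1), V (k + 1)}" for z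
    using orb_inj [OF k, of z 0] orb_inj [OF k, of z "m - 1"] that m e0 by (auto simp: m_def)
  \<comment> \<open>Equality puts both points at ends of the sector. They are distinct and share one
    unit interval, so the sector is one unit long.\<close>
  have "x = 0 \<or> x = m - 1" "y = 0 \<or> y = m - 1" using ends xy in1 by blast+
  moreover have "x \<noteq> y" using ne by auto
  ultimately have "m - 1 \<le> 1" using x y by auto
  then have "ord k = 2" using m by (simp add: m_def)
  moreover have "dist (orb k (x + e)) (orb k (y + e)) \<noteq> 0" using eq ne by simp
  then have "orb k (x + e) \<noteq> orb k (y + e)" by simp
  ultimately show "ord k = 2 \<and> {orb k (x + e), orb k (y + e)} = {V (k - 1), V (top k)}"
    using out1 unfolding t by auto
qed

text \<open>The equality case of the expansion is ruled out here: no other arc contains both ends of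
  an arc shorter than a half turn.\<close>

lemma ends_in_other_piece:
  assumes k: "k \<in> pieces" "k' \<in> pieces" "k \<noteq> k'" and w: "\<theta> (top k) - \<theta> (k - 1) < pi"
    and "V (k - 1) \<in> closure (S k')" "V (top k) \<in> closure (S k')"
  shows False
proof -
  note p = piece [OF k(1)] and p' = piece [OF k(2)]
  have "top k' \<le> k - 1 \<or> top k \<le> k' - 1"
    using pieces_ordered [OF k(1,2)] pieces_ordered [OF k(2,1)] k(3) by linarith
  then have o: "\<theta> (top k') \<le> \<theta> (k - 1) \<or> \<theta> (top k) \<le> \<theta> (k' - 1)" by simp
  show False
    by (rule ends_not_in_disjoint_arc [OF p(11-13) w p'(11-13) piece_width(1) [OF k(2)] o])
       (use assms(5,6) in \<open>simp_all only: closure_S [OF k(2)] p(9,10)\<close>)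
qed

section \<open>Every orbit enters the domain\<close>

text \<open>\<open>q\<close> is the unit interval of the sector shared by both coordinates. The exit
  is expressed by counter-clockwise steps even where \<open>F\<close> turns clockwise, because the
  resulting rotation is the same. For an ideal side \<open>q\<close> is a dummy, fixed to 0 in
  \<open>exit_index\<close>.\<close>

definition exit_map :: "nat \<times> nat \<Rightarrow> complex \<Rightarrow> complex" where
  "exit_map = (\<lambda>(k, q). if ell k then \<gamma> (k + 1) ^^ (ord k - 1 - q) else \<gamma> k)"

definition exit_arc :: "nat \<times> nat \<Rightarrow> complex set" where
  "exit_arc = (\<lambda>(k, q). if ell k then orb k ` {real q..<real q + 1} else S k)"

definition exit_closed_arc :: "nat \<times> nat \<Rightarrow> complex set" where
  "exit_closed_arc = (\<lambda>(k, q). if ell k then orb k ` {real q..real q + 1} else closure (S k))"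

definition exit_index :: "(nat \<times> nat) set" where
  "exit_index = (SIGMA k:pieces. {..<(if ell k then ord k - 1 else 1)})"

lemma exit_map_orb: "ell k \<Longrightarrow> exit_map (k, q) (orb k x) = orb k (x + real (ord k - 1 - q))"
proof -
  assume k: "ell k"
  have "(\<gamma> (k + 1) ^^ i) (orb k x) = orb k (x + real i)" for i
    by (induction i) (simp_all add: \<gamma>_orb(2) [OF k, unfolded Suc_eq_plus1 [symmetric]] algebra_simps)
  then show ?thesis using k by (simp add: exit_map_def)
qed

lemma exit_index_cases:
  assumes "i \<in> exit_index"
  obtains k where "k \<in> pieces" "\<not> ell k" "i = (k, 0)"
  | k q where "k \<in> pieces" "ell k" "q < ord k - 1" "i = (k, q)"
  using assms by (auto simp: exit_index_def split: if_splits)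

lemma exit_closed_arc_subset:
  assumes "i \<in> exit_index"
  shows "exit_arc i \<subseteq> exit_closed_arc i" "exit_arc i \<subseteq> S (fst i)" "exit_closed_arc i \<subseteq> closure (S (fst i))"
    "compact (exit_closed_arc i)" "exit_closed_arc i \<subseteq> sphere 0 1"
proof -
  have cs: "closure (S k) \<subseteq> sphere 0 1" for k by (intro closure_minimal S_subset closed_sphere)
  have "exit_arc i \<subseteq> exit_closed_arc i \<and> exit_arc i \<subseteq> S (fst i) \<and> exit_closed_arc i \<subseteq> closure (S (fst i)) \<and> closed (exit_closed_arc i)"
    using assms
  proof (cases rule: exit_index_cases)
    case (1 k)
    then show ?thesis using closure_subset by (simp add: exit_arc_def exit_closed_arc_def)
  next
    case (2 k q)
    have q: "real q + 1 \<le> real (ord k) - 1" using 2(3) by linarith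
    have "orb k ` {real q..<real q + 1} \<subseteq> S k" unfolding S_orb [OF 2(2)] by (rule image_mono) (use q in auto)
    moreover from this have "closure (orb k ` {real q..<real q + 1}) \<subseteq> closure (S k)" by (rule closure_mono)
    moreover have "closure (orb k ` {real q..<real q + 1}) = orb k ` {real q..real q + 1}"
      by (rule closure_orb [OF 2(2)]) (use ell_orb(4) [OF 2(2)] in auto)
    moreover have "orb k ` {real q..<real q + 1} \<subseteq> orb k ` {real q..real q + 1}" by (rule image_mono) auto
    ultimately show ?thesis using 2 closed_closure [of "orb k ` {real q..<real q + 1}"]
      by (simp add: exit_arc_def exit_closed_arc_def)
  qed
  then show "exit_arc i \<subseteq> exit_closed_arc i" "exit_arc i \<subseteq> S (fst i)" "exit_closed_arc i \<subseteq> closure (S (fst i))"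
    "compact (exit_closed_arc i)" "exit_closed_arc i \<subseteq> sphere 0 1"
  proof -
    assume *: "exit_arc i \<subseteq> exit_closed_arc i \<and> exit_arc i \<subseteq> S (fst i) \<and> exit_closed_arc i \<subseteq> closure (S (fst i)) \<and> closed (exit_closed_arc i)"
    show "exit_arc i \<subseteq> exit_closed_arc i" "exit_arc i \<subseteq> S (fst i)" "exit_closed_arc i \<subseteq> closure (S (fst i))"
      using * by blast+
    show sph: "exit_closed_arc i \<subseteq> sphere 0 1" using * cs [of "fst i"] by blast
    show "compact (exit_closed_arc i)"
      unfolding compact_eq_bounded_closed using * bounded_subset [OF bounded_sphere sph] by blast
  qed
qed

lemma continuous_on_exit_map:
  assumes "i \<in> exit_index"
  shows "continuous_on (sphere 0 1) (exit_map i)"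
proof -
  have c: "continuous_on (sphere 0 1) (\<gamma> j)" if "j \<in> {1..N}" for j
    by (rule continuous_on_subset [OF disk_isometry_continuous_on [OF isometry [OF that]]]) auto
  have it: "continuous_on (sphere 0 1) (\<gamma> j ^^ n) \<and> (\<gamma> j ^^ n) ` sphere 0 1 \<subseteq> sphere 0 1" if j: "j \<in> {1..N}" for j n
  proof (induction n)
    case 0
    then show ?case by (simp add: id_def [symmetric])
  next
    case (Suc n)
    have "continuous_on (sphere 0 1) (\<gamma> j \<circ> (\<gamma> j ^^ n))"
      using Suc c [OF j] by (intro continuous_on_compose) (auto intro: continuous_on_subset)
    moreover have "(\<gamma> j \<circ> (\<gamma> j ^^ n)) ` sphere 0 1 \<subseteq> sphere 0 1"
      using Suc disk_isometry_image_sphere [OF isometry [OF j]] unfolding image_comp [symmetric] by blast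
    ultimately show ?case by simp
  qed
  show ?thesis using assms
  proof (cases rule: exit_index_cases)
    case (1 k)
    then show ?thesis using c [OF piece(1) [OF 1(1)]] by (simp add: exit_map_def)
  next
    case (2 k q)
    then show ?thesis using it [OF ellD(4) [OF 2(2)]] by (simp add: exit_map_def)
  qed
qed

lemma exit_leaves:
  assumes "i \<in> exit_index" "z \<in> exit_arc i"
  shows "exit_map i z \<notin> S (\<sigma> (fst i))"
  using assms(1)
proof (cases rule: exit_index_cases)
  case (1 k)
  then have "z \<in> S k" using assms by (simp add: exit_arc_def)
  then have "\<gamma> k z \<in> sphere 0 1 - S (paired k)" using \<gamma>_ideal_image(1) [OF 1(1,2)] by blast
  then show ?thesis using 1 by (simp add: exit_map_def \<sigma>_def)
next
  case (2 k q)
  obtain x where x: "real q \<le> x" "x < real q + 1" "z = orb k x" using assms 2 by (auto simp: exit_arc_def)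
  have e: "real (ord k - 1 - q) = real (ord k) - 1 - real q" using 2(3) by (simp add: of_nat_diff)
  have "orb k (x + real (ord k - 1 - q)) \<notin> S k"
    using orb_mem_S [OF 2(2), of "x + real (ord k - 1 - q)"] x ell_orb(4) [OF 2(2)] unfolding e by simp
  then show ?thesis using 2 x(3) by (simp add: exit_map_orb \<sigma>_def)
qed

text \<open>Chords are kept only between end points: a gluing takes the ends of a side to the ends
  of its partner, and an elliptic exit that keeps a chord belongs to a sector of order 2 and ends at
  the sector's own ends. A sector of order 2 as wide as a half turn would be diametral.\<close>

lemma exit_expansion:
  assumes i: "i \<in> exit_index" and u: "u \<in> exit_closed_arc i" and w: "w \<in> exit_closed_arc i"
  shows "dist u w \<le> dist (exit_map i u) (exit_map i w)"
    and "dist (exit_map i u) (exit_map i w) = dist u w \<Longrightarrow> u \<noteq> w \<Longrightarrow> \<not> diametral (fst i) \<Longrightarrow>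
      {exit_map i u, exit_map i w} = {V (\<sigma> (fst i) - 1), V (top (\<sigma> (fst i)))} \<and>
      \<theta> (top (\<sigma> (fst i))) - \<theta> (\<sigma> (fst i) - 1) < pi"
proof -
  have "dist u w \<le> dist (exit_map i u) (exit_map i w) \<and>
    (dist (exit_map i u) (exit_map i w) = dist u w \<longrightarrow> u \<noteq> w \<longrightarrow> \<not> diametral (fst i) \<longrightarrow>
      {exit_map i u, exit_map i w} = {V (\<sigma> (fst i) - 1), V (top (\<sigma> (fst i)))} \<and>
      \<theta> (top (\<sigma> (fst i))) - \<theta> (\<sigma> (fst i) - 1) < pi)"
    using i
  proof (cases rule: exit_index_cases)
    case (1 k)
    have uw: "u \<in> closure (S k)" "w \<in> closure (S k)" using u w 1 by (simp_all add: exit_closed_arc_def)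
    note E = ideal_expansion [OF 1(1,2) uw] note G = glue_ideal [OF 1(1,2)]
    have \<sigma>: "\<sigma> k = paired k" "top k = k" using 1 by (simp_all add: \<sigma>_def top_def)
    have q: "paired k \<in> pieces" "\<not> ell (paired k)" using G by blast+
    then have tq: "top (paired k) = paired k" by (simp add: top_def)
    have w2: "\<theta> (top (paired k)) - \<theta> (paired k - 1) < pi"
      using piece_width(3) [OF q] pi_gt_zero by linarith
    have "{\<gamma> k u, \<gamma> k w} = {V (paired k - 1), V (top (paired k))}"
      if "dist (\<gamma> k u) (\<gamma> k w) = dist u w" "u \<noteq> w"
    proof -
      have "\<gamma> k ` {u, w} = \<gamma> k ` {V (k - 1), V k}" using E(2) [OF that] \<sigma> by simp
      then show ?thesis using G unfolding tq by auto
    qed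
    then show ?thesis using E(1) w2 1 \<sigma> by (simp add: exit_map_def)
  next
    case (2 k q)
    obtain x where x: "x \<in> {real q..real q + 1}" "u = orb k x" using u 2 by (auto simp: exit_closed_arc_def)
    obtain y where y: "y \<in> {real q..real q + 1}" "w = orb k y" using w 2 by (auto simp: exit_closed_arc_def)
    note E = elliptic_expansion [OF 2(2,3) x(1) y(1)]
    have \<sigma>: "\<sigma> k = k" using 2 by (simp add: \<sigma>_def)
    have "\<theta> (top k) - \<theta> (k - 1) < pi" if "ord k = 2" "\<not> diametral k"
    proof -
      have "l \<noteq> 2" using that 2(2) by (auto simp: diametral_def)
      then have "2 < l" using piece_width(4) [OF 2(1,2)] by simp
      then have "2 * pi / real l < 2 * pi / 2" by (intro divide_strict_left_mono) auto
      then show ?thesis using piece_width(2) [OF 2(1,2)] by simp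
    qed
    note w2 = this
    have em: "exit_map (k, q) u = orb k (x + real (ord k - 1 - q))" "exit_map (k, q) w = orb k (y + real (ord k - 1 - q))"
      unfolding x(2) y(2) by (rule exit_map_orb [OF 2(2)])+
    show ?thesis
      unfolding 2(4) fst_conv \<sigma> em
    proof (intro conjI impI)
      show "dist u w \<le> dist (orb k (x + real (ord k - 1 - q))) (orb k (y + real (ord k - 1 - q)))"
        unfolding x(2) y(2) by (rule E(1))
      assume h: "dist (orb k (x + real (ord k - 1 - q))) (orb k (y + real (ord k - 1 - q))) = dist u w" "u \<noteq> w" "\<not> diametral k"
      note E2 = E(2) [OF h(1) [unfolded x(2) y(2)] h(2) [unfolded x(2) y(2)] h(3)]
      show "{orb k (x + real (ord k - 1 - q)), orb k (y + real (ord k - 1 - q))} = {V (k - 1), V (top k)}"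
        by (rule conjunct2 [OF E2])
      show "\<theta> (top k) - \<theta> (k - 1) < pi"
        by (rule w2 [OF conjunct1 [OF E2] h(3)])
    qed
  qed
  then show "dist u w \<le> dist (exit_map i u) (exit_map i w)"
    and "dist (exit_map i u) (exit_map i w) = dist u w \<Longrightarrow> u \<noteq> w \<Longrightarrow> \<not> diametral (fst i) \<Longrightarrow>
      {exit_map i u, exit_map i w} = {V (\<sigma> (fst i) - 1), V (top (\<sigma> (fst i)))} \<and>
      \<theta> (top (\<sigma> (fst i))) - \<theta> (\<sigma> (fst i) - 1) < pi"
    by blast+
qed

section \<open>Orbits that avoid the domain\<close>

definition escaping :: "(complex \<times> complex) set" where
  "escaping = {z \<in> off_diagonal. \<forall>n. (F ^^ n) z \<notin> half_open_domain}"

lemma funpow_escaping: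
  assumes "z \<in> escaping"
  shows "(F ^^ n) z \<in> escaping"
proof -
  have "(F ^^ n) z \<in> off_diagonal"
    using assms by (induction n) (auto simp: escaping_def F_off_diagonal)
  moreover have "(F ^^ j) ((F ^^ n) z) \<notin> half_open_domain" for j
  proof -
    have "(F ^^ j) ((F ^^ n) z) = (F ^^ (j + n)) z" by (simp add: funpow_add)
    then show ?thesis using assms by (simp add: escaping_def)
  qed
  ultimately show ?thesis by (simp add: escaping_def)
qed

lemma elliptic_step_range:
  assumes "z \<in> {0..<real m} \<times> {0..<real m}"
  shows "elliptic_step m a z \<in> {0..<real m} \<times> {0..<real m}"
proof -
  have "0 < real m" using assms by auto
  then have m1: "1 \<le> real m" by simp
  show ?thesis
    using assms by (cases z; auto simp: elliptic_step_def wrap_down_def wrap_up_def; use m1 in linarith)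
qed

text \<open>A pair separated by an arc is in the domain by \<open>different_pieces\<close>, so both
  coordinates start in a common arc. In an elliptic sector the same argument excludes the separating
  outcomes of \<open>elliptic_exit\<close>; only the common exit remains.\<close>

lemma escaping_exit:
  assumes "z \<in> escaping"
  shows "\<exists>i\<in>exit_index. z \<in> exit_arc i \<times> exit_arc i \<and> map_prod (exit_map i) (exit_map i) z \<in> escaping"
proof -
  obtain u w where z: "z = (u, w)" by fastforce
  have s: "u \<in> sphere 0 1" "w \<in> sphere 0 1" and out: "(F ^^ n) (u, w) \<notin> half_open_domain" for n
    using assms by (auto simp: escaping_def off_diagonal_def z)
  obtain k where k: "k \<in> pieces" "w \<in> S k" using pieces_cover [OF s(2)] by blast
  have u: "u \<in> S k" using different_pieces [OF k s(1)] out [of 0] by auto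
  show ?thesis
  proof (cases "ell k")
    case False
    have "(k, 0) \<in> exit_index" using k False by (simp add: exit_index_def)
    moreover have "map_prod (exit_map (k, 0)) (exit_map (k, 0)) z = F z"
      using F_ideal [OF k(1) False k(2), of u] False by (simp add: z exit_map_def)
    moreover have "F z \<in> escaping" using funpow_escaping [OF assms, of 1] by simp
    moreover have "z \<in> exit_arc (k, 0) \<times> exit_arc (k, 0)" using False u k by (simp add: z exit_arc_def)
    ultimately show ?thesis by (intro bexI [of _ "(k, 0)"]) simp_all
  next
    case True
    define m a where "m = ord k" and "a = apos k"
    obtain x where x: "0 \<le> x" "x < real m - 1" "u = orb k x" using u unfolding S_orb [OF True] m_def by auto
    obtain y where y: "0 \<le> y" "y < real m - 1" "w = orb k y" using k(2) unfolding S_orb [OF True] m_def by auto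
    note ap = apos [OF True, folded m_def a_def]
    let ?f = "elliptic_step m a"
    obtain n where n: "0 < n" "\<forall>j<n. snd ((?f ^^ j) (x, y)) < real m - 1"
      and c: "case (?f ^^ n) (x, y) of (x', y') \<Rightarrow>
       0 \<le> x' \<and> x' < real m \<and> 0 \<le> y' \<and> y' < real m \<and>
       (x' < real m - 1 \<and> real m - 1 \<le> y' \<or> real m - 1 \<le> x' \<and> y' < real m - 1 \<or>
       (real m - 1 \<le> x' \<and> real m - 1 \<le> y' \<and> \<lfloor>x\<rfloor> = \<lfloor>y\<rfloor> \<and>
        x' = x + (real m - 1 - of_int \<lfloor>y\<rfloor>) \<and> y' = y + (real m - 1 - of_int \<lfloor>y\<rfloor>)))"
      using elliptic_exit [OF ell_orb(3) [OF True, folded m_def] ap(1,2) x(1,2) y(1,2)] by (elim exE conjE) (rule that; assumption)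
    obtain x' y' where xy': "(?f ^^ n) (x, y) = (x', y')" by fastforce
    note c' = c [unfolded xy' prod.case]
    have zxy: "z = orb2 k (x, y)" by (simp add: z x(3) y(3) orb2_def)
    have rng: "(?f ^^ j) (x, y) \<in> {0..<real m} \<times> {0..<real m}" for j
      by (induction j) (use x y in \<open>auto intro!: elliptic_step_range\<close>)
    have Fj: "(F ^^ j) z = orb2 k ((?f ^^ j) (x, y))" if "j \<le> n" for j
      using that
    proof (induction j)
      case 0
      then show ?case by (simp add: zxy)
    next
      case (Suc j)
      have "0 \<le> snd ((?f ^^ j) (x, y))" using rng [of j] by (auto simp: mem_Times_iff)
      moreover have "snd ((?f ^^ j) (x, y)) < real m - 1" using n(2) Suc.prems by simp
      ultimately show ?case using Suc F_orb2 [OF True, of "(?f ^^ j) (x, y)"] by (simp add: m_def a_def)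
    qed
    have Fn: "(F ^^ n) z = (orb k x', orb k y')" using Fj [of n] xy' by (simp add: orb2_def)
    have nH: "(orb k x', orb k y') \<notin> half_open_domain" using out [of n] Fn by (simp add: z)
    have xS: "orb k x' \<in> S k \<longleftrightarrow> x' < real m - 1" and yS: "orb k y' \<in> S k \<longleftrightarrow> y' < real m - 1"
      using orb_mem_S [OF True] c' by (auto simp: m_def)
    have "\<not> (x' < real m - 1 \<and> real m - 1 \<le> y')"
    proof
      assume h: "x' < real m - 1 \<and> real m - 1 \<le> y'"
      obtain j where j: "j \<in> pieces" "orb k y' \<in> S j" using pieces_cover [OF orb_sphere [OF True]] by blast
      have "orb k x' \<in> S k" "orb k y' \<notin> S k" using h xS yS by auto
      then have "orb k x' \<notin> S j" using pieces_disjoint [OF k(1) j(1)] j(2) by blast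
      then show False using different_pieces [OF j orb_sphere [OF True]] nH by blast
    qed
    moreover have "\<not> (real m - 1 \<le> x' \<and> y' < real m - 1)"
      using different_pieces [OF k(1) _ orb_sphere [OF True], of "orb k y'" x'] xS yS nH by auto
    ultimately have e: "\<lfloor>x\<rfloor> = \<lfloor>y\<rfloor>" "x' = x + (real m - 1 - of_int \<lfloor>y\<rfloor>)" "y' = y + (real m - 1 - of_int \<lfloor>y\<rfloor>)"
      using c' by blast+
    define q where "q = nat \<lfloor>y\<rfloor>"
    have q: "real q = of_int \<lfloor>y\<rfloor>" using y(1) by (simp add: q_def)
    have qy: "real q \<le> y" "y < real q + 1" "real q \<le> x" "x < real q + 1"
      unfolding q using e(1) by linarith+
    have "real q < real m - 1" using qy y by linarith
    then have qm: "q < m - 1" by linarith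
    then have em: "real (m - 1 - q) = real m - 1 - of_int \<lfloor>y\<rfloor>" using q by (simp add: of_nat_diff)
    have "(k, q) \<in> exit_index" using k True qm by (simp add: exit_index_def m_def)
    moreover have "map_prod (exit_map (k, q)) (exit_map (k, q)) z = (F ^^ n) z"
      unfolding Fn e(2,3) em [symmetric] by (simp add: z x(3) y(3) exit_map_orb [OF True] m_def)
    moreover have "z \<in> exit_arc (k, q) \<times> exit_arc (k, q)"
      using True qy by (simp add: z x(3) y(3) exit_arc_def)
    ultimately show ?thesis using funpow_escaping [OF assms, of n] by (intro bexI [of _ "(k, q)"]) simp_all
  qed
qed

text \<open>The exits of an escaping orbit are fed into \<open>persistent_expansion\<close>, with
  the chord as the growing quantity. In the equality case both ends of the arc that the exit avoids
  would lie in the closure of the arc visited next.\<close>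

lemma escaping_empty: "escaping = {}"
proof (rule ccontr)
  assume "escaping \<noteq> {}"
  then obtain z where z: "z \<in> escaping" by blast
  let ?d = "\<lambda>z. dist (fst z) (snd z :: complex)"
  have finI: "finite exit_index" unfolding exit_index_def by (intro finite_SigmaI finite_pieces) auto
  have index_piece: "fst i \<in> pieces" if "i \<in> exit_index" for i
    using that by (cases rule: exit_index_cases) simp_all
  \<comment> \<open>An exit leaves \<open>S (\<sigma> k)\<close>, so the arc visited next is another
    one.\<close>
  have leaves: "\<sigma> (fst i) \<noteq> fst i'"
    if i: "i \<in> exit_index" "i' \<in> exit_index" and x: "x \<in> exit_arc i \<times> exit_arc i"
      "map_prod (exit_map i) (exit_map i) x \<in> exit_arc i' \<times> exit_arc i'" for i i' x
  proof
    assume eq: "\<sigma> (fst i) = fst i'"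
    have "exit_map i (fst x) \<in> exit_arc i'" using x(2) by (simp add: mem_Times_iff)
    then have "exit_map i (fst x) \<in> S (fst i')" by (rule subsetD [OF exit_closed_arc_subset(2) [OF i(2)]])
    moreover have "exit_map i (fst x) \<notin> S (\<sigma> (fst i))"
      by (rule exit_leaves [OF i(1)]) (use x(1) in \<open>simp add: mem_Times_iff\<close>)
    ultimately show False using eq by simp
  qed
  have "?d z \<le> 0"
  proof (rule persistent_expansion [where I = exit_index and C = "\<lambda>i. exit_closed_arc i \<times> exit_closed_arc i"
        and T = "\<lambda>i. map_prod (exit_map i) (exit_map i)" and L = "\<lambda>i. exit_arc i \<times> exit_arc i"
        and D = "{i. diametral (fst i)}" and S = escaping and d = ?d])
    show "finite exit_index" by (rule finI)
    show "continuous_on UNIV ?d" by (intro continuous_intros)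
    show "z \<in> escaping" by (rule z)
    show "\<exists>i\<in>exit_index. x \<in> exit_arc i \<times> exit_arc i \<and> map_prod (exit_map i) (exit_map i) x \<in> escaping"
      if "x \<in> escaping" for x by (rule escaping_exit [OF that])
    fix i assume i: "i \<in> exit_index"
    note sub = exit_closed_arc_subset [OF i]
    show "compact (exit_closed_arc i \<times> exit_closed_arc i)" by (intro compact_Times sub)
    show "exit_arc i \<times> exit_arc i \<subseteq> exit_closed_arc i \<times> exit_closed_arc i" using sub(1) by blast
    have ce: "continuous_on (exit_closed_arc i) (exit_map i)"
      by (rule continuous_on_subset [OF continuous_on_exit_map [OF i] sub(5)])
    have "continuous_on (exit_closed_arc i \<times> exit_closed_arc i) (\<lambda>z. (exit_map i (fst z), exit_map i (snd z)))"
      by (intro continuous_on_Pair continuous_on_compose2 [OF ce] continuous_on_fst continuous_on_snd continuous_on_id) auto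
    then show "continuous_on (exit_closed_arc i \<times> exit_closed_arc i) (map_prod (exit_map i) (exit_map i))"
      by (simp add: map_prod_def case_prod_beta)
    show "?d x \<le> ?d (map_prod (exit_map i) (exit_map i) x)" if "x \<in> exit_closed_arc i \<times> exit_closed_arc i" for x
      using exit_expansion(1) [OF i, of "fst x" "snd x"] that by (simp add: mem_Times_iff)
  next
    fix i i' x
    assume i: "i \<in> exit_index" "i' \<in> exit_index" and x: "x \<in> exit_arc i \<times> exit_arc i"
      "map_prod (exit_map i) (exit_map i) x \<in> exit_arc i' \<times> exit_arc i'" and d: "i \<in> {i. diametral (fst i)}"
    have ne: "\<sigma> (fst i) \<noteq> fst i'" by (rule leaves [OF i x])
    have "\<sigma> (fst i) = fst i" using d by (simp add: \<sigma>_def diametral_def)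
    then have "fst i' \<noteq> fst i" using ne by simp
    \<comment> \<open>A second diametral exit would have to take place at the same vertex, since
      there is only one diametral pair.\<close>
    then show "i' \<notin> {i. diametral (fst i)}" using d one_order_2 [of "fst i" "fst i'"] by (auto simp: diametral_def)
  next
    fix i i' x y
    assume i: "i \<in> exit_index - {i. diametral (fst i)}" "i' \<in> exit_index" and x: "x \<in> exit_arc i \<times> exit_arc i"
      "map_prod (exit_map i) (exit_map i) x \<in> exit_arc i' \<times> exit_arc i'"
      and y: "y \<in> exit_closed_arc i \<times> exit_closed_arc i"
      "map_prod (exit_map i) (exit_map i) y \<in> exit_closed_arc i' \<times> exit_closed_arc i'"
      and eq: "?d (map_prod (exit_map i) (exit_map i) y) = ?d y"
    have i1: "i \<in> exit_index" "\<not> diametral (fst i)" using i(1) by simp_all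
    have ne: "\<sigma> (fst i) \<noteq> fst i'" by (rule leaves [OF i1(1) i(2) x])
    have pc: "\<sigma> (fst i) \<in> pieces" "fst i' \<in> pieces"
      by (rule \<sigma>_pieces(1) [OF index_piece [OF i1(1)]], rule index_piece [OF i(2)])
    have y1: "fst y \<in> exit_closed_arc i" "snd y \<in> exit_closed_arc i" using y(1) by (simp_all add: mem_Times_iff)
    have y2: "exit_map i (fst y) \<in> exit_closed_arc i'" "exit_map i (snd y) \<in> exit_closed_arc i'"
      using y(2) by (simp_all add: mem_Times_iff)
    have eq': "dist (exit_map i (fst y)) (exit_map i (snd y)) = dist (fst y) (snd y)" using eq by simp
    have "fst y = snd y"
    proof (rule ccontr)
      assume nd: "fst y \<noteq> snd y"
      note X = exit_expansion(2) [OF i1(1) y1 eq' nd i1(2)]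
      have "{exit_map i (fst y), exit_map i (snd y)} \<subseteq> closure (S (fst i'))"
        using y2 exit_closed_arc_subset(3) [OF i(2)] by blast
      then have "{V (\<sigma> (fst i) - 1), V (top (\<sigma> (fst i)))} \<subseteq> closure (S (fst i'))"
        unfolding conjunct1 [OF X] .
      then show False
        using ends_in_other_piece [OF pc ne conjunct2 [OF X]] by simp
    qed
    then show "?d y \<le> 0" by simp
  qed
  moreover have "fst z \<noteq> snd z" using z by (auto simp: escaping_def off_diagonal_def)
  ultimately show False by simp
qed

lemma reaches_half_open_domain:
  assumes "z \<in> off_diagonal"
  obtains n where "(F ^^ n) z \<in> half_open_domain"
  using escaping_empty assms unfolding escaping_def by blast

text \<open>The half-open domain is contained in every iterated image, since \<open>F\<close>
  permutes it, and \<Omega> contains their intersection; so the closure of the intersection is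
  \<Omega>. The exceptional null set is the difference of the two sets.\<close>

lemma global_attractor_Omega:
  "global_attractor F off_diagonal (Omega g ms t \<gamma> A)"
  "z \<in> off_diagonal \<Longrightarrow> \<exists>K>0. (F ^^ K) z \<in> Omega g ms t \<gamma> A"
proof -
  let ?H = half_open_domain and ?O = "Omega g ms t \<gamma> A"
  have O: "?O = closure ?H" and null: "torus_null (?O - ?H)"
    using null_closure_half_open_domain unfolding Omega_eq null_closure_def by auto
  have HO: "?H \<subseteq> ?O" unfolding O by (rule closure_subset)
  have FH: "F ` ?H = ?H" using bij_betw_half_open_domain by (simp add: bij_betw_def)
  have inv: "F ` (?O \<inter> off_diagonal) \<subseteq> ?O \<inter> off_diagonal"
    using F_closed_domain F_off_diagonal unfolding O by blast
  have FnH: "(F ^^ n) ` ?H = ?H" for n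
  proof (induction n)
    case (Suc n)
    have "(F ^^ Suc n) ` ?H = F ` (F ^^ n) ` ?H" by (simp add: image_image)
    then show ?case unfolding Suc FH .
  qed simp
  have "?H \<subseteq> (\<Inter>n. (F ^^ n) ` (?O \<inter> off_diagonal))"
  proof (rule INT_greatest)
    fix n
    have "(F ^^ n) ` ?H \<subseteq> (F ^^ n) ` (?O \<inter> off_diagonal)"
      using HO half_open_domain_off_diagonal by (intro image_mono) blast
    then show "?H \<subseteq> (F ^^ n) ` (?O \<inter> off_diagonal)" unfolding FnH .
  qed
  moreover have "(\<Inter>n. (F ^^ n) ` (?O \<inter> off_diagonal)) \<subseteq> ?O"
  proof -
    have "(\<Inter>n. (F ^^ n) ` (?O \<inter> off_diagonal)) \<subseteq> (F ^^ 0) ` (?O \<inter> off_diagonal)" by (rule INT_lower) simp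
    also have "\<dots> \<subseteq> ?O" by simp
    finally show ?thesis .
  qed
  ultimately have X: "?O = closure (\<Inter>n. (F ^^ n) ` (?O \<inter> off_diagonal))"
  proof (intro subset_antisym)
    assume *: "?H \<subseteq> (\<Inter>n. (F ^^ n) ` (?O \<inter> off_diagonal))" "(\<Inter>n. (F ^^ n) ` (?O \<inter> off_diagonal)) \<subseteq> ?O"
    have "closed ?O" unfolding O by (rule closed_closure)
    then show "closure (\<Inter>n. (F ^^ n) ` (?O \<inter> off_diagonal)) \<subseteq> ?O" using *(2) by (intro closure_minimal)
    have "closure ?H \<subseteq> closure (\<Inter>n. (F ^^ n) ` (?O \<inter> off_diagonal))" by (rule closure_mono [OF *(1)])
    then show "?O \<subseteq> closure (\<Inter>n. (F ^^ n) ` (?O \<inter> off_diagonal))" by (simp only: O [symmetric])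
  qed
  have bij: "bij_betw F (?O - (?O - ?H)) (?O - (?O - ?H))"
    using bij_betw_half_open_domain HO by (simp add: double_diff)
  have reach: "\<exists>n. (F ^^ n) z \<in> ?O" if "z \<in> off_diagonal" for z
    using reaches_half_open_domain [OF that] HO by blast
  show "global_attractor F off_diagonal ?O"
    unfolding global_attractor_def
  proof (intro conjI)
    show "\<forall>x\<in>off_diagonal. \<exists>n. (F ^^ n) x \<in> ?O" using reach by blast
    show "\<exists>Z. torus_null Z \<and> bij_betw F (?O - Z) (?O - Z)" using null bij by blast
  qed (fact inv X)+
  show "\<exists>K>0. (F ^^ K) z \<in> ?O" if z: "z \<in> off_diagonal"
  proof -
    \<comment> \<open>The orbit is started at \<open>F z\<close> to make the number of steps
      positive.\<close>
    obtain n where "(F ^^ n) (F z) \<in> ?H" using reaches_half_open_domain [OF F_off_diagonal [OF z]] by blast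
    then have "(F ^^ Suc n) z \<in> ?O" using HO unfolding funpow_Suc_right by auto
    then show ?thesis by blast
  qed
qed

end

theorem theorem5p3:
  fixes g t :: nat and ms :: "nat list"
    and V A :: "nat \<Rightarrow> complex" and \<gamma> :: "nat \<Rightarrow> complex \<Rightarrow> complex"
  assumes "canonical_polygon g ms t V \<gamma>"
    and "boundary_partition g ms t V A"
    and "\<And>k. elliptic_index g ms k \<Longrightarrow> A k \<in> arc_cc (P_point V k) (Q_point V k)"
  defines "F \<equiv> natural_extension (num_sides g ms t) \<gamma> A"
  shows "global_attractor F off_diagonal (Omega g ms t \<gamma> A) \<and>
    (\<forall>u0 w0. (u0, w0) \<in> off_diagonal \<longrightarrow> (\<exists>K>0. (F ^^ K) (u0, w0) \<in> Omega g ms t \<gamma> A))"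
proof -
  interpret partitioned_polygon g ms t V \<gamma> A
    using assms(1,2) by (simp add: partitioned_polygon_def partitioned_polygon_axioms_def)
  show ?thesis
    using global_attractor_Omega unfolding F_def assms(4) by blast
qed

end
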